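(* Let $d\geq 1$, let $A,B\subseteq\mathbb{R}^d$ be convex bodies, and let $\pi:\mathbb{R}^d\to\mathbb{R}^d$ be a linear transformation with $\dim(\ker\pi)=1$. Put $M=|\pi(A)|$ and $N=|\pi(B)|$, the $(d-1)$-dimensional Lebesgue measures of the projections (which lie in the $(d-1)$-dimensional subspace $\pi(\mathbb{R}^d)$). Then $$|A+B|=\left(M^{1/(d-1)}+N^{1/(d-1)}\right)^{d-1}\left(\frac{|A|}{M}+\frac{|B|}{N}\right)$$ holds if and only if there are homothetic convex bodies $A',B'\subseteq\mathbb{R}^d$ such that $A$ is a stretching of $A'$ and $B$ is a stretching of $B'$, both with respect to $\pi$.
   Context: A convex body is a compact convex subset of $\mathbb{R}^d$ with nonempty interior; $|\cdot|$ denotes Lebesgue measure of the appropriate dimension and $A+B=\{a+b: a\in A, b\in B\}$. Two convex bodies $X,Y$ are homothetic if $X=\lambda Y+\mathbf v$ for some $\lambda>0$, $\mathbf v\in\mathbb{R}^d$. For $d=1$ the coefficients are interpreted by their limiting values, i.e. the formula reads $|A+B|=|A|+|B|$. Stretching: let $K=\pi(\mathbb{R}^d)$ and fix a nonzero $\mathbf u\in\ker\pi$, so every point of $\mathbb{R}^d$ is uniquely $y\mathbf u+\mathbf x$ with $y\in\mathbb{R}$, $\mathbf x\in K$. Let $P(A)\subseteq K$ be the projection of $A$ onto $K$ along $\mathbf u$. A convex body $A$ can be written as $A=\{y\mathbf u+\mathbf x:\mathbf x\in P(A),\ u_A(\mathbf x)\le y\le v_A(\mathbf x)\}$ with $u_A$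 convex and $v_A$ concave. A set $A''$ is a stretching of $A$ (with respect to $\pi$) of amount $h\ge 0$ if $A''=\{y\mathbf u+\mathbf x:\mathbf x\in P(A),\ u_A(\mathbf x)\le y\le v_A(\mathbf x)+h\}$; "$A$ is a stretching of $A'$" means this holds for some $h\ge0$. *)

theory Defs
  imports "HOL-Analysis.Analysis" "HOL-Library.Set_Algebras"
begin

definition convex_body :: "'a::euclidean_space set \<Rightarrow> bool" where
  "convex_body A \<longleftrightarrow> compact A \<and> convex A \<and> interior A \<noteq> {}"

definition homothetic_bodies :: "'a::euclidean_space set \<Rightarrow> 'a set \<Rightarrow> bool" where
  "homothetic_bodies X Y \<longleftrightarrow> (\<exists>c v. c > 0 \<and> X = (\<lambda>y. c *\<^sub>R y + v) ` Y)"

definition orthonormal_basis :: "'a::euclidean_space set \<Rightarrow> 'a set \<Rightarrow> bool" where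
  "orthonormal_basis S B \<longleftrightarrow>
     B \<subseteq> S \<and> span B = S \<and> pairwise orthogonal B \<and> (\<forall>b\<in>B. norm b = 1)"

text \<open>
  The \<open>dim S\<close>-dimensional Lebesgue measure on a linear subspace \<open>S\<close>, as a measure on the ambient
  space. It is built the way the library builds \<^const>\<open>lborel\<close>, with an orthonormal basis of \<open>S\<close>
  in place of \<^const>\<open>Basis\<close>. The measure does not depend on which orthonormal basis is chosen.
  For \<open>S = {0}\<close> the basis is empty and the result is the unit mass at \<open>0\<close>.
\<close>
definition subspace_lebesgue :: "'a::euclidean_space set \<Rightarrow> 'a measure" where
  "subspace_lebesgue S =
     (let B = (SOME B. orthonormal_basis S B)
      in completion (distr (\<Pi>\<^sub>M b\<in>B. lborel) borel (\<lambda>f. \<Sum>b\<in>B. f b *\<^sub>R b)))"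

text \<open>
  Here \<open>K\<close> is any linear complement of the line spanned by \<open>u\<close>. In the stretching construction
  \<open>u\<close> spans the kernel of a linear map \<open>\<pi>\<close>, and \<open>K = range \<pi>\<close> is such a complement unless
  \<open>u \<in> range \<pi>\<close>, as happens for nonzero nilpotent \<open>\<pi>\<close>; see \<open>line_complement_range\<close> and
  \<open>line_complement_orthogonal\<close> below.
\<close>
definition line_complement :: "'a::euclidean_space \<Rightarrow> 'a set \<Rightarrow> bool" where
  "line_complement u K \<longleftrightarrow>
     subspace K \<and> (\<forall>z. \<exists>!(y::real, x). x \<in> K \<and> z = y *\<^sub>R u + x)"

definition proj_along :: "'a::euclidean_space \<Rightarrow> 'a set \<Rightarrow> 'a set \<Rightarrow> 'a set" where
  "proj_along u K A = {x \<in> K. \<exists>y. y *\<^sub>R u + x \<in> A}"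

text \<open>
  For \<open>x\<close> in the projection of a convex body \<open>A\<close>, the fibre \<open>{y. y *\<^sub>R u + x \<in> A}\<close> is a nonempty
  compact interval; the next two functions are its endpoints.
\<close>
definition lower_bd :: "'a::euclidean_space \<Rightarrow> 'a set \<Rightarrow> 'a \<Rightarrow> real" where
  "lower_bd u A x = Inf {y. y *\<^sub>R u + x \<in> A}"

definition upper_bd :: "'a::euclidean_space \<Rightarrow> 'a set \<Rightarrow> 'a \<Rightarrow> real" where
  "upper_bd u A x = Sup {y. y *\<^sub>R u + x \<in> A}"

definition stretch :: "'a::euclidean_space \<Rightarrow> 'a set \<Rightarrow> real \<Rightarrow> 'a set \<Rightarrow> 'a set" where
  "stretch u K h A =
     {y *\<^sub>R u + x | y x. x \<in> proj_along u K A \<and> lower_bd u A x \<le> y \<and> y \<le> upper_bd u A x + h}"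

definition is_stretching :: "'a::euclidean_space \<Rightarrow> 'a set \<Rightarrow> 'a set \<Rightarrow> 'a set \<Rightarrow> bool" where
  "is_stretching u K A A' \<longleftrightarrow> (\<exists>h\<ge>0. A = stretch u K h A')"

text \<open>
  In dimension one the exponent \<open>1/(d-1)\<close> has no value and the expression is read as \<open>a + b\<close>.
\<close>
definition bonnesen_bound :: "nat \<Rightarrow> real \<Rightarrow> real \<Rightarrow> real \<Rightarrow> real \<Rightarrow> real" where
  "bonnesen_bound d M N a b =
     (if d = 1 then a + b
      else (M powr (1 / (real d - 1)) + N powr (1 / (real d - 1))) ^ (d - 1) * (a / M + b / N))"

lemma line_complementI:
  assumes K: "subspace K" and u: "u \<notin> K" and ex: "\<And>z. \<exists>y x. x \<in> K \<and> z = y *\<^sub>R u + x"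
  shows "line_complement u K"
  unfolding line_complement_def
proof (intro conjI allI K)
  fix z
  obtain y x where yx: "x \<in> K" "z = y *\<^sub>R u + x" using ex by blast
  have "(y', x') = (y, x)" if "x' \<in> K" "z = y' *\<^sub>R u + x'" for y' x'
  proof -
    have eq: "(y' - y) *\<^sub>R u = x - x'" using that yx by (simp add: algebra_simps)
    then have "(y' - y) *\<^sub>R u \<in> K" using K yx that by (simp add: subspace_diff)
    then have "y' = y" using u subspace_scale[OF K, of "(y' - y) *\<^sub>R u" "inverse (y' - y)"]
      by (cases "y' = y") auto
    then show ?thesis using eq by simp
  qed
  then show "\<exists>!(y, x). x \<in> K \<and> z = y *\<^sub>R u + x"
    using yx by (intro ex1I[of _ "(y, x)"]) auto
qed

lemma line_complement_orthogonal:
  assumes "u \<noteq> 0"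
  shows "line_complement u {x. u \<bullet> x = 0}"
proof (rule line_complementI)
  show "subspace {x. u \<bullet> x = 0}" by (simp add: subspace_hyperplane)
  show "u \<notin> {x. u \<bullet> x = 0}" using assms by simp
  show "\<exists>y x. x \<in> {x. u \<bullet> x = 0} \<and> z = y *\<^sub>R u + x" for z
    using assms by (intro exI[of _ "(u \<bullet> z) / (u \<bullet> u)"]
      exI[of _ "z - ((u \<bullet> z) / (u \<bullet> u)) *\<^sub>R u"]) (simp add: inner_diff_right)
qed

lemma line_complement_range:
  fixes \<pi> :: "'a::euclidean_space \<Rightarrow> 'a"
  assumes \<pi>: "linear \<pi>" and ker: "dim {x. \<pi> x = 0} = 1" and u: "\<pi> u = 0" "u \<notin> range \<pi>"
  shows "line_complement u (range \<pi>)"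
proof (rule line_complementI)
  show S: "subspace (range \<pi>)" using \<pi> linear_subspace_image subspace_UNIV by blast
  show "u \<notin> range \<pi>" by fact
  have u0: "u \<noteq> 0" using u(2) S subspace_0 by blast
  have "span {u} = span {x. \<pi> x = 0}"
    using u(1) ker u0 by (intro dim_eq_span) auto
  then have kerline: "\<exists>c. x = c *\<^sub>R u" if "\<pi> x = 0" for x
    using that span_base[of x "{x. \<pi> x = 0}"] by (auto simp: span_singleton)
  have "inj_on \<pi> (range \<pi>)"
  proof (rule inj_onI)
    fix x y assume xy: "x \<in> range \<pi>" "y \<in> range \<pi>" "\<pi> x = \<pi> y"
    then obtain c where c: "x - y = c *\<^sub>R u" using kerline[of "x - y"] \<pi> by (auto simp: linear_diff)
    have "c *\<^sub>R u \<in> range \<pi>" using xy S c subspace_diff by metis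
    then show "x = y" using u(2) subspace_scale[OF S, of "c *\<^sub>R u" "inverse c"] c
      by (cases "c = 0") auto
  qed
  then have "dim (\<pi> ` range \<pi>) = dim (range \<pi>)"
    using S \<pi> by (intro dim_image_eq) (auto simp: span_eq_iff[THEN iffD2])
  then have onto: "\<pi> ` range \<pi> = range \<pi>"
    using S \<pi> linear_subspace_image[OF \<pi> S] by (intro subspace_dim_equal) auto
  show "\<exists>y x. x \<in> range \<pi> \<and> z = y *\<^sub>R u + x" for z
  proof -
    obtain x where x: "x \<in> range \<pi>" "\<pi> x = \<pi> z" using onto by (metis imageE rangeI)
    then obtain c where "z - x = c *\<^sub>R u" using kerline[of "z - x"] \<pi> by (auto simp: linear_diff)
    then have "z = c *\<^sub>R u + x" by (simp add: algebra_simps)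
    with x show ?thesis by blast
  qed
qed

text \<open>The right-hand side does not mention \<open>K\<close>: the choice of complement is immaterial.\<close>
lemma stretch_eq:
  assumes A: "convex_body A" and K: "line_complement u K" and h: "h \<ge> 0"
  shows "stretch u K h A = {a + t *\<^sub>R u | a t. a \<in> A \<and> 0 \<le> t \<and> t \<le> h}"
proof -
  have u0: "u \<noteq> 0"
  proof
    assume "u = 0"
    with K have "\<exists>!(y::real, x). x \<in> K \<and> 0 = x" and "0 \<in> K"
      unfolding line_complement_def by (auto simp: subspace_0)
    then have "(0::real, 0::'a) = (1, 0)" by blast
    then show False by simp
  qed
  have fib: "compact {y. y *\<^sub>R u + x \<in> A}" "convex {y. y *\<^sub>R u + x \<in> A}" for x
  proof -
    have "compact A" "convex A" using A by (auto simp: convex_body_def)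
    then obtain r where r: "\<And>a. a \<in> A \<Longrightarrow> norm a \<le> r"
      using compact_imp_bounded bounded_iff by metis
    have "norm y \<le> (r + norm x) / norm u" if "y *\<^sub>R u + x \<in> A" for y
    proof -
      have "norm (y *\<^sub>R u) \<le> norm (y *\<^sub>R u + x) + norm x"
        by (metis add_diff_cancel norm_triangle_ineq4)
      with r[OF that] u0 show ?thesis by (simp add: field_simps)
    qed
    then have "bounded {y. y *\<^sub>R u + x \<in> A}" unfolding bounded_iff by blast
    moreover have "closed ((\<lambda>y. y *\<^sub>R u + x) -` A)"
      using compact_imp_closed[OF \<open>compact A\<close>]
      by (intro continuous_closed_vimage) (auto intro!: continuous_intros)
    ultimately show "compact {y. y *\<^sub>R u + x \<in> A}"
      by (simp add: compact_eq_bounded_closed vimage_def)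
    show "convex {y. y *\<^sub>R u + x \<in> A}"
    proof (rule convexI)
      fix y z and s t :: real
      assume *: "y \<in> {y. y *\<^sub>R u + x \<in> A}" "z \<in> {y. y *\<^sub>R u + x \<in> A}" "0 \<le> s" "0 \<le> t" "s + t = 1"
      then have "s *\<^sub>R (y *\<^sub>R u + x) + t *\<^sub>R (z *\<^sub>R u + x) \<in> A"
        using convexD[OF \<open>convex A\<close>] by blast
      moreover have "s *\<^sub>R (y *\<^sub>R u + x) + t *\<^sub>R (z *\<^sub>R u + x)
                     = (s * y + t * z) *\<^sub>R u + (s + t) *\<^sub>R x"
        by (simp add: algebra_simps)
      ultimately show "s *\<^sub>R y + t *\<^sub>R z \<in> {y. y *\<^sub>R u + x \<in> A}" using *(5) by simp
    qed
  qed
  show ?thesis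
  proof (intro equalityI subsetI)
    fix z assume "z \<in> stretch u K h A"
    then obtain y x y0 where z: "z = y *\<^sub>R u + x" "y0 *\<^sub>R u + x \<in> A"
      "lower_bd u A x \<le> y" "y \<le> upper_bd u A x + h"
      unfolding stretch_def proj_along_def by blast
    let ?F = "{y. y *\<^sub>R u + x \<in> A}"
    have ne: "?F \<noteq> {}" using z(2) by blast
    have S: "upper_bd u A x \<in> ?F" and I: "lower_bd u A x \<in> ?F"
      unfolding upper_bd_def lower_bd_def
      using fib(1)[of x] ne closed_contains_Sup[of ?F] closed_contains_Inf[of ?F]
      by (simp_all only: compact_imp_closed compact_imp_bounded bounded_imp_bdd_above
          bounded_imp_bdd_below simp_thms)
    show "z \<in> {a + t *\<^sub>R u | a t. a \<in> A \<and> 0 \<le> t \<and> t \<le> h}"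
    proof (cases "y \<le> upper_bd u A x")
      case True
      have "is_interval ?F" using fib(2) is_interval_convex_1 by blast
      then have "y \<in> ?F" using mem_is_interval_1_I[OF _ I S] z(3) True by blast
      then show ?thesis using z(1) h by (intro CollectI exI[of _ z] exI[of _ 0]) auto
    next
      case False
      then show ?thesis using S z
        by (intro CollectI exI[of _ "upper_bd u A x *\<^sub>R u + x"] exI[of _ "y - upper_bd u A x"])
          (auto simp: algebra_simps)
    qed
  next
    fix z assume "z \<in> {a + t *\<^sub>R u | a t. a \<in> A \<and> 0 \<le> t \<and> t \<le> h}"
    then obtain a t where a: "z = a + t *\<^sub>R u" "a \<in> A" "0 \<le> t" "t \<le> h" by blast
    obtain y x where x: "x \<in> K" "a = y *\<^sub>R u + x"
      using K unfolding line_complement_def by blast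
    let ?F = "{y. y *\<^sub>R u + x \<in> A}"
    have "y \<in> ?F" using a x by simp
    then have "lower_bd u A x \<le> y" "y \<le> upper_bd u A x"
      unfolding upper_bd_def lower_bd_def using compact_imp_bounded[OF fib(1)[of x]]
      by (auto intro!: cInf_lower cSup_upper intro: bounded_imp_bdd_above bounded_imp_bdd_below)
    then show "z \<in> stretch u K h A"
      unfolding stretch_def proj_along_def using a x
      by (intro CollectI exI[of _ "y + t"] exI[of _ x]) (auto simp: algebra_simps)
  qed
qed

end

theory Submission
  imports Defs
begin

text \<open>
  Let \<open>w\<close> span the kernel, and call the orthogonal projection of a body along \<open>w\<close> its shadow. The fibre
  lengths \<open>f\<close>, \<open>g\<close>, \<open>h\<close> of \<open>A\<close>, \<open>B\<close>, \<open>A + B\<close> over the shadows \<open>P\<close>, \<open>Q\<close>, \<open>P + Q\<close> satisfy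
  \<open>f x + g y \<le> h (x + y)\<close>, and Bonnesen's inequality is the functional statement
  \<open>\<integral> h \<ge> (\<mu> + \<nu>)^m (avg\<^sub>P f + avg\<^sub>Q g)\<close> with \<open>\<mu>^m = \<bar>P\<bar>\<close>, \<open>\<nu>^m = \<bar>Q\<bar>\<close>. It follows by induction on \<open>m\<close>: slice in one
  coordinate, couple the slices of \<open>P\<close> and \<open>Q\<close> that cut off equal proportions of volume, and apply
  the tangent-line inequality for \<open>z^m\<close>. Equality forces this coupling to be affine with slope \<open>\<nu> / \<mu>\<close>
  in every direction; the translation part is read off from the centroids, hence is linear in the
  direction, so the support functions show that \<open>Q\<close> is homothetic to \<open>P\<close>. The case \<open>f = g = 1/2\<close>
  is the equality case of Brunn--Minkowski.

  If equality holds for \<open>A\<close>, \<open>B\<close>, then their shadows are homothetic. Stretching one of the two bodies until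
  the volumes per unit of shadow are in the ratio \<open>\<mu> : \<nu>\<close> turns Bonnesen equality into Brunn--Minkowski equality,
  so the stretched body and the other one are homothetic.
\<close>

subsection \<open>Couplings of one-dimensional densities\<close>

text \<open>Only superadditivity of the triple \<open>f\<close>, \<open>g\<close>, \<open>h\<close>
  enters, a property that slices inherit. The equality case is not carried through the induction:
  only the last slicing step is examined, and it speaks about one coordinate. Every unit vector can
  serve as that coordinate once volumes and averages are free of a basis, which is why integrals
  over a complement are defined in the ambient space. Each direction leaves an unknown additive
  constant in the affine coupling; comparing first moments identifies it.

  Equality yields information only where \<open>f\<close> is positive. Fibre lengths may vanish over
  the boundary of a shadow, so the argument runs with interiors, and closures restore the bodies.

  Stretching by an amount \<open>h\<close> adds \<open>h\<close> times the measure of the shadow to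
  the volume. For the sum of the stretched bodies to have the right volume, the shadow of
  \<open>A + B\<close> must have radius \<open>\<mu> + \<nu>\<close>; hence the homothety of the
  shadows has to be settled before any stretching.\<close>

lemma power_Suc_tangent_gap:
  fixes z w :: real
  assumes "z > 0" "w > 0"
  shows "z ^ Suc n - (real n + 1) * w ^ n * z + real n * w ^ Suc n \<ge> real n * w ^ (n - 1) * (z - w)\<^sup>2"
proof (induction n)
  case (Suc n)
  \<comment> \<open>\<open>?D n\<close> is the gap between \<open>z ^ Suc n\<close> and its tangent
    line at \<open>w\<close>. In the recursion below, the term added to \<open>z * ?D n\<close> is
    already the claimed bound for \<open>Suc n\<close>.\<close>
  let ?D = "\<lambda>n. z ^ Suc n - (real n + 1) * w ^ n * z + real n * w ^ Suc n"
  have "0 \<le> real n * w ^ (n - 1) * (z - w)\<^sup>2" using assms by simp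
  then have "0 \<le> z * ?D n" using Suc assms by (intro mult_nonneg_nonneg) linarith+
  moreover have "?D (Suc n) = z * ?D n + real (Suc n) * w ^ n * (z - w)\<^sup>2"
    by (simp add: power2_eq_square algebra_simps)
  ultimately show ?case by simp
qed simp

text \<open>Jensen's inequality for \<open>z ^ Suc n\<close> with weights \<open>a / (a + b)\<close>
  and \<open>b / (a + b)\<close>, applied to the points \<open>\<mu> / x\<close> and
  \<open>\<nu> / y\<close>, whose mean is \<open>\<mu> + \<nu>\<close>. With slice radii
  \<open>a\<close> and \<open>b\<close>, the quotients \<open>\<mu> ^ Suc n / a ^ n\<close> and
  \<open>\<nu> ^ Suc n / b ^ n\<close> are the derivatives of the quantile maps, so the second claim
  fixes their ratio as \<open>\<mu> : \<nu>\<close>.\<close>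

lemma power_sum_bound:
  fixes a b \<mu> \<nu> :: real
  assumes pos: "a > 0" "b > 0" "\<mu> > 0" "\<nu> > 0"
  shows "(\<mu> + \<nu>) ^ Suc n \<le> (a + b) ^ n * (\<mu> ^ Suc n / a ^ n + \<nu> ^ Suc n / b ^ n)" (is "?l \<le> ?r")
    and "(\<mu> + \<nu>) ^ Suc n = (a + b) ^ n * (\<mu> ^ Suc n / a ^ n + \<nu> ^ Suc n / b ^ n)
      \<Longrightarrow> \<nu> * (\<mu> ^ Suc n / a ^ n) = \<mu> * (\<nu> ^ Suc n / b ^ n)"
proof -
  define x y where "x = a / (a + b)" and "y = b / (a + b)"
  have xy: "x > 0" "y > 0" "x + y = 1" using pos by (auto simp: x_def y_def add_divide_distrib[symmetric])
  define w where "w = \<mu> + \<nu>"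
  have w: "w > 0" using pos by (simp add: w_def)
  define D where "D z = z ^ Suc n - (real n + 1) * w ^ n * z + real n * w ^ Suc n" for z
  define G where "G z = real n * w ^ (n - 1) * (z - w)\<^sup>2" for z :: real
  have DG: "D z \<ge> G z" if "z > 0" for z unfolding D_def G_def using power_Suc_tangent_gap[OF that w] .
  have G0: "G z \<ge> 0" for z unfolding G_def using w by simp
  have z: "\<mu> / x > 0" "\<nu> / y > 0" using xy pos by auto
  have aux: "(a + b) ^ n * (\<mu> ^ Suc n / a ^ n) = x * (\<mu> / x) ^ Suc n"
    "(a + b) ^ n * (\<nu> ^ Suc n / b ^ n) = y * (\<nu> / y) ^ Suc n"
  proof -
    have gen: "(a + b) ^ n * (m ^ Suc n / c ^ n) = w * (m / w) ^ Suc n"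
      if "c > 0" "w = c / (a + b)" for m c w :: real
    proof -
      have "m / w = (a + b) * m / c" "w \<noteq> 0" using that pos by (simp_all add: mult.commute)
      then have "w * (m / w) ^ Suc n = m * ((a + b) * m / c) ^ n"
        by (metis nonzero_mult_div_cancel_left mult.assoc power_Suc times_divide_eq_right)
      then show ?thesis by (simp only: power_divide power_mult_distrib power_Suc) (simp add: ac_simps)
    qed
    show "(a + b) ^ n * (\<mu> ^ Suc n / a ^ n) = x * (\<mu> / x) ^ Suc n" by (rule gen[OF pos(1) x_def])
    show "(a + b) ^ n * (\<nu> ^ Suc n / b ^ n) = y * (\<nu> / y) ^ Suc n" by (rule gen[OF pos(2) y_def])
  qed
  have "x * D (\<mu> / x) + y * D (\<nu> / y)
      = x * (\<mu> / x) ^ Suc n + y * (\<nu> / y) ^ Suc n - (real n + 1) * w ^ n * (x * (\<mu> / x) + y * (\<nu> / y))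
        + (x + y) * (real n * w ^ Suc n)"
    unfolding D_def by (simp add: algebra_simps)
  also have "x * (\<mu> / x) + y * (\<nu> / y) = w" using xy by (simp add: w_def)
  finally have eq: "x * D (\<mu> / x) + y * D (\<nu> / y) = ?r - ?l"
    unfolding distrib_left aux using xy by (simp add: w_def[symmetric] algebra_simps)
  have nn: "D (\<mu> / x) \<ge> 0" "D (\<nu> / y) \<ge> 0" using DG[OF z(1)] DG[OF z(2)] G0 order_trans by blast+
  then show "?l \<le> ?r" using eq xy by (smt (verit) mult_nonneg_nonneg)
  assume "?l = ?r"
  then have "x * D (\<mu> / x) + y * D (\<nu> / y) = 0" using eq by simp
  then have "D (\<mu> / x) = 0" "D (\<nu> / y) = 0"
    using nn xy by (smt (verit) mult_nonneg_nonneg mult_pos_pos)+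
  then have "G (\<mu> / x) = 0" "G (\<nu> / y) = 0" using DG[OF z(1)] DG[OF z(2)] G0 by (smt (verit))+
  \<comment> \<open>For \<open>n = 0\<close> the quadratic remainder is zero and gives no
    information; the conclusion is then the identity
    \<open>\<nu> * \<mu> = \<mu> * \<nu>\<close>.\<close>
  then have "n = 0 \<or> (\<mu> / x = w \<and> \<nu> / y = w)" using w by (auto simp: G_def)
  then show "\<nu> * (\<mu> ^ Suc n / a ^ n) = \<mu> * (\<nu> ^ Suc n / b ^ n)"
  proof
    assume *: "\<mu> / x = w \<and> \<nu> / y = w"
    have 1: "\<mu> / a = w / (a + b)" "\<nu> / b = w / (a + b)"
      using * pos by (auto simp: x_def y_def field_simps)
    have "\<mu> ^ Suc n / a ^ n = \<mu> * (\<mu> / a) ^ n" "\<nu> ^ Suc n / b ^ n = \<nu> * (\<nu> / b) ^ n"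
      by (simp_all add: power_divide)
    then show ?thesis unfolding 1 by simp
  qed simp
qed

text \<open>The derivative is continuous on the open interval only and may blow up at the ends, as
  it does for quantile maps where slices shrink to nothing. The formula is first proved for
  indicators through absolute integrability; this identifies two measures, and integrating against
  them gives every nonnegative measurable function.\<close>

lemma nn_integral_substitution_open:
  fixes q q' :: "real \<Rightarrow> real" and f :: "real \<Rightarrow> ennreal"
  assumes der: "\<And>x. x \<in> {a<..<b} \<Longrightarrow> (q has_real_derivative q' x) (at x)"
    and pos: "\<And>x. x \<in> {a<..<b} \<Longrightarrow> q' x > 0"
    and cont: "continuous_on {a<..<b} q'"
    and bd: "bounded (q ` {a<..<b})" and inj: "inj_on q {a<..<b}"
    and f[measurable]: "f \<in> borel_measurable borel"
  shows "(\<integral>\<^sup>+y. f y * indicator (q ` {a<..<b}) y \<partial>lborel)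
       = (\<integral>\<^sup>+x\<in>{a<..<b}. f (q x) * ennreal (q' x) \<partial>lborel)"
proof -
  let ?I = "{a<..<b}"
  \<comment> \<open>Extension by zero makes both functions Borel on the whole line; the zero density
    discards everything outside \<open>?I\<close>.\<close>
  define qq where "qq x = (if x \<in> ?I then q x else 0)" for x
  define qd where "qd x = (if x \<in> ?I then q' x else 0)" for x
  have qd0: "qd x \<ge> 0" for x using pos by (simp add: qd_def less_imp_le)
  have cq: "continuous_on ?I q"
    using der by (meson DERIV_isCont continuous_at_imp_continuous_on)
  have op: "open (q ` ?I)"
    using injective_into_1d_imp_open_map_UNIV[OF _ cq inj] by auto
  then have [measurable]: "q ` ?I \<in> sets borel" by auto
  have [measurable]: "qq \<in> borel_measurable borel" "qd \<in> borel_measurable borel"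
    unfolding qq_def[abs_def] qd_def[abs_def] by (rule borel_measurable_continuous_on_if, rule borel_open, rule open_greaterThanLessThan, fact, rule continuous_on_const)+
  have fin: "emeasure lborel (q ` ?I) < \<infinity>" by (rule emeasure_bounded_finite[OF bd])
  have E: "density lborel (indicator (q ` ?I)) = distr (density lborel (\<lambda>x. ennreal (qd x))) borel qq"
  proof (rule measure_eqI)
    fix X assume "X \<in> sets (density lborel (indicator (q ` ?I)))"
    then have [measurable]: "X \<in> sets borel" by simp
    have finX: "emeasure lborel (X \<inter> q ` ?I) \<noteq> top"
      using emeasure_mono[of "X \<inter> q ` ?I" "q ` ?I" lborel] fin by (auto simp: top_unique)
    have lm: "X \<inter> q ` ?I \<in> lmeasurable"
      using fin by (intro fmeasurableI) (auto intro: le_less_trans[OF emeasure_mono])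
    have "indicat_real X absolutely_integrable_on q ` ?I \<and>
        integral (q ` ?I) (indicat_real X) = measure lebesgue (X \<inter> q ` ?I)"
    proof
      have hi: "(indicat_real X has_integral measure lebesgue (X \<inter> q ` ?I)) (q ` ?I)"
      proof -
        have "((\<lambda>x. indicat_real (X \<inter> q ` ?I) x) has_integral measure lebesgue (X \<inter> q ` ?I)) UNIV"
          using lm by (simp add: has_integral_measure_lborel lmeasurable_iff_has_integral)
        moreover have "indicat_real (X \<inter> q ` ?I) = (\<lambda>x. if x \<in> q ` ?I then indicat_real X x else 0)"
          by (auto simp: indicator_def)
        ultimately show ?thesis by (simp add: has_integral_restrict_UNIV)
      qed
      then show "indicat_real X absolutely_integrable_on q ` ?I"
        by (intro nonnegative_absolutely_integrable_1) auto
      show "integral (q ` ?I) (indicat_real X) = measure lebesgue (X \<inter> q ` ?I)"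
        using hi by (rule integral_unique)
    qed
    then have ai: "(\<lambda>x. \<bar>q' x\<bar> * indicat_real X (q x)) absolutely_integrable_on ?I"
      and ie: "integral ?I (\<lambda>x. \<bar>q' x\<bar> * indicat_real X (q x)) = measure lebesgue (X \<inter> q ` ?I)"
      using has_absolute_integral_change_of_variables_1'[of ?I q q' "indicat_real X" "measure lebesgue (X \<inter> q ` ?I)"]
        der inj by (auto intro: DERIV_subset)
    have "((\<lambda>x. \<bar>q' x\<bar> * indicat_real X (q x)) has_integral measure lebesgue (X \<inter> q ` ?I)) ?I"
      using ai ie by (metis integrable_integral set_lebesgue_integral_eq_integral(1))
    then have "((\<lambda>x. if x \<in> ?I then \<bar>q' x\<bar> * indicat_real X (q x) else 0) has_integral measure lebesgue (X \<inter> q ` ?I)) UNIV"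
      by (simp only: has_integral_restrict_UNIV)
    also have "(\<lambda>x. if x \<in> ?I then \<bar>q' x\<bar> * indicat_real X (q x) else 0) = (\<lambda>x. qd x * indicat_real X (qq x))"
      using pos by (auto simp: qd_def qq_def abs_of_pos)
    finally have "(\<integral>\<^sup>+x. ennreal (qd x * indicat_real X (qq x)) \<partial>lborel) = ennreal (measure lebesgue (X \<inter> q ` ?I))"
      by (intro nn_integral_has_integral_lborel) (use qd0 in simp_all)
    also have "ennreal (measure lebesgue (X \<inter> q ` ?I)) = emeasure lborel (X \<inter> q ` ?I)"
      using finX by (simp add: emeasure_eq_ennreal_measure)
    finally have *: "(\<integral>\<^sup>+x. ennreal (qd x * indicat_real X (qq x)) \<partial>lborel) = emeasure lborel (X \<inter> q ` ?I)" .
    have "emeasure (distr (density lborel (\<lambda>x. ennreal (qd x))) borel qq) X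
        = (\<integral>\<^sup>+x. ennreal (qd x) * indicator (qq -` X) x \<partial>lborel)"
      by (simp add: emeasure_distr) (subst emeasure_density, auto intro!: measurable_sets_borel[of qq borel])
    also have "\<dots> = (\<integral>\<^sup>+x. ennreal (qd x * indicat_real X (qq x)) \<partial>lborel)"
      by (intro nn_integral_cong) (auto simp: indicator_def)
    also have "\<dots> = emeasure (density lborel (indicator (q ` ?I))) X"
      unfolding * by (subst emeasure_density) (auto simp: indicator_inter_arith[symmetric] Int_commute)
    finally show "emeasure (density lborel (indicator (q ` ?I))) X =
      emeasure (distr (density lborel (\<lambda>x. ennreal (qd x))) borel qq) X" ..
  qed simp
  have "(\<integral>\<^sup>+y. f y * indicator (q ` ?I) y \<partial>lborel) = (\<integral>\<^sup>+y. f y \<partial>density lborel (indicator (q ` ?I)))"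
    by (subst nn_integral_density) (auto simp: mult.commute)
  also have "\<dots> = (\<integral>\<^sup>+x. ennreal (qd x) * f (qq x) \<partial>lborel)"
    unfolding E by (subst nn_integral_distr) (auto simp: nn_integral_density)
  also have "\<dots> = (\<integral>\<^sup>+x\<in>{a<..<b}. f (q x) * ennreal (q' x) \<partial>lborel)"
    by (intro nn_integral_cong) (auto simp: qd_def qq_def mult.commute)
  finally show ?thesis .
qed

text \<open>\<open>q\<close> inverts the normalised primitive \<open>F\<close> of the density. Since
  \<open>F\<close> has the nonzero derivative \<open>\<alpha> t / M\<close> inside the interval, the
  inverse function theorem differentiates \<open>q\<close>.\<close>

lemma quantile_exists:
  fixes \<alpha> :: "real \<Rightarrow> real"
  assumes t: "t0 < t1" and cont: "continuous_on {t0<..<t1} \<alpha>"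
    and pos: "\<And>t. t \<in> {t0<..<t1} \<Longrightarrow> \<alpha> t > 0"
    and M: "(\<integral>\<^sup>+t\<in>{t0<..<t1}. ennreal (\<alpha> t) \<partial>lborel) = ennreal M" "M > 0"
  obtains q where "q ` {0<..<1} = {t0<..<t1}" "strict_mono_on {0<..<1} q"
    "\<And>\<tau>. \<tau> \<in> {0<..<1} \<Longrightarrow> (q has_real_derivative M / \<alpha> (q \<tau>)) (at \<tau>)"
proof -
  define al where "al t = (if t \<in> {t0<..<t1} then \<alpha> t else 0)" for t
  have [measurable]: "al \<in> borel_measurable borel"
    unfolding al_def[abs_def] by (rule borel_measurable_continuous_on_if, rule borel_open, rule open_greaterThanLessThan, rule cont, rule continuous_on_const)
  have al0: "al t \<ge> 0" for t using pos by (simp add: al_def less_imp_le)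
  have "(\<integral>\<^sup>+t. ennreal (al t) \<partial>lborel) = ennreal M"
    unfolding M(1)[symmetric] by (intro nn_integral_cong) (auto simp: al_def)
  then have hiU: "(al has_integral M) UNIV"
    using al0 M(2) by (intro nn_integral_has_integral) auto
  have "(\<lambda>t. if t \<in> {t0..t1} then al t else 0) = al" by (auto simp: al_def)
  then have hi: "(al has_integral M) {t0..t1}" using hiU has_integral_restrict_UNIV[of "{t0..t1}" al M] by simp
  define F where "F t = integral {t0..t} al / M" for t
  have F0: "F t0 = 0" and F1: "F t1 = 1" using hi M(2) by (simp_all add: F_def integral_unique)
  have cF: "continuous_on {t0..t1} F"
    unfolding F_def using M(2) hi by (intro continuous_intros indefinite_integral_continuous_1) auto
  have dF: "(F has_real_derivative \<alpha> t / M) (at t)" if t: "t \<in> {t0<..<t1}" for t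
  proof -
    have "continuous (at t) \<alpha>" using cont t by (simp add: continuous_on_eq_continuous_at)
    moreover have "\<forall>\<^sub>F x in nhds t. al x = \<alpha> x"
      by (rule eventually_mono[OF eventually_nhds_in_open[of "{t0<..<t1}" t]]) (use t in \<open>auto simp: al_def\<close>)
    ultimately have "continuous (at t) al" by (simp add: isCont_cong)
    then have c: "continuous (at t within ({t0..t1} - {})) al" by (rule continuous_at_imp_continuous_within)
    have "al integrable_on {t0..t1}" "t \<in> {t0..t1} - {}" using hi t by auto
    from integral_has_vector_derivative_continuous_at[OF this _ c]
    have "((\<lambda>u. integral {t0..u} al) has_vector_derivative al t) (at t within {t0..t1})" by simp
    then have "((\<lambda>u. integral {t0..u} al) has_vector_derivative al t) (at t within {t0<..<t1})"
      by (rule has_vector_derivative_within_subset) auto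
    moreover have "al t = \<alpha> t" using t by (simp add: al_def)
    ultimately have "((\<lambda>u. integral {t0..u} al) has_real_derivative \<alpha> t) (at t within {t0<..<t1})"
      by (metis has_real_derivative_iff_has_vector_derivative)
    then have "((\<lambda>u. integral {t0..u} al) has_real_derivative \<alpha> t) (at t)"
      using at_within_open[OF t] by simp
    then show ?thesis unfolding F_def by (rule DERIV_cdivide)
  qed
  have mono: "F x < F y" if "t0 \<le> x" "x < y" "y \<le> t1" for x y
  proof (rule DERIV_pos_imp_increasing_open[OF that(2)])
    fix t assume "x < t" "t < y"
    then have "t \<in> {t0<..<t1}" using that by auto
    then show "\<exists>k. DERIV F t :> k \<and> k > 0" using dF pos M(2) by (metis divide_pos_pos)
  qed (use cF that in \<open>auto intro: continuous_on_subset\<close>)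
  have inj: "inj_on F {t0<..<t1}"
    using mono by (intro linorder_inj_onI) (auto simp: less_imp_neq)
  have im: "F ` {t0<..<t1} = {0<..<1}"
  proof (intro equalityI subsetI)
    fix y assume "y \<in> F ` {t0<..<t1}"
    then show "y \<in> {0<..<1}" using mono[of t0] mono[of _ t1] F0 F1 by auto
  next
    fix y :: real assume y: "y \<in> {0<..<1}"
    then obtain x where x: "t0 \<le> x" "x \<le> t1" "F x = y"
      using IVT'[of F t0 y t1] F0 F1 t cF by auto
    then have "x \<noteq> t0" "x \<noteq> t1" using F0 F1 y by auto
    then show "y \<in> F ` {t0<..<t1}" using x by auto
  qed
  define q where "q = the_inv_into {t0<..<t1} F"
  have qF: "q (F t) = t" if "t \<in> {t0<..<t1}" for t using inj that by (simp add: q_def the_inv_into_f_f)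
  have Fq: "F (q \<tau>) = \<tau>" and qi: "q \<tau> \<in> {t0<..<t1}" if "\<tau> \<in> {0<..<1}" for \<tau>
    using that f_the_inv_into_f[OF inj] the_inv_into_into[OF inj _ subset_refl] unfolding q_def im by blast+
  have qm: "strict_mono_on {0<..<1} q"
  proof (rule strict_mono_onI)
    fix r s :: real assume rs: "r \<in> {0<..<1}" "s \<in> {0<..<1}" "r < s"
    show "q r < q s"
    proof (rule ccontr)
      assume "\<not> q r < q s"
      then have "F (q s) \<le> F (q r)" using mono[of "q s" "q r"] qi[OF rs(1)] qi[OF rs(2)]
        by (cases "q s = q r") auto
      then show False using Fq rs by auto
    qed
  qed
  show thesis
  proof (rule that)
    show "q ` {0<..<1} = {t0<..<t1}"
      using qi qF im by (auto simp: image_iff) (metis (no_types, lifting) greaterThanLessThan_iff imageI)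
    show "strict_mono_on {0<..<1} q" by (fact qm)
    fix \<tau> :: real assume \<tau>: "\<tau> \<in> {0<..<1}"
    have "(q has_derivative (*) (inverse (\<alpha> (q \<tau>) / M))) (at (F (q \<tau>)))"
    proof (rule has_derivative_inverse_strong_x[where S="{t0<..<t1}" and f=F])
      show "(F has_derivative (*) (\<alpha> (q \<tau>) / M)) (at (q (F (q \<tau>))))"
        using dF[OF qi[OF \<tau>]] Fq[OF \<tau>] by (simp add: has_field_derivative_def)
      show "(*) (\<alpha> (q \<tau>) / M) \<circ> (*) (inverse (\<alpha> (q \<tau>) / M)) = id"
        using pos[OF qi[OF \<tau>]] M(2) by (auto simp: fun_eq_iff)
      show "continuous_on {t0<..<t1} F" using cF by (rule continuous_on_subset) auto
    qed (use qi \<tau> qF Fq in auto)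
    then have "(q has_real_derivative inverse (\<alpha> (q \<tau>) / M)) (at (F (q \<tau>)))"
      by (simp add: has_field_derivative_def)
    then show "(q has_real_derivative M / \<alpha> (q \<tau>)) (at \<tau>)" using Fq[OF \<tau>] by simp
  qed
qed

text \<open>The exceptional set is open and null, hence empty. It serves to pass from an almost
  everywhere identity of continuous functions to an identity everywhere.\<close>

lemma AE_open_imp_all:
  fixes P :: "real \<Rightarrow> bool"
  assumes "open S" "AE x in lborel. x \<in> S \<longrightarrow> P x" "open {x \<in> S. \<not> P x}" "x \<in> S"
  shows "P x"
proof -
  have "AE x in lborel. x \<notin> {x \<in> S. \<not> P x}" using assms(2) by eventually_elim auto
  then have "emeasure lborel {x \<in> S. \<not> P x} = 0"
    using assms(3) by (subst (asm) AE_iff_measurable) (auto intro: borel_open)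
  then have "negligible {x \<in> S. \<not> P x}"
    using assms(3) by (simp add: negligible_iff_null_sets null_sets_def emeasure_completion borel_open)
  then show ?thesis using open_not_negligible[OF assms(3)] assms(4) by auto
qed

text \<open>\<open>q\<close> carries the uniform distribution on the unit interval to the distribution on \<open>{a<..<b}\<close> that
  has total mass \<open>m\<close> and integrates \<open>k\<close> to \<open>\<Lambda> k\<close>.\<close>
definition quantile_map :: "(real \<Rightarrow> real) \<Rightarrow> real \<Rightarrow> real \<Rightarrow> ennreal \<Rightarrow> ((real \<Rightarrow> ennreal) \<Rightarrow> ennreal) \<Rightarrow> bool" where
  "quantile_map q a b m \<Lambda> \<longleftrightarrow> q \<in> borel_measurable borel \<and> q ` {0<..<1} = {a<..<b} \<and>
     (\<forall>k\<in>borel_measurable borel. \<Lambda> k = m * (\<integral>\<^sup>+\<tau>\<in>{0<..<1}. k (q \<tau>) \<partial>lborel))"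

text \<open>The density is written \<open>a t ^ n\<close> because \<open>a t\<close> will be the
  radius of an \<open>n\<close>-dimensional slice. Since \<open>q'\<close> is the total mass divided
  by the density, the density cancels under the substitution, and integration against it becomes a
  mean over the unit interval.\<close>

lemma quantile_map_exists:
  fixes a :: "real \<Rightarrow> real"
  assumes J: "t0 < t1" "continuous_on {t0<..<t1} a" "\<And>t. t \<in> {t0<..<t1} \<Longrightarrow> a t > 0"
    and M: "(\<integral>\<^sup>+t\<in>{t0<..<t1}. ennreal (a t ^ n) \<partial>lborel) = ennreal (\<mu> ^ Suc n)" and pos: "\<mu> > 0"
  obtains q q' :: "real \<Rightarrow> real" where
    "quantile_map q t0 t1 (ennreal (\<mu> ^ Suc n)) (\<lambda>k. \<integral>\<^sup>+t\<in>{t0<..<t1}. k t * ennreal (a t ^ n) \<partial>lborel)"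
    "strict_mono_on {0<..<1} q" "continuous_on {0<..<1} q" "continuous_on {0<..<1} q'"
    "\<And>\<tau>. \<tau> \<in> {0<..<1} \<Longrightarrow> (q has_real_derivative q' \<tau>) (at \<tau>) \<and> q' \<tau> = \<mu> ^ Suc n / a (q \<tau>) ^ n \<and> q' \<tau> > 0"
proof -
  let ?I = "{0<..<1::real}"
  obtain p where p: "p ` ?I = {t0<..<t1}" "strict_mono_on ?I p"
    "\<And>\<tau>. \<tau> \<in> ?I \<Longrightarrow> (p has_real_derivative \<mu> ^ Suc n / a (p \<tau>) ^ n) (at \<tau>)"
  proof (rule quantile_exists[OF J(1) _ _ M])
    show "continuous_on {t0<..<t1} (\<lambda>t. a t ^ n)" by (intro continuous_intros J)
  qed (use J(3) pos in auto)
  define q where "q \<tau> = (if \<tau> \<in> ?I then p \<tau> else 0)" for \<tau>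
  have qp: "q \<tau> = p \<tau>" if "\<tau> \<in> ?I" for \<tau> using that by (simp add: q_def)
  have cp: "continuous_on ?I p"
    using p(3) by (meson DERIV_isCont continuous_at_imp_continuous_on)
  have qm[measurable]: "q \<in> borel_measurable borel"
    unfolding q_def[abs_def]
    by (rule borel_measurable_continuous_on_if, rule borel_open, rule open_greaterThanLessThan, rule cp, rule continuous_on_const)
  have cq: "continuous_on ?I q" using cp by (subst continuous_on_cong[OF refl qp])
  have im: "q ` ?I = {t0<..<t1}" unfolding p(1)[symmetric] using qp by (intro image_cong) auto
  have smq: "strict_mono_on ?I q" using p(2) qp by (simp add: strict_mono_on_def)
  define q' where "q' \<tau> = \<mu> ^ Suc n / a (q \<tau>) ^ n" for \<tau>
  have qJ: "q \<tau> \<in> {t0<..<t1}" if "\<tau> \<in> ?I" for \<tau> using im that by blast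
  have cq': "continuous_on ?I q'" unfolding q'_def
    by (intro continuous_intros continuous_on_compose2[OF J(2) cq]) (use qJ J(3) in \<open>auto simp: less_imp_neq\<close>, metis less_irrefl greaterThanLessThan_iff)
  have q'pos: "q' \<tau> > 0" if "\<tau> \<in> ?I" for \<tau> using J(3)[OF qJ[OF that]] pos by (simp add: q'_def)
  have dq: "(q has_real_derivative q' \<tau>) (at \<tau>)" if "\<tau> \<in> ?I" for \<tau>
  proof -
    have "(p has_real_derivative q' \<tau>) (at \<tau>)" using p(3)[OF that] qp[OF that] by (simp add: q'_def)
    then show ?thesis
      by (rule has_field_derivative_transform_within_open[OF _ open_greaterThanLessThan that]) (simp add: qp)
  qed
  have "(\<integral>\<^sup>+t\<in>{t0<..<t1}. k t * ennreal (a t ^ n) \<partial>lborel)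
      = ennreal (\<mu> ^ Suc n) * (\<integral>\<^sup>+\<tau>\<in>?I. k (q \<tau>) \<partial>lborel)"
    if [measurable]: "k \<in> borel_measurable borel" for k
  proof -
    define aa where "aa t = (if t \<in> {t0<..<t1} then a t else 0)" for t
    have [measurable]: "aa \<in> borel_measurable borel"
      unfolding aa_def[abs_def]
      by (rule borel_measurable_continuous_on_if, rule borel_open, rule open_greaterThanLessThan, rule J, rule continuous_on_const)
    have "(\<integral>\<^sup>+t\<in>{t0<..<t1}. k t * ennreal (a t ^ n) \<partial>lborel)
        = (\<integral>\<^sup>+t. (k t * ennreal (aa t ^ n)) * indicator (q ` ?I) t \<partial>lborel)"
      unfolding im by (intro nn_integral_cong) (auto simp: aa_def indicator_def)
    also have "\<dots> = (\<integral>\<^sup>+\<tau>\<in>?I. (k (q \<tau>) * ennreal (aa (q \<tau>) ^ n)) * ennreal (q' \<tau>) \<partial>lborel)"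
    proof (rule nn_integral_substitution_open[OF dq q'pos cq'])
      show "inj_on q ?I" using smq by (rule strict_mono_on_imp_inj_on)
      show "bounded (q ` ?I)" unfolding im by simp
    qed auto
    also have "\<dots> = (\<integral>\<^sup>+\<tau>. ennreal (\<mu> ^ Suc n) * (k (q \<tau>) * indicator ?I \<tau>) \<partial>lborel)"
    proof (rule nn_integral_cong)
      fix \<tau> :: real
      show "k (q \<tau>) * ennreal (aa (q \<tau>) ^ n) * ennreal (q' \<tau>) * indicator ?I \<tau>
          = ennreal (\<mu> ^ Suc n) * (k (q \<tau>) * indicator ?I \<tau>)"
      proof (cases "\<tau> \<in> ?I")
        case True
        have a: "a (q \<tau>) > 0" using J(3)[OF qJ[OF True]] .
        have "ennreal (aa (q \<tau>) ^ n) * ennreal (q' \<tau>) = ennreal (a (q \<tau>) ^ n * q' \<tau>)"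
          using a qJ[OF True] by (simp add: aa_def ennreal_mult')
        also have "a (q \<tau>) ^ n * q' \<tau> = \<mu> ^ Suc n" using a by (simp add: q'_def)
        finally show ?thesis using True by (simp add: mult.assoc) (simp add: mult.commute)
      qed simp
    qed
    also have "\<dots> = ennreal (\<mu> ^ Suc n) * (\<integral>\<^sup>+\<tau>\<in>?I. k (q \<tau>) \<partial>lborel)"
      by (rule nn_integral_cmult) simp
    finally show ?thesis .
  qed
  then show thesis
    using qm im smq cq cq' dq q'pos by (intro that[of q q']) (auto simp: quantile_map_def q'_def)
qed

text \<open>Restricting \<open>H\<close> to the range of \<open>q + r\<close> and substituting
  leaves at least the integral of \<open>(a + b) ^ n * (q' + r') * (\<phi> + \<psi>)\<close>, and
  the weight \<open>(a + b) ^ n * (q' + r')\<close> is at least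
  \<open>(\<mu> + \<nu>) ^ Suc n\<close> by \<open>power_sum_bound\<close>. In case of equality the
  excess of the weight vanishes almost everywhere that \<open>\<phi> + \<psi>\<close> is
  positive.\<close>

lemma quantile_coupling:
  fixes a b :: "real \<Rightarrow> real" and \<phi> \<psi> H :: "real \<Rightarrow> ennreal"
  assumes J: "t0 < t1" "continuous_on {t0<..<t1} a" "\<And>t. t \<in> {t0<..<t1} \<Longrightarrow> a t > 0"
    and L: "s0 < s1" "continuous_on {s0<..<s1} b" "\<And>s. s \<in> {s0<..<s1} \<Longrightarrow> b s > 0"
    and pos: "\<mu> > 0" "\<nu> > 0"
    and M: "(\<integral>\<^sup>+t\<in>{t0<..<t1}. ennreal (a t ^ n) \<partial>lborel) = ennreal (\<mu> ^ Suc n)"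
    and N: "(\<integral>\<^sup>+s\<in>{s0<..<s1}. ennreal (b s ^ n) \<partial>lborel) = ennreal (\<nu> ^ Suc n)"
    and [measurable]: "\<phi> \<in> borel_measurable borel" "\<psi> \<in> borel_measurable borel" "H \<in> borel_measurable borel"
    and H: "\<And>t s. t \<in> {t0<..<t1} \<Longrightarrow> s \<in> {s0<..<s1} \<Longrightarrow> ennreal ((a t + b s) ^ n) * (\<phi> t + \<psi> s) \<le> H (t + s)"
  obtains q r :: "real \<Rightarrow> real" where
    "quantile_map q t0 t1 (ennreal (\<mu> ^ Suc n)) (\<lambda>k. \<integral>\<^sup>+t\<in>{t0<..<t1}. k t * ennreal (a t ^ n) \<partial>lborel)"
    "quantile_map r s0 s1 (ennreal (\<nu> ^ Suc n)) (\<lambda>k. \<integral>\<^sup>+s\<in>{s0<..<s1}. k s * ennreal (b s ^ n) \<partial>lborel)"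
    "ennreal ((\<mu> + \<nu>) ^ Suc n) * (\<integral>\<^sup>+\<tau>\<in>{0<..<1}. (\<phi> (q \<tau>) + \<psi> (r \<tau>)) \<partial>lborel) \<le> (\<integral>\<^sup>+z. H z \<partial>lborel)"
    "\<lbrakk>(\<integral>\<^sup>+z. H z \<partial>lborel) = ennreal ((\<mu> + \<nu>) ^ Suc n) * (\<integral>\<^sup>+\<tau>\<in>{0<..<1}. (\<phi> (q \<tau>) + \<psi> (r \<tau>)) \<partial>lborel);
      (\<integral>\<^sup>+z. H z \<partial>lborel) < top; \<And>t. t \<in> {t0<..<t1} \<Longrightarrow> \<phi> t > 0\<rbrakk>
      \<Longrightarrow> \<exists>c. \<forall>\<tau>\<in>{0<..<1}. r \<tau> = \<nu> / \<mu> * q \<tau> + c"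
proof -
  let ?I = "{0<..<1::real}"
  obtain q q' :: "real \<Rightarrow> real" where
    Q: "quantile_map q t0 t1 (ennreal (\<mu> ^ Suc n)) (\<lambda>k. \<integral>\<^sup>+t\<in>{t0<..<t1}. k t * ennreal (a t ^ n) \<partial>lborel)"
    and smq: "strict_mono_on ?I q" and cq: "continuous_on ?I q" and cq': "continuous_on ?I q'"
    and q: "\<And>\<tau>. \<tau> \<in> ?I \<Longrightarrow> (q has_real_derivative q' \<tau>) (at \<tau>) \<and> q' \<tau> = \<mu> ^ Suc n / a (q \<tau>) ^ n \<and> q' \<tau> > 0"
    using quantile_map_exists[OF J M pos(1)] by blast
  obtain r r' :: "real \<Rightarrow> real" where
    R: "quantile_map r s0 s1 (ennreal (\<nu> ^ Suc n)) (\<lambda>k. \<integral>\<^sup>+s\<in>{s0<..<s1}. k s * ennreal (b s ^ n) \<partial>lborel)"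
    and smr: "strict_mono_on ?I r" and cr: "continuous_on ?I r" and cr': "continuous_on ?I r'"
    and r: "\<And>\<tau>. \<tau> \<in> ?I \<Longrightarrow> (r has_real_derivative r' \<tau>) (at \<tau>) \<and> r' \<tau> = \<nu> ^ Suc n / b (r \<tau>) ^ n \<and> r' \<tau> > 0"
    using quantile_map_exists[OF L N pos(2)] by blast
  note dq = q[THEN conjunct1] and q' = q[THEN conjunct2, THEN conjunct1] and q'pos = q[THEN conjunct2, THEN conjunct2]
  note dr = r[THEN conjunct1] and r' = r[THEN conjunct2, THEN conjunct1] and r'pos = r[THEN conjunct2, THEN conjunct2]
  have [measurable]: "q \<in> borel_measurable borel" "r \<in> borel_measurable borel"
    and imq: "q ` ?I = {t0<..<t1}" and imr: "r ` ?I = {s0<..<s1}" using Q R by (auto simp: quantile_map_def)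
  have qJ: "q \<tau> \<in> {t0<..<t1}" and rL: "r \<tau> \<in> {s0<..<s1}" if "\<tau> \<in> ?I" for \<tau>
    using imq imr that by blast+
  have a0: "a (q \<tau>) > 0" and b0: "b (r \<tau>) > 0" if "\<tau> \<in> ?I" for \<tau>
    using J(3) L(3) qJ[OF that] rL[OF that] by blast+
  define C where "C = (\<mu> + \<nu>) ^ Suc n"
  have C0: "C > 0" using pos by (simp add: C_def)
  \<comment> \<open>The value \<open>C\<close> outside the unit interval keeps
    \<open>W \<tau> \<ge> C\<close> valid for all \<open>\<tau>\<close>; the factor \<open>X\<close>
    vanishes there.\<close>
  define W where "W \<tau> = (if \<tau> \<in> ?I then (a (q \<tau>) + b (r \<tau>)) ^ n * (q' \<tau> + r' \<tau>) else C)" for \<tau>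
  have [measurable]: "W \<in> borel_measurable borel"
  proof -
    have "continuous_on ?I (\<lambda>\<tau>. (a (q \<tau>) + b (r \<tau>)) ^ n * (q' \<tau> + r' \<tau>))"
      by (intro continuous_intros cq' cr' continuous_on_compose2[OF J(2) cq] continuous_on_compose2[OF L(2) cr])
        (use qJ rL in auto)
    then show ?thesis unfolding W_def[abs_def]
      by (rule borel_measurable_continuous_on_if[OF borel_open[OF open_greaterThanLessThan] _ continuous_on_const])
  qed
  have WC: "W \<tau> \<ge> C" for \<tau>
    using power_sum_bound(1)[OF a0 b0 pos] by (simp add: W_def C_def q' r')
  define X where "X \<tau> = (\<phi> (q \<tau>) + \<psi> (r \<tau>)) * indicator ?I \<tau>" for \<tau>
  have [measurable]: "X \<in> borel_measurable borel" unfolding X_def[abs_def] by simp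
  define z where "z \<tau> = q \<tau> + r \<tau>" for \<tau>
  have WX: "(\<integral>\<^sup>+\<tau>. ennreal (W \<tau>) * X \<tau> \<partial>lborel) \<le> (\<integral>\<^sup>+x. H x \<partial>lborel)"
  proof -
    have "(\<integral>\<^sup>+\<tau>. ennreal (W \<tau>) * X \<tau> \<partial>lborel) \<le> (\<integral>\<^sup>+\<tau>\<in>?I. H (z \<tau>) * ennreal (q' \<tau> + r' \<tau>) \<partial>lborel)"
    proof (rule nn_integral_mono)
      fix \<tau> :: real
      show "ennreal (W \<tau>) * X \<tau> \<le> H (z \<tau>) * ennreal (q' \<tau> + r' \<tau>) * indicator ?I \<tau>"
      proof (cases "\<tau> \<in> ?I")
        case True
        have p: "q' \<tau> + r' \<tau> \<ge> 0" using q'pos[OF True] r'pos[OF True] by simp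
        have "ennreal (W \<tau>) * X \<tau> = (ennreal ((a (q \<tau>) + b (r \<tau>)) ^ n) * (\<phi> (q \<tau>) + \<psi> (r \<tau>))) * ennreal (q' \<tau> + r' \<tau>)"
          using True p a0[OF True] b0[OF True] by (simp add: W_def X_def ennreal_mult ac_simps)
        also have "\<dots> \<le> H (z \<tau>) * ennreal (q' \<tau> + r' \<tau>)"
          unfolding z_def by (intro mult_right_mono H qJ rL True) simp
        finally show ?thesis using True by simp
      qed (simp add: X_def)
    qed
    also have "\<dots> = (\<integral>\<^sup>+y. H y * indicator (z ` ?I) y \<partial>lborel)"
    proof (rule nn_integral_substitution_open[symmetric])
      show "(z has_real_derivative q' x + r' x) (at x)" if "x \<in> ?I" for x
        unfolding z_def using dq[OF that] dr[OF that] by (rule DERIV_add)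
      show "continuous_on ?I (\<lambda>x. q' x + r' x)" by (intro continuous_intros cq' cr')
      show "q' x + r' x > 0" if "x \<in> ?I" for x using q'pos[OF that] r'pos[OF that] by simp
      have "z ` ?I \<subseteq> {t0 + s0..t1 + s1}"
        using qJ rL by (force simp: z_def)
      then show "bounded (z ` ?I)" using bounded_subset bounded_closed_interval by blast
      have "strict_mono_on ?I z" using smq smr by (simp add: strict_mono_on_def z_def add_strict_mono)
      then show "inj_on z ?I" by (rule strict_mono_on_imp_inj_on)
    qed simp
    also have "\<dots> \<le> (\<integral>\<^sup>+x. H x \<partial>lborel)" by (intro nn_integral_mono) (auto simp: indicator_def)
    finally show ?thesis .
  qed
  have split: "(\<integral>\<^sup>+\<tau>. ennreal (W \<tau>) * X \<tau> \<partial>lborel)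
      = ennreal C * (\<integral>\<^sup>+\<tau>. X \<tau> \<partial>lborel) + (\<integral>\<^sup>+\<tau>. ennreal (W \<tau> - C) * X \<tau> \<partial>lborel)"
  proof -
    have "ennreal (W \<tau>) = ennreal C + ennreal (W \<tau> - C)" for \<tau>
      using WC[of \<tau>] C0 by (simp add: ennreal_plus[symmetric] del: ennreal_plus)
    then have "(\<integral>\<^sup>+\<tau>. ennreal (W \<tau>) * X \<tau> \<partial>lborel)
        = (\<integral>\<^sup>+\<tau>. ennreal C * X \<tau> + ennreal (W \<tau> - C) * X \<tau> \<partial>lborel)"
      by (simp add: distrib_right)
    also have "\<dots> = (\<integral>\<^sup>+\<tau>. ennreal C * X \<tau> \<partial>lborel) + (\<integral>\<^sup>+\<tau>. ennreal (W \<tau> - C) * X \<tau> \<partial>lborel)"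
      by (rule nn_integral_add) simp_all
    finally show ?thesis by (simp add: nn_integral_cmult)
  qed
  show thesis
  proof (rule that[OF Q R])
    show "ennreal ((\<mu> + \<nu>) ^ Suc n) * (\<integral>\<^sup>+\<tau>\<in>?I. (\<phi> (q \<tau>) + \<psi> (r \<tau>)) \<partial>lborel)
        \<le> (\<integral>\<^sup>+z. H z \<partial>lborel)"
      using WX unfolding split X_def[symmetric] C_def[symmetric] by (rule order_trans[rotated]) (simp add: add_increasing2)
  next
    assume eq: "(\<integral>\<^sup>+z. H z \<partial>lborel)
        = ennreal ((\<mu> + \<nu>) ^ Suc n) * (\<integral>\<^sup>+\<tau>\<in>?I. (\<phi> (q \<tau>) + \<psi> (r \<tau>)) \<partial>lborel)"
      and fin: "(\<integral>\<^sup>+z. H z \<partial>lborel) < top" and \<phi>0: "\<And>t. t \<in> {t0<..<t1} \<Longrightarrow> \<phi> t > 0"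
    have "ennreal C * (\<integral>\<^sup>+\<tau>. X \<tau> \<partial>lborel) + (\<integral>\<^sup>+\<tau>. ennreal (W \<tau> - C) * X \<tau> \<partial>lborel)
        \<le> ennreal C * (\<integral>\<^sup>+\<tau>. X \<tau> \<partial>lborel) + 0"
      using WX unfolding split eq X_def[symmetric] C_def[symmetric] by simp
    \<comment> \<open>In \<open>ennreal\<close> the main term may be cancelled because it is
      finite.\<close>
    moreover have "ennreal C * (\<integral>\<^sup>+\<tau>. X \<tau> \<partial>lborel) < top"
      using fin unfolding eq X_def[symmetric] C_def[symmetric] .
    ultimately have "(\<integral>\<^sup>+\<tau>. ennreal (W \<tau> - C) * X \<tau> \<partial>lborel) = 0"
      by (auto simp: ennreal_add_left_cancel_le)
    then have "AE \<tau> in lborel. ennreal (W \<tau> - C) * X \<tau> = 0"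
      by (subst (asm) nn_integral_0_iff_AE) simp_all
    then have ae: "AE \<tau> in lborel. \<tau> \<in> ?I \<longrightarrow> \<nu> * q' \<tau> = \<mu> * r' \<tau>"
    proof eventually_elim
      case (elim \<tau>)
      show ?case
      proof
        assume \<tau>: "\<tau> \<in> ?I"
        then have "X \<tau> > 0" using \<phi>0[OF qJ[OF \<tau>]] by (simp add: X_def add_pos_nonneg)
        then have "W \<tau> = C" using elim WC[of \<tau>] by (auto simp: ennreal_eq_0_iff)
        then show "\<nu> * q' \<tau> = \<mu> * r' \<tau>"
          using power_sum_bound(2)[OF a0[OF \<tau>] b0[OF \<tau>] pos] \<tau> by (simp add: W_def C_def q' r')
      qed
    qed
    \<comment> \<open>Both derivatives are continuous, so the relation holds at every point of the
      unit interval and can be integrated.\<close>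
    have d: "\<nu> * q' \<tau> = \<mu> * r' \<tau>" if "\<tau> \<in> ?I" for \<tau>
    proof (rule AE_open_imp_all[OF _ ae _ that])
      have "open (?I \<inter> (\<lambda>\<tau>. \<nu> * q' \<tau> - \<mu> * r' \<tau>) -` (- {0}))"
        by (intro continuous_open_preimage continuous_intros cq' cr')
      also have "?I \<inter> (\<lambda>\<tau>. \<nu> * q' \<tau> - \<mu> * r' \<tau>) -` (- {0}) = {x \<in> ?I. \<nu> * q' x \<noteq> \<mu> * r' x}" by auto
      finally show "open {x \<in> ?I. \<nu> * q' x \<noteq> \<mu> * r' x}" .
    qed simp
    have "\<exists>c. \<forall>\<tau>\<in>?I. \<mu> * r \<tau> - \<nu> * q \<tau> = c"
    proof (rule has_field_derivative_zero_constant)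
      fix \<tau> :: real assume \<tau>: "\<tau> \<in> ?I"
      have "((\<lambda>\<tau>. \<mu> * r \<tau> - \<nu> * q \<tau>) has_real_derivative \<mu> * r' \<tau> - \<nu> * q' \<tau>) (at \<tau>)"
        by (intro DERIV_diff DERIV_cmult dq dr \<tau>)
      then show "((\<lambda>\<tau>. \<mu> * r \<tau> - \<nu> * q \<tau>) has_real_derivative 0) (at \<tau> within ?I)"
        using d[OF \<tau>] by (simp add: has_field_derivative_at_within)
    qed simp
    then obtain c where c: "\<And>\<tau>. \<tau> \<in> ?I \<Longrightarrow> \<mu> * r \<tau> - \<nu> * q \<tau> = c" by blast
    then have "r \<tau> = \<nu> / \<mu> * q \<tau> + c / \<mu>" if "\<tau> \<in> ?I" for \<tau>
      using c[OF that] pos by (simp add: field_simps)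
    then show "\<exists>c. \<forall>\<tau>\<in>?I. r \<tau> = \<nu> / \<mu> * q \<tau> + c" by blast
  qed
qed

subsection \<open>Functional Bonnesen inequality in product spaces\<close>

abbreviation PL :: "'i set \<Rightarrow> ('i \<Rightarrow> real) measure" where
  "PL I \<equiv> Pi\<^sub>M I (\<lambda>_. lborel)"

text \<open>Points of \<open>PL I\<close> are \<open>undefined\<close> off \<open>I\<close>;
  restricting the convex combination to \<open>I\<close> keeps it in the space.\<close>

definition pconvex :: "'i set \<Rightarrow> ('i \<Rightarrow> real) set \<Rightarrow> bool" where
  "pconvex I P \<longleftrightarrow> (\<forall>x\<in>P. \<forall>y\<in>P. \<forall>l\<in>{0<..<1}. (\<lambda>i\<in>I. (1 - l) * x i + l * y i) \<in> P)"

definition pslice :: "'i \<Rightarrow> 'i set \<Rightarrow> ('i \<Rightarrow> real) set \<Rightarrow> real \<Rightarrow> ('i \<Rightarrow> real) set" where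
  "pslice i I P t = {x \<in> space (PL I). x(i := t) \<in> P}"

text \<open>For \<open>card I = 0\<close> the exponent is \<open>1 / 0 = 0\<close>, so that \<open>prad\<close> is \<open>1\<close> on sets of positive measure.\<close>
definition prad :: "'i set \<Rightarrow> ('i \<Rightarrow> real) set \<Rightarrow> real" where
  "prad I P = measure (PL I) P powr (1 / real (card I))"

definition pavg :: "'i set \<Rightarrow> ('i \<Rightarrow> real) set \<Rightarrow> (('i \<Rightarrow> real) \<Rightarrow> ennreal) \<Rightarrow> ennreal" where
  "pavg I P f = (\<integral>\<^sup>+x\<in>P. f x \<partial>PL I) / emeasure (PL I) P"

definition pbody :: "'i set \<Rightarrow> ('i \<Rightarrow> real) set \<Rightarrow> bool" where
  "pbody I P \<longleftrightarrow> P \<in> sets (PL I) \<and> pconvex I P \<and> (\<exists>C. \<forall>x\<in>P. \<forall>i\<in>I. \<bar>x i\<bar> \<le> C) \<and> emeasure (PL I) P > 0"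

text \<open>The bound concerns sums of points of \<open>P\<close> and \<open>Q\<close> only, and
  \<open>h\<close> is arbitrary elsewhere. Slicing \<open>f\<close> at height \<open>t\<close>,
  \<open>g\<close> at height \<open>u\<close> and \<open>h\<close> at height \<open>t + u\<close>
  preserves the property.\<close>

definition supadditive_on ::
    "'i set \<Rightarrow> ('i \<Rightarrow> real) set \<Rightarrow> ('i \<Rightarrow> real) set \<Rightarrow> (('i \<Rightarrow> real) \<Rightarrow> ennreal)
      \<Rightarrow> (('i \<Rightarrow> real) \<Rightarrow> ennreal) \<Rightarrow> (('i \<Rightarrow> real) \<Rightarrow> ennreal) \<Rightarrow> bool" where
  "supadditive_on I P Q f g h \<longleftrightarrow>
     f \<in> borel_measurable (PL I) \<and> g \<in> borel_measurable (PL I) \<and> h \<in> borel_measurable (PL I) \<and>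
     (\<forall>x\<in>P. \<forall>y\<in>Q. f x + g y \<le> h (\<lambda>i\<in>I. x i + y i))"

definition bonnesen_on :: "'i set \<Rightarrow> bool" where
  "bonnesen_on I \<longleftrightarrow> (\<forall>P Q f g h. pbody I P \<longrightarrow> pbody I Q \<longrightarrow> supadditive_on I P Q f g h \<longrightarrow>
     ennreal ((prad I P + prad I Q) ^ card I) * (pavg I P f + pavg I Q g) \<le> (\<integral>\<^sup>+x. h x \<partial>PL I))"

lemma product_sigma_finite_lborel: "product_sigma_finite (\<lambda>_. lborel :: real measure)"
  by standard

section \<open>Homotheties and volumes in finite products of the line\<close>

lemma nn_integral_PL_affine:
  assumes I: "finite I" and c: "c > 0" and f: "f \<in> borel_measurable (PL I)"
  shows "(\<integral>\<^sup>+x. f x \<partial>PL I) = ennreal (c ^ card I) * (\<integral>\<^sup>+x. f (\<lambda>i\<in>I. v i + c * x i) \<partial>PL I)"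
  using I f
proof (induction I arbitrary: f rule: finite_induct)
  case empty
  then show ?case
    by (simp add: PiM_empty nn_integral_count_space_finite restrict_def)
next
  case (insert i I f)
  interpret product_sigma_finite "\<lambda>_. lborel :: real measure" by (rule product_sigma_finite_lborel)
  note [measurable] = insert.prems
  let ?A = "\<lambda>K x. \<lambda>i\<in>K. v i + c * x i"
  have [measurable]: "?A I \<in> measurable (PL I) (PL I)" "?A (insert i I) \<in> measurable (PL (insert i I)) (PL (insert i I))"
    by measurable
  interpret Is: sigma_finite_measure "PL I" by (rule sigma_finite[OF insert.hyps(1)])
  have m1[measurable]: "(\<lambda>(y, x). x(i := y)) \<in> measurable (lborel \<Otimes>\<^sub>M PL I) (PL (insert i I))"
    by measurable
  have m2: "(\<lambda>x. f (x(i := z))) \<in> borel_measurable (PL I)" for z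
    by measurable
  have upd: "(?A I x)(i := v i + c * y) = ?A (insert i I) (x(i := y))" for x y
    using insert.hyps(2) by (auto simp: fun_eq_iff)
  have "(\<integral>\<^sup>+x. f x \<partial>PL (insert i I)) = (\<integral>\<^sup>+y. (\<integral>\<^sup>+x. f (x(i := y)) \<partial>PL I) \<partial>lborel)"
    by (rule product_nn_integral_insert_rev[OF insert.hyps insert.prems])
  also have "\<dots> = ennreal c * (\<integral>\<^sup>+y. (\<integral>\<^sup>+x. f (x(i := v i + c * y)) \<partial>PL I) \<partial>lborel)"
    using c by (subst nn_integral_real_affine[where c=c and t="v i"]) auto
  also have "\<dots> = ennreal c * (\<integral>\<^sup>+y. ennreal (c ^ card I) * (\<integral>\<^sup>+x. f ((?A I x)(i := v i + c * y)) \<partial>PL I) \<partial>lborel)"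
    by (subst insert.IH[OF m2]) simp
  also have "\<dots> = ennreal (c ^ card (insert i I)) * (\<integral>\<^sup>+y. (\<integral>\<^sup>+x. f (?A (insert i I) (x(i := y))) \<partial>PL I) \<partial>lborel)"
  proof -
    have "(\<lambda>y. \<integral>\<^sup>+x. f (?A (insert i I) (x(i := y))) \<partial>PL I) \<in> borel_measurable lborel" by measurable
    then show ?thesis
      unfolding upd using c insert.hyps by (simp only: nn_integral_cmult) (simp add: ennreal_mult mult.assoc)
  qed
  also have "(\<integral>\<^sup>+y. (\<integral>\<^sup>+x. f (?A (insert i I) (x(i := y))) \<partial>PL I) \<partial>lborel)
      = (\<integral>\<^sup>+x. f (?A (insert i I) x) \<partial>PL (insert i I))"
    by (rule product_nn_integral_insert_rev[OF insert.hyps, symmetric]) measurable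
  finally show ?case .
qed

lemma emeasure_PL_affine_le:
  assumes "finite I" "c > 0" and [measurable]: "X \<in> sets (PL I)" "Y \<in> sets (PL I)"
    and XY: "\<And>x. x \<in> X \<Longrightarrow> (\<lambda>i\<in>I. v i + c * x i) \<in> Y"
  shows "ennreal (c ^ card I) * emeasure (PL I) X \<le> emeasure (PL I) Y"
proof -
  have "emeasure (PL I) X = (\<integral>\<^sup>+x. indicator X x \<partial>PL I)" by simp
  also have "\<dots> \<le> (\<integral>\<^sup>+x. indicator Y (\<lambda>i\<in>I. v i + c * x i) \<partial>PL I)"
    using XY by (intro nn_integral_mono) (auto simp: indicator_def)
  finally have "ennreal (c ^ card I) * emeasure (PL I) X
      \<le> ennreal (c ^ card I) * (\<integral>\<^sup>+x. indicator Y (\<lambda>i\<in>I. v i + c * x i) \<partial>PL I)"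
    by (rule mult_left_mono) simp
  also have "\<dots> = emeasure (PL I) Y"
    by (subst nn_integral_PL_affine[OF assms(1,2), symmetric]) auto
  finally show ?thesis .
qed

lemma pbody_finite:
  assumes "finite I" "pbody I P"
  shows "emeasure (PL I) P < top"
proof -
  interpret product_sigma_finite "\<lambda>_. lborel :: real measure" by (rule product_sigma_finite_lborel)
  obtain C where C: "\<And>x i. x \<in> P \<Longrightarrow> i \<in> I \<Longrightarrow> \<bar>x i\<bar> \<le> C" using assms(2) by (auto simp: pbody_def)
  have "P \<subseteq> space (PL I)" using assms(2) sets.sets_into_space by (auto simp: pbody_def)
  then have "P \<subseteq> (\<Pi>\<^sub>E i\<in>I. {-C..C})" using C by (auto simp: space_PiM PiE_iff abs_le_iff minus_le_iff)
  then have "emeasure (PL I) P \<le> emeasure (PL I) (\<Pi>\<^sub>E i\<in>I. {-C..C})"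
    using assms(1) by (intro emeasure_mono) auto
  also have "\<dots> = (\<Prod>i\<in>I. emeasure lborel {-C..C})"
    using assms(1) by (subst emeasure_PiM) auto
  also have "\<dots> < top" by (cases "- C \<le> C") (simp_all add: ennreal_power power_0_left)
  finally show ?thesis .
qed

lemma prad_power:
  assumes "finite I" "pbody I P"
  shows "prad I P > 0" "emeasure (PL I) P = ennreal (prad I P ^ card I)"
proof -
  have e: "emeasure (PL I) P = ennreal (measure (PL I) P)"
    using pbody_finite[OF assms] by (simp add: emeasure_eq_ennreal_measure less_top)
  moreover have "emeasure (PL I) P > 0" using assms(2) by (simp add: pbody_def)
  ultimately have m: "measure (PL I) P > 0" by simp
  then show "prad I P > 0" by (simp add: prad_def)
  show "emeasure (PL I) P = ennreal (prad I P ^ card I)"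
  proof (cases "I = {}")
    \<comment> \<open>In dimension zero the product space is a single point of mass one, and a body
      is that whole space, in agreement with \<open>prad I P ^ 0\<close>.\<close>
    case True
    interpret product_sigma_finite "\<lambda>_. lborel :: real measure" by (rule product_sigma_finite_lborel)
    have "P \<subseteq> space (PL I)" "P \<noteq> {}"
      using assms(2) sets.sets_into_space by (auto simp: pbody_def)
    then have "P = {\<lambda>_. undefined}" using True by (auto simp: space_PiM)
    then show ?thesis using True emeasure_PiM[of "{}" "\<lambda>_. {}"] by simp
  next
    case False
    then have "card I > 0" using assms(1) by (simp add: card_gt_0_iff)
    then have "prad I P ^ card I = measure (PL I) P"
      using m by (simp add: prad_def powr_realpow[symmetric] powr_powr)
    then show ?thesis using e by simp
  qed
qed

text \<open>Squeezes \<open>f\<close> near \<open>t\<close> between \<open>(1 \<plusminus> \<bar>r - t\<bar> / \<delta>) ^ n * f t\<close>.\<close>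
lemma continuous_on_if_scaling:
  fixes f :: "real \<Rightarrow> real"
  assumes sc: "\<And>p t l. p \<in> {a<..<b} \<Longrightarrow> t \<in> {a<..<b} \<Longrightarrow> 0 < l \<Longrightarrow> l < 1 \<Longrightarrow> l ^ n * f t \<le> f ((1 - l) * p + l * t)"
  shows "continuous_on {a<..<b} f"
proof (rule continuous_at_imp_continuous_on, rule ballI)
  fix t assume t: "t \<in> {a<..<b}"
  define d where "d = min (t - a) (b - t) / 2"
  have d: "d > 0" "t + d \<in> {a<..<b}" "t - d \<in> {a<..<b}" using t by (auto simp: d_def min_def field_simps)
  have bounds: "(1 - \<bar>r - t\<bar> / d) ^ n * f t \<le> f r \<and> f r \<le> (1 + \<bar>r - t\<bar> / d) ^ n * f t"
    if r: "\<bar>r - t\<bar> < d" for r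
  proof (cases "r = t")
    case False
    define e where "e = \<bar>r - t\<bar> / d"
    have e: "0 < e" "e < 1" using False d(1) r by (auto simp: e_def)
    define \<sigma> where "\<sigma> = (if r > t then d else - d)"
    have rs: "r - t = \<sigma> * e" "t + \<sigma> \<in> {a<..<b}" "t - \<sigma> \<in> {a<..<b}"
      using d False by (auto simp: \<sigma>_def e_def)
    have rI: "r \<in> {a<..<b}" using r d by auto
    have "(1 - e) ^ n * f t \<le> f ((1 - (1 - e)) * (t + \<sigma>) + (1 - e) * t)"
      using e by (intro sc rs t) auto
    also have "(1 - (1 - e)) * (t + \<sigma>) + (1 - e) * t = r" using rs(1) by (simp add: algebra_simps)
    finally have 1: "(1 - e) ^ n * f t \<le> f r" .
    define l where "l = 1 / (1 + e)"
    have l: "0 < l" "l < 1" "l * (1 + e) = 1" using e by (auto simp: l_def)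
    have "l ^ n * f r \<le> f ((1 - l) * (t - \<sigma>) + l * r)"
      using l by (intro sc rs rI) auto
    also have "(1 - l) * (t - \<sigma>) + l * r = t"
    proof -
      have "(1 - l) * (t - \<sigma>) + l * r = t + l * (r - t) + (l - 1) * \<sigma>" by (simp add: algebra_simps)
      also have "\<dots> = t + (l * (1 + e) - 1) * \<sigma>" unfolding rs(1) by (simp add: algebra_simps)
      finally show ?thesis using l(3) by simp
    qed
    finally have "(1 + e) ^ n * (l ^ n * f r) \<le> (1 + e) ^ n * f t"
      using e by (intro mult_left_mono) auto
    also have "(1 + e) ^ n * (l ^ n * f r) = (l * (1 + e)) ^ n * f r" by (simp add: power_mult_distrib)
    finally have "f r \<le> (1 + e) ^ n * f t" using l(3) by simp
    with 1 show ?thesis by (simp add: e_def)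
  qed simp
  have ev: "\<forall>\<^sub>F r in at t. \<bar>r - t\<bar> < d"
    using eventually_at_ball[OF d(1), of t UNIV] by (rule eventually_mono) (auto simp: dist_real_def)
  have "f \<midarrow>t\<rightarrow> f t"
  proof (rule tendsto_sandwich)
    show "\<forall>\<^sub>F r in at t. (1 - \<bar>r - t\<bar> / d) ^ n * f t \<le> f r"
      "\<forall>\<^sub>F r in at t. f r \<le> (1 + \<bar>r - t\<bar> / d) ^ n * f t"
      using ev bounds by (auto elim!: eventually_mono)
    have "((\<lambda>r. (1 - \<bar>r - t\<bar> / d) ^ n * f t) \<longlongrightarrow> (1 - \<bar>t - t\<bar> / d) ^ n * f t) (at t)"
      "((\<lambda>r. (1 + \<bar>r - t\<bar> / d) ^ n * f t) \<longlongrightarrow> (1 + \<bar>t - t\<bar> / d) ^ n * f t) (at t)"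
      by (intro tendsto_intros, use d(1) in simp)+
    then show "((\<lambda>r. (1 - \<bar>r - t\<bar> / d) ^ n * f t) \<longlongrightarrow> f t) (at t)"
      "((\<lambda>r. (1 + \<bar>r - t\<bar> / d) ^ n * f t) \<longlongrightarrow> f t) (at t)" by simp_all
  qed
  then show "isCont f t" by (simp add: isCont_def)
qed

section \<open>Slices of a convex set\<close>

lemma pslice_measurable:
  assumes "i \<notin> I" "P \<in> sets (PL (insert i I))"
  shows "pslice i I P t \<in> sets (PL I)"
proof -
  have m: "(\<lambda>x. x(i := t)) \<in> measurable (PL I) (PL (insert i I))" by measurable
  show ?thesis using measurable_sets[OF m assms(2)]
    by (simp add: pslice_def vimage_def Int_def conj_commute)
qed

lemma nn_integral_pslice:
  assumes I: "finite I" "i \<notin> I" and [measurable]: "P \<in> sets (PL (insert i I))" "f \<in> borel_measurable (PL (insert i I))"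
  shows "(\<integral>\<^sup>+x\<in>P. f x \<partial>PL (insert i I))
      = (\<integral>\<^sup>+t. (\<integral>\<^sup>+x\<in>pslice i I P t. f (x(i := t)) \<partial>PL I) \<partial>lborel)"
    and "(\<lambda>t. \<integral>\<^sup>+x\<in>pslice i I P t. f (x(i := t)) \<partial>PL I) \<in> borel_measurable borel"
proof -
  interpret product_sigma_finite "\<lambda>_. lborel :: real measure" by (rule product_sigma_finite_lborel)
  interpret Is: sigma_finite_measure "PL I" by (rule sigma_finite[OF I(1)])
  have eq: "(\<integral>\<^sup>+x. f (x(i := t)) * indicator P (x(i := t)) \<partial>PL I)
      = (\<integral>\<^sup>+x\<in>pslice i I P t. f (x(i := t)) \<partial>PL I)" for t
    by (rule nn_integral_cong) (simp add: pslice_def indicator_def)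
  show "(\<integral>\<^sup>+x\<in>P. f x \<partial>PL (insert i I))
      = (\<integral>\<^sup>+t. (\<integral>\<^sup>+x\<in>pslice i I P t. f (x(i := t)) \<partial>PL I) \<partial>lborel)"
    unfolding eq[symmetric] by (rule product_nn_integral_insert_rev[OF I]) measurable
  have [measurable]: "(\<lambda>(y, x). x(i := y)) \<in> measurable (lborel \<Otimes>\<^sub>M PL I) (PL (insert i I))"
    by measurable
  have "(\<lambda>t. \<integral>\<^sup>+x. f (x(i := t)) * indicator P (x(i := t)) \<partial>PL I) \<in> borel_measurable lborel"
    by measurable
  then show "(\<lambda>t. \<integral>\<^sup>+x\<in>pslice i I P t. f (x(i := t)) \<partial>PL I) \<in> borel_measurable borel"
    unfolding eq by simp
qed

lemma emeasure_pslice: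
  assumes I: "finite I" "i \<notin> I" and P: "P \<in> sets (PL (insert i I))"
  shows "emeasure (PL (insert i I)) P = (\<integral>\<^sup>+t. emeasure (PL I) (pslice i I P t) \<partial>lborel)"
    and "(\<lambda>t. emeasure (PL I) (pslice i I P t)) \<in> borel_measurable borel"
  using nn_integral_pslice[OF I P, of "\<lambda>_. 1"] P pslice_measurable[OF I(2) P] by simp_all

text \<open>By convexity, contracting the slice at height \<open>t\<close> towards a single point
  \<open>p\<close> of \<open>P\<close> with ratio \<open>l\<close> lands in the slice at the
  intermediate height. This estimate yields both positivity and continuity of the slice volume
  between the extreme heights.\<close>

lemma pslice_scaling:
  assumes I: "finite I" "i \<notin> I" and P: "P \<in> sets (PL (insert i I))" "pconvex (insert i I) P"
    and p: "p \<in> P" and l: "0 < l" "l < 1"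
  shows "ennreal (l ^ card I) * emeasure (PL I) (pslice i I P t)
      \<le> emeasure (PL I) (pslice i I P ((1 - l) * p i + l * t))"
proof (rule emeasure_PL_affine_le[where v="\<lambda>j. (1 - l) * p j"])
  fix x assume x: "x \<in> pslice i I P t"
  then have "(\<lambda>j\<in>insert i I. (1 - l) * p j + l * (x(i := t)) j) \<in> P"
    using P(2)[unfolded pconvex_def, rule_format, OF p, of "x(i := t)" l] l by (simp add: pslice_def)
  moreover have "(\<lambda>j\<in>insert i I. (1 - l) * p j + l * (x(i := t)) j)
      = (\<lambda>j\<in>I. (1 - l) * p j + l * x j)(i := (1 - l) * p i + l * t)"
    using I(2) by (auto simp: fun_eq_iff)
  ultimately show "(\<lambda>j\<in>I. (1 - l) * p j + l * x j) \<in> pslice i I P ((1 - l) * p i + l * t)"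
    by (auto simp: pslice_def space_PiM)
qed (use assms pslice_measurable in auto)

lemma pbody_pslice:
  assumes I: "finite I" "i \<notin> I" and P: "pbody (insert i I) P" and pos: "emeasure (PL I) (pslice i I P t) > 0"
  shows "pbody I (pslice i I P t)"
  unfolding pbody_def
proof (intro conjI pos)
  show "pslice i I P t \<in> sets (PL I)" using P pslice_measurable[OF I(2)] by (simp add: pbody_def)
  show "pconvex I (pslice i I P t)"
    unfolding pconvex_def
  proof (intro ballI)
    fix x y and l :: real assume xy: "x \<in> pslice i I P t" "y \<in> pslice i I P t" "l \<in> {0<..<1}"
    then have "(\<lambda>j\<in>insert i I. (1 - l) * (x(i := t)) j + l * (y(i := t)) j) \<in> P"
      using P unfolding pbody_def pconvex_def pslice_def by blast
    moreover have "(\<lambda>j\<in>insert i I. (1 - l) * (x(i := t)) j + l * (y(i := t)) j)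
        = (\<lambda>j\<in>I. (1 - l) * x j + l * y j)(i := t)"
      using I(2) by (auto simp: fun_eq_iff algebra_simps)
    ultimately show "(\<lambda>j\<in>I. (1 - l) * x j + l * y j) \<in> pslice i I P t"
      by (auto simp: pslice_def space_PiM)
  qed
  obtain C where C: "\<And>x j. x \<in> P \<Longrightarrow> j \<in> insert i I \<Longrightarrow> \<bar>x j\<bar> \<le> C" using P by (auto simp: pbody_def)
  have "\<bar>x j\<bar> \<le> C" if "x \<in> pslice i I P t" "j \<in> I" for x j
    using C[of "x(i := t)" j] that I(2) by (cases "j = i") (auto simp: pslice_def)
  then show "\<exists>C. \<forall>x\<in>pslice i I P t. \<forall>j\<in>I. \<bar>x j\<bar> \<le> C" by blast
qed

text \<open>With \<open>t\<close>, the set \<open>J\<close> of heights of positive slice volume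
  contains every point strictly between \<open>t\<close> and the height of any point of
  \<open>P\<close>. So \<open>J\<close> is an interval up to its ends, and the contraction estimate
  makes the slice volume continuous inside.\<close>

lemma pslice_interval:
  assumes I: "finite I" "i \<notin> I" and P: "pbody (insert i I) P"
  obtains t0 t1 where "t0 < t1" "continuous_on {t0<..<t1} (\<lambda>t. prad I (pslice i I P t))"
    "\<And>t. t \<in> {t0<..<t1} \<Longrightarrow> emeasure (PL I) (pslice i I P t) > 0"
    "AE t in lborel. t \<notin> {t0<..<t1} \<longrightarrow> emeasure (PL I) (pslice i I P t) = 0"
    "\<And>p. p \<in> P \<Longrightarrow> p i \<in> {t0..t1}"
proof -
  define \<alpha> where "\<alpha> t = emeasure (PL I) (pslice i I P t)" for t
  define J where "J = {t. \<alpha> t > 0}"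
  have P': "P \<in> sets (PL (insert i I))" "pconvex (insert i I) P" "emeasure (PL (insert i I)) P > 0"
    using P by (auto simp: pbody_def)
  have scale: "ennreal (l ^ card I) * \<alpha> t \<le> \<alpha> ((1 - l) * p i + l * t)" if "p \<in> P" "0 < l" "l < 1" for p l t
    unfolding \<alpha>_def by (rule pslice_scaling[OF I P'(1,2) that])
  have scaleJ: "(1 - l) * p i + l * t \<in> J" if "p \<in> P" "0 < l" "l < 1" "t \<in> J" for p l t
  proof -
    have "0 < ennreal (l ^ card I) * \<alpha> t" using that by (simp add: J_def ennreal_zero_less_mult_iff)
    then show ?thesis using scale[OF that(1-3), of t] by (simp add: J_def)
  qed
  have witness: "\<exists>p\<in>P. p i = t" if "t \<in> J" for t
  proof -
    have "pslice i I P t \<noteq> {}" using that by (auto simp: J_def \<alpha>_def)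
    then obtain x where "x(i := t) \<in> P" by (auto simp: pslice_def)
    then show ?thesis by (intro bexI[of _ "x(i := t)"]) auto
  qed
  have Pint: "emeasure (PL (insert i I)) P = (\<integral>\<^sup>+t. \<alpha> t \<partial>lborel)"
    unfolding \<alpha>_def by (rule emeasure_pslice(1)[OF I P'(1)])
  have am[measurable]: "\<alpha> \<in> borel_measurable borel" unfolding \<alpha>_def[abs_def] by (rule emeasure_pslice(2)[OF I P'(1)])
  obtain C where C: "\<And>x j. x \<in> P \<Longrightarrow> j \<in> insert i I \<Longrightarrow> \<bar>x j\<bar> \<le> C" using P by (auto simp: pbody_def)
  have Jb: "t \<in> {-C..C}" if "t \<in> J" for t using witness[OF that] C by (force simp: abs_le_iff)
  \<comment> \<open>With at most one height in \<open>J\<close>, slicing would give \<open>P\<close>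
    measure zero.\<close>
  have J2: "\<exists>u\<in>J. \<exists>v\<in>J. u < v"
  proof (rule ccontr)
    assume "\<not> ?thesis"
    then have "\<exists>c. J \<subseteq> {c}" by (metis insert_iff linorder_neqE_linordered_idom subsetI)
    then obtain c where c: "J \<subseteq> {c}" by blast
    have "AE t in lborel. t \<noteq> c" by (rule AE_lborel_singleton)
    then have "AE t in lborel. \<alpha> t = 0"
      by eventually_elim (use c in \<open>auto simp: J_def zero_less_iff_neq_zero\<close>)
    then have "(\<integral>\<^sup>+t. \<alpha> t \<partial>lborel) = 0" using am by (simp add: nn_integral_0_iff_AE)
    then show False using P'(3) unfolding Pint by simp
  qed
  define t0 t1 where "t0 = Inf J" and "t1 = Sup J"
  have Jne: "J \<noteq> {}" using J2 by blast
  have bdd: "bdd_below J" "bdd_above J" using Jb by (auto intro!: bdd_belowI[of _ "-C"] bdd_aboveI[of _ C])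
  have JI: "t \<in> {t0..t1}" if "t \<in> J" for t
    using that bdd by (auto simp: t0_def t1_def cInf_lower cSup_upper)
  have IJ: "t \<in> J" if t: "t \<in> {t0<..<t1}" for t
  proof -
    obtain u where u: "u \<in> J" "u < t" using t Jne bdd(1) by (auto simp: t0_def cInf_less_iff)
    obtain v where v: "v \<in> J" "t < v" using t Jne bdd(2) by (auto simp: t1_def less_cSup_iff)
    obtain p where p: "p \<in> P" "p i = u" using witness[OF u(1)] by blast
    define l where "l = (t - u) / (v - u)"
    have "0 < l" "l < 1" using u v by (auto simp: l_def)
    moreover have "(1 - l) * p i + l * v = t"
    proof -
      have "(1 - l) * p i + l * v = u + l * (v - u)" by (simp add: p algebra_simps)
      also have "l * (v - u) = t - u" using u v by (simp add: l_def)
      finally show ?thesis by simp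
    qed
    ultimately show ?thesis using scaleJ[OF p(1) _ _ v(1), of l] by simp
  qed
  have t01: "t0 < t1"
  proof -
    obtain u v where "u \<in> J" "v \<in> J" "u < v" using J2 by blast
    then show ?thesis using JI[of u] JI[of v] by simp
  qed
  have body: "pbody I (pslice i I P t)" if "t \<in> {t0<..<t1}" for t
    using pbody_pslice[OF I P] IJ[OF that] by (simp add: J_def \<alpha>_def)
  show thesis
  proof (rule that[OF t01])
    show "emeasure (PL I) (pslice i I P t) > 0" if "t \<in> {t0<..<t1}" for t
      using IJ[OF that] by (simp add: J_def \<alpha>_def)
    have "AE t in lborel. t \<noteq> t0" "AE t in lborel. t \<noteq> t1" by (rule AE_lborel_singleton)+
    then show "AE t in lborel. t \<notin> {t0<..<t1} \<longrightarrow> emeasure (PL I) (pslice i I P t) = 0"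
    proof eventually_elim
      case (elim t)
      show ?case
      proof
        assume "t \<notin> {t0<..<t1}"
        then have "t \<notin> J" using JI elim by force
        then show "emeasure (PL I) (pslice i I P t) = 0"
          by (simp add: J_def \<alpha>_def)
      qed
    qed
    \<comment> \<open>Heights between \<open>p i\<close> and a fixed \<open>t\<close> in
      \<open>J\<close> remain in \<open>J\<close>; letting the ratio \<open>l\<close> tend to
      \<open>0\<close> puts \<open>p i\<close> itself in the closed interval.\<close>
    show "p i \<in> {t0..t1}" if p: "p \<in> P" for p
    proof -
      obtain t where t: "t \<in> J" using Jne by blast
      have lim: "((\<lambda>l. (1 - l) * p i + l * t) \<longlongrightarrow> (1 - 0) * p i + 0 * t) (at_right 0)"
        by (intro tendsto_intros)
      have ev: "\<forall>\<^sub>F l in at_right 0. (1 - l) * p i + l * t \<in> {t0..t1}"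
        unfolding eventually_at_right_field by (intro exI[of _ 1] conjI allI impI JI scaleJ p t) auto
      have "(1 - 0) * p i + 0 * t \<in> {t0..t1}"
        by (rule Lim_in_closed_set[OF _ ev _ lim]) auto
      then show ?thesis by simp
    qed
    define g where "g t = measure (PL I) (pslice i I P t)" for t
    have ag: "\<alpha> t = ennreal (g t)" "g t > 0" if "t \<in> {t0<..<t1}" for t
    proof -
      have f: "\<alpha> t < top" using pbody_finite[OF I(1) body[OF that]] by (simp add: \<alpha>_def)
      then show *: "\<alpha> t = ennreal (g t)" by (simp add: \<alpha>_def g_def emeasure_eq_ennreal_measure less_top)
      show "g t > 0" using IJ[OF that] * by (simp add: J_def)
    qed
    have cg: "continuous_on {t0<..<t1} g"
    proof (rule continuous_on_if_scaling)
      fix p t l :: real assume *: "p \<in> {t0<..<t1}" "t \<in> {t0<..<t1}" "0 < l" "l < 1"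
      obtain x where x: "x \<in> P" "x i = p" using witness[OF IJ[OF *(1)]] by blast
      have in': "(1 - l) * p + l * t \<in> {t0<..<t1}"
        using convexD_alt[of "{t0<..<t1}" p t l] * by simp
      have "ennreal (l ^ card I) * ennreal (g t) \<le> ennreal (g ((1 - l) * p + l * t))"
        using scale[OF x(1) *(3,4), of t] unfolding x(2) ag(1)[OF *(2)] ag(1)[OF in'] .
      then have "ennreal (l ^ card I * g t) \<le> ennreal (g ((1 - l) * p + l * t))"
        using * by (simp add: ennreal_mult')
      then show "l ^ card I * g t \<le> g ((1 - l) * p + l * t)"
        using ag(2)[OF in'] by (simp add: ennreal_le_iff)
    qed
    show "continuous_on {t0<..<t1} (\<lambda>t. prad I (pslice i I P t))"
      unfolding prad_def g_def[symmetric]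
      by (intro continuous_on_powr cg continuous_on_const) (use ag(2) in force)
  qed
qed

section \<open>The distribution of one coordinate on a body\<close>

text \<open>The last two clauses tie the interval to the geometry of \<open>X\<close>: they make
  \<open>a\<close> and \<open>b\<close> the infimum and the supremum of coordinate \<open>i\<close>
  over \<open>X\<close>, which is what lets the coupling be read as a relation between support
  functions.\<close>

definition slice_quantile :: "'i \<Rightarrow> 'i set \<Rightarrow> ('i \<Rightarrow> real) set \<Rightarrow> (real \<Rightarrow> real) \<Rightarrow> real \<Rightarrow> real \<Rightarrow> bool" where
  "slice_quantile i K X q a b \<longleftrightarrow>
     quantile_map q a b (emeasure (PL K) X) (\<lambda>k. \<integral>\<^sup>+x\<in>X. k (x i) \<partial>PL K) \<and>
     (\<forall>p\<in>X. p i \<in> {a..b}) \<and> (\<forall>t\<in>{a<..<b}. \<exists>p\<in>X. p i = t)"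

definition slice_avg :: "'i \<Rightarrow> 'i set \<Rightarrow> ('i \<Rightarrow> real) set \<Rightarrow> (('i \<Rightarrow> real) \<Rightarrow> ennreal) \<Rightarrow> real \<Rightarrow> ennreal" where
  "slice_avg i I X f t = pavg I (pslice i I X t) (\<lambda>x. f (x(i := t)))"

lemma slice_avg_measurable:
  assumes I: "finite I" "i \<notin> I" and "X \<in> sets (PL (insert i I))" "f \<in> borel_measurable (PL (insert i I))"
  shows "slice_avg i I X f \<in> borel_measurable borel"
  unfolding slice_avg_def[abs_def] pavg_def
  by (intro borel_measurable_divide_ennreal nn_integral_pslice(2)[OF I] emeasure_pslice(2)[OF I] assms)

lemma slice_avg_component:
  assumes I: "finite I" and X: "pbody I (pslice i I X t)"
  shows "slice_avg i I X (\<lambda>x. k (x i)) t = k t"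
proof -
  have "pslice i I X t \<in> sets (PL I)" using X by (simp add: pbody_def)
  then have "slice_avg i I X (\<lambda>x. k (x i)) t
      = k t * emeasure (PL I) (pslice i I X t) / emeasure (PL I) (pslice i I X t)"
    by (simp add: slice_avg_def pavg_def nn_integral_cmult)
  also have "\<dots> = k t"
    using X pbody_finite[OF I X] by (intro mult_divide_eq_ennreal) (auto simp: pbody_def)
  finally show ?thesis .
qed

text \<open>Fubini over the slices: almost every slice at a height outside \<open>{a<..<b}\<close>
  is null, and for the others \<open>prad ^ card I\<close> is the slice volume, which undoes the
  division in the average.\<close>

lemma nn_integral_slice_avg:
  assumes I: "finite I" "i \<notin> I" and X: "pbody (insert i I) X" and k: "k \<in> borel_measurable (PL (insert i I))"
    and sl: "\<And>t. t \<in> {a<..<b} \<Longrightarrow> emeasure (PL I) (pslice i I X t) > 0"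
      "AE t in lborel. t \<notin> {a<..<b} \<longrightarrow> emeasure (PL I) (pslice i I X t) = 0"
  shows "(\<integral>\<^sup>+x\<in>X. k x \<partial>PL (insert i I))
      = (\<integral>\<^sup>+t\<in>{a<..<b}. slice_avg i I X k t * ennreal (prad I (pslice i I X t) ^ card I) \<partial>lborel)"
proof -
  have Xs: "X \<in> sets (PL (insert i I))" using X by (simp add: pbody_def)
  have "(\<integral>\<^sup>+x\<in>X. k x \<partial>PL (insert i I))
      = (\<integral>\<^sup>+t. (\<integral>\<^sup>+x\<in>pslice i I X t. k (x(i := t)) \<partial>PL I) \<partial>lborel)"
    by (rule nn_integral_pslice(1)[OF I Xs k])
  also have "\<dots> = (\<integral>\<^sup>+t\<in>{a<..<b}. slice_avg i I X k t * ennreal (prad I (pslice i I X t) ^ card I) \<partial>lborel)"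
  proof (rule nn_integral_cong_AE)
    show "AE t in lborel. (\<integral>\<^sup>+x\<in>pslice i I X t. k (x(i := t)) \<partial>PL I)
        = slice_avg i I X k t * ennreal (prad I (pslice i I X t) ^ card I) * indicator {a<..<b} t"
      using sl(2)
    proof eventually_elim
      case (elim t)
      show ?case
      proof (cases "t \<in> {a<..<b}")
        case True
        have b: "pbody I (pslice i I X t)" by (rule pbody_pslice[OF I X sl(1)[OF True]])
        have "slice_avg i I X k t * emeasure (PL I) (pslice i I X t)
            = (\<integral>\<^sup>+x\<in>pslice i I X t. k (x(i := t)) \<partial>PL I)"
          unfolding slice_avg_def pavg_def using sl(1)[OF True] pbody_finite[OF I(1) b]
          by (subst ennreal_divide_times) (simp_all add: ennreal_divide_self[symmetric] mult_divide_eq_ennreal)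
        then show ?thesis using True prad_power(2)[OF I(1) b] by simp
      next
        case False
        then have "pslice i I X t \<in> null_sets (PL I)"
          using elim pslice_measurable[OF I(2) Xs] by (auto simp: null_sets_def)
        then have "(\<integral>\<^sup>+x\<in>pslice i I X t. k (x(i := t)) \<partial>PL I) = 0"
          by (subst nn_integral_null_set) simp_all
        then show ?thesis using False by simp
      qed
    qed
  qed
  finally show ?thesis .
qed

lemma nn_integral_slice_component:
  assumes I: "finite I" "i \<notin> I" and X: "pbody (insert i I) X" and [measurable]: "k \<in> borel_measurable borel"
    and sl: "\<And>t. t \<in> {a<..<b} \<Longrightarrow> emeasure (PL I) (pslice i I X t) > 0"
      "AE t in lborel. t \<notin> {a<..<b} \<longrightarrow> emeasure (PL I) (pslice i I X t) = 0"
  shows "(\<integral>\<^sup>+x\<in>X. k (x i) \<partial>PL (insert i I))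
      = (\<integral>\<^sup>+t\<in>{a<..<b}. k t * ennreal (prad I (pslice i I X t) ^ card I) \<partial>lborel)"
proof -
  have "(\<lambda>x. k (x i)) \<in> borel_measurable (PL (insert i I))" by measurable
  from nn_integral_slice_avg[OF I X this sl] show ?thesis
    by (simp add: indicator_def slice_avg_component[OF I(1)] pbody_pslice[OF I X] sl(1) cong: if_cong)
      (auto intro!: nn_integral_cong simp: slice_avg_component[OF I(1)] pbody_pslice[OF I X] sl(1))
qed

lemma slice_quantileI:
  assumes I: "finite I" "i \<notin> I" and X: "pbody (insert i I) X"
    and sl: "\<And>t. t \<in> {a<..<b} \<Longrightarrow> emeasure (PL I) (pslice i I X t) > 0"
      "AE t in lborel. t \<notin> {a<..<b} \<longrightarrow> emeasure (PL I) (pslice i I X t) = 0" "\<And>p. p \<in> X \<Longrightarrow> p i \<in> {a..b}"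
    and q: "quantile_map q a b (emeasure (PL (insert i I)) X)
      (\<lambda>k. \<integral>\<^sup>+t\<in>{a<..<b}. k t * ennreal (prad I (pslice i I X t) ^ card I) \<partial>lborel)"
  shows "slice_quantile i (insert i I) X q a b"
  unfolding slice_quantile_def
proof (intro conjI ballI sl(3))
  show "quantile_map q a b (emeasure (PL (insert i I)) X) (\<lambda>k. \<integral>\<^sup>+x\<in>X. k (x i) \<partial>PL (insert i I))"
  proof -
    have "(\<integral>\<^sup>+x\<in>X. k (x i) \<partial>PL (insert i I))
        = (\<integral>\<^sup>+t\<in>{a<..<b}. k t * ennreal (prad I (pslice i I X t) ^ card I) \<partial>lborel)"
      if "k \<in> borel_measurable borel" for k by (rule nn_integral_slice_component[OF I X that sl(1,2)])
    then show ?thesis using q unfolding quantile_map_def by simp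
  qed
  fix t assume t: "t \<in> {a<..<b}"
  have "pslice i I X t \<noteq> {}" using sl(1)[OF t] by auto
  then obtain x where "x(i := t) \<in> X" by (auto simp: pslice_def)
  then show "\<exists>p\<in>X. p i = t" by (intro bexI[of _ "x(i := t)"]) auto
qed

lemma pavg_quantile:
  assumes I: "finite I" "i \<notin> I" and X: "pbody (insert i I) X" and f: "f \<in> borel_measurable (PL (insert i I))"
    and sl: "\<And>t. t \<in> {a<..<b} \<Longrightarrow> emeasure (PL I) (pslice i I X t) > 0"
      "AE t in lborel. t \<notin> {a<..<b} \<longrightarrow> emeasure (PL I) (pslice i I X t) = 0"
    and q: "quantile_map q a b (emeasure (PL (insert i I)) X)
      (\<lambda>k. \<integral>\<^sup>+t\<in>{a<..<b}. k t * ennreal (prad I (pslice i I X t) ^ card I) \<partial>lborel)"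
  shows "(\<integral>\<^sup>+\<tau>\<in>{0<..<1}. slice_avg i I X f (q \<tau>) \<partial>lborel) = pavg (insert i I) X f"
proof -
  have K: "finite (insert i I)" using I(1) by simp
  have "X \<in> sets (PL (insert i I))" using X by (simp add: pbody_def)
  then have "slice_avg i I X f \<in> borel_measurable borel" using f by (rule slice_avg_measurable[OF I])
  moreover have "(\<integral>\<^sup>+x\<in>X. f x \<partial>PL (insert i I))
      = (\<integral>\<^sup>+t\<in>{a<..<b}. slice_avg i I X f t * ennreal (prad I (pslice i I X t) ^ card I) \<partial>lborel)"
    by (rule nn_integral_slice_avg[OF I X f sl])
  ultimately have "(\<integral>\<^sup>+x\<in>X. f x \<partial>PL (insert i I))
      = emeasure (PL (insert i I)) X * (\<integral>\<^sup>+\<tau>\<in>{0<..<1}. slice_avg i I X f (q \<tau>) \<partial>lborel)"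
    using q by (simp add: quantile_map_def)
  then have "pavg (insert i I) X f = (\<integral>\<^sup>+\<tau>\<in>{0<..<1}. slice_avg i I X f (q \<tau>) \<partial>lborel)
      * emeasure (PL (insert i I)) X / emeasure (PL (insert i I)) X"
    by (simp add: pavg_def mult.commute)
  also have "\<dots> = (\<integral>\<^sup>+\<tau>\<in>{0<..<1}. slice_avg i I X f (q \<tau>) \<partial>lborel)"
    using X pbody_finite[OF K X] by (intro mult_divide_eq_ennreal) (auto simp: pbody_def)
  finally show ?thesis ..
qed

text \<open>The equality case of the coupling asks for a positive \<open>\<phi>\<close>; positivity
  of \<open>f\<close> survives averaging because a positive function on a set of positive measure
  has positive integral.\<close>

lemma slice_avg_pos:
  assumes I: "finite I" and X: "pbody I (pslice i I X t)" and f: "f \<in> borel_measurable (PL (insert i I))"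
    and pos: "\<And>x. x \<in> X \<Longrightarrow> f x > 0"
  shows "slice_avg i I X f t > 0"
proof -
  note [measurable] = f
  have m: "pslice i I X t \<in> sets (PL I)" and p: "emeasure (PL I) (pslice i I X t) > 0" using X by (auto simp: pbody_def)
  have "(\<integral>\<^sup>+x\<in>pslice i I X t. f (x(i := t)) \<partial>PL I) \<noteq> 0"
  proof
    assume "(\<integral>\<^sup>+x\<in>pslice i I X t. f (x(i := t)) \<partial>PL I) = 0"
    then have "AE x in PL I. f (x(i := t)) * indicator (pslice i I X t) x = 0"
      using m by (subst (asm) nn_integral_0_iff_AE) simp_all
    then have "AE x in PL I. x \<notin> pslice i I X t"
    proof eventually_elim
      case (elim x)
      then show ?case using pos[of "x(i := t)"] by (auto simp: pslice_def)
    qed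
    then have "emeasure (PL I) (pslice i I X t) = 0"
      using m by (simp add: AE_iff_null_sets null_setsD1)
    then show False using p by simp
  qed
  then show ?thesis
    unfolding slice_avg_def pavg_def using pbody_finite[OF I X]
    by (simp add: ennreal_zero_less_divide zero_less_iff_neq_zero)
qed

text \<open>The induction step. \<open>H z\<close> integrates \<open>h\<close> at height
  \<open>z\<close>, and the lower-dimensional inequality for the slices of \<open>P\<close> and
  \<open>Q\<close> at heights \<open>t\<close> and \<open>u\<close> is the bound on
  \<open>H (t + u)\<close> that \<open>quantile_coupling\<close> takes as input. The equality claim
  concerns the coordinate \<open>i\<close> alone, so nothing about equality in lower dimensions has
  to be known.\<close>

lemma slice_coupling:
  fixes i :: 'i and I :: "'i set"
  defines "K \<equiv> insert i I"
  assumes I: "finite I" "i \<notin> I" and B: "bonnesen_on I"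
    and P: "pbody K P" and Q: "pbody K Q" and sup: "supadditive_on K P Q f g h"
  obtains t0 t1 s0 s1 and q r :: "real \<Rightarrow> real" where
    "slice_quantile i K P q t0 t1" "slice_quantile i K Q r s0 s1"
    "ennreal ((prad K P + prad K Q) ^ card K) * (pavg K P f + pavg K Q g) \<le> (\<integral>\<^sup>+x. h x \<partial>PL K)"
    "\<lbrakk>(\<integral>\<^sup>+x. h x \<partial>PL K) = ennreal ((prad K P + prad K Q) ^ card K) * (pavg K P f + pavg K Q g);
      (\<integral>\<^sup>+x. h x \<partial>PL K) < top; \<And>x. x \<in> P \<Longrightarrow> f x > 0\<rbrakk>
      \<Longrightarrow> \<exists>c. \<forall>\<tau>\<in>{0<..<1}. r \<tau> = prad K Q / prad K P * q \<tau> + c"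
proof -
  interpret product_sigma_finite "\<lambda>_. lborel :: real measure" by (rule product_sigma_finite_lborel)
  interpret Is: sigma_finite_measure "PL I" by (rule sigma_finite[OF I(1)])
  have K: "finite K" "card K = Suc (card I)" using I by (auto simp: K_def)
  have PQ: "P \<in> sets (PL K)" "Q \<in> sets (PL K)" using P Q by (auto simp: pbody_def)
  have fm: "f \<in> borel_measurable (PL K)" "g \<in> borel_measurable (PL K)" and [measurable]: "h \<in> borel_measurable (PL K)"
    and fgh: "\<And>x y. x \<in> P \<Longrightarrow> y \<in> Q \<Longrightarrow> f x + g y \<le> h (\<lambda>j\<in>K. x j + y j)"
    using sup by (auto simp: supadditive_on_def)
  have [measurable]: "(\<lambda>(y, x). x(i := y)) \<in> measurable (lborel \<Otimes>\<^sub>M PL I) (PL K)"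
    unfolding K_def by measurable
  define \<mu> \<nu> where "\<mu> = prad K P" and "\<nu> = prad K Q"
  have pos: "\<mu> > 0" "\<nu> > 0" and MN: "emeasure (PL K) P = ennreal (\<mu> ^ Suc (card I))" "emeasure (PL K) Q = ennreal (\<nu> ^ Suc (card I))"
    using prad_power[OF K(1) P] prad_power[OF K(1) Q] K(2) by (simp_all add: \<mu>_def \<nu>_def)
  define H where "H z = (\<integral>\<^sup>+x. h (x(i := z)) \<partial>PL I)" for z
  have Hm: "H \<in> borel_measurable lborel" unfolding H_def[abs_def] by measurable
  have Hint: "(\<integral>\<^sup>+x. h x \<partial>PL K) = (\<integral>\<^sup>+z. H z \<partial>lborel)"
    unfolding H_def K_def by (rule product_nn_integral_insert_rev[OF I]) (simp add: K_def[symmetric])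
  note avm = slice_avg_measurable[OF I PQ(1)[unfolded K_def] fm(1)[unfolded K_def]]
    slice_avg_measurable[OF I PQ(2)[unfolded K_def] fm(2)[unfolded K_def]]
  obtain t0 t1 where t: "t0 < t1" "continuous_on {t0<..<t1} (\<lambda>t. prad I (pslice i I P t))"
    "\<And>t. t \<in> {t0<..<t1} \<Longrightarrow> emeasure (PL I) (pslice i I P t) > 0"
    "AE t in lborel. t \<notin> {t0<..<t1} \<longrightarrow> emeasure (PL I) (pslice i I P t) = 0"
    "\<And>p. p \<in> P \<Longrightarrow> p i \<in> {t0..t1}"
    using pslice_interval[OF I P[unfolded K_def]] by blast
  obtain s0 s1 where s: "s0 < s1" "continuous_on {s0<..<s1} (\<lambda>s. prad I (pslice i I Q s))"
    "\<And>s. s \<in> {s0<..<s1} \<Longrightarrow> emeasure (PL I) (pslice i I Q s) > 0"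
    "AE s in lborel. s \<notin> {s0<..<s1} \<longrightarrow> emeasure (PL I) (pslice i I Q s) = 0"
    "\<And>p. p \<in> Q \<Longrightarrow> p i \<in> {s0..s1}"
    using pslice_interval[OF I Q[unfolded K_def]] by blast
  have bP: "pbody I (pslice i I P t)" if "t \<in> {t0<..<t1}" for t
    by (rule pbody_pslice[OF I P[unfolded K_def] t(3)[OF that]])
  have bQ: "pbody I (pslice i I Q t)" if "t \<in> {s0<..<s1}" for t
    by (rule pbody_pslice[OF I Q[unfolded K_def] s(3)[OF that]])
  have M: "(\<integral>\<^sup>+t\<in>{t0<..<t1}. ennreal (prad I (pslice i I P t) ^ card I) \<partial>lborel) = ennreal (\<mu> ^ Suc (card I))"
    using nn_integral_slice_component[OF I P[unfolded K_def] _ t(3,4), of "\<lambda>_. 1"] PQ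
    by (simp add: K_def[symmetric] MN)
  have N: "(\<integral>\<^sup>+s\<in>{s0<..<s1}. ennreal (prad I (pslice i I Q s) ^ card I) \<partial>lborel) = ennreal (\<nu> ^ Suc (card I))"
    using nn_integral_slice_component[OF I Q[unfolded K_def] _ s(3,4), of "\<lambda>_. 1"] PQ
    by (simp add: K_def[symmetric] MN)
  have Hge: "ennreal ((prad I (pslice i I P t) + prad I (pslice i I Q u)) ^ card I)
      * (slice_avg i I P f t + slice_avg i I Q g u) \<le> H (t + u)"
    if tu: "t \<in> {t0<..<t1}" "u \<in> {s0<..<s1}" for t u
  proof -
    note [measurable] = fm[unfolded K_def] \<open>h \<in> borel_measurable (PL K)\<close>[unfolded K_def]
    have "supadditive_on I (pslice i I P t) (pslice i I Q u) (\<lambda>x. f (x(i := t))) (\<lambda>x. g (x(i := u))) (\<lambda>x. h (x(i := t + u)))"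
      unfolding supadditive_on_def
    proof (intro conjI ballI)
      fix x y assume xy: "x \<in> pslice i I P t" "y \<in> pslice i I Q u"
      have "(\<lambda>j\<in>K. (x(i := t)) j + (y(i := u)) j) = (\<lambda>j\<in>I. x j + y j)(i := t + u)"
        using I(2) by (auto simp: fun_eq_iff K_def)
      then show "f (x(i := t)) + g (y(i := u)) \<le> h ((\<lambda>j\<in>I. x j + y j)(i := t + u))"
        using fgh[of "x(i := t)" "y(i := u)"] xy by (simp add: pslice_def)
    qed measurable
    then show ?thesis
      using B bP[OF tu(1)] bQ[OF tu(2)] unfolding bonnesen_on_def slice_avg_def H_def by blast
  qed
  show thesis
  proof (rule quantile_coupling[where a="\<lambda>t. prad I (pslice i I P t)" and b="\<lambda>t. prad I (pslice i I Q t)"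
        and \<phi>="slice_avg i I P f" and \<psi>="slice_avg i I Q g" and H=H and ?t0.0=t0 and ?t1.0=t1 and ?s0.0=s0 and ?s1.0=s1
        and \<mu>=\<mu> and \<nu>=\<nu> and n="card I"], goal_cases)
    \<comment> \<open>Cases 3 and 6 ask for positive slice radii, case 14 for the sliced inequality,
      and case 15 receives the coupled quantile maps.\<close>
    case (3 u)
    then show ?case by (rule prad_power(1)[OF I(1) bP])
  next
    case (6 u)
    then show ?case by (rule prad_power(1)[OF I(1) bQ])
  next
    case (14 u v)
    then show ?case by (rule Hge)
  next
    case (15 q r)
    note q = 15(1)[folded MN(1), unfolded K_def] and r = 15(2)[folded MN(2), unfolded K_def]
    have [measurable]: "q \<in> borel_measurable borel" "r \<in> borel_measurable borel" using q r by (auto simp: quantile_map_def)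
    note [measurable] = avm
    have av: "(\<integral>\<^sup>+\<tau>\<in>{0<..<1}. (slice_avg i I P f (q \<tau>) + slice_avg i I Q g (r \<tau>)) \<partial>lborel) = pavg K P f + pavg K Q g"
    proof -
      have "pavg K P f = (\<integral>\<^sup>+\<tau>\<in>{0<..<1}. slice_avg i I P f (q \<tau>) \<partial>lborel)"
        unfolding K_def by (rule pavg_quantile[OF I P[unfolded K_def] fm(1)[unfolded K_def] t(3,4) q, symmetric])
      moreover have "pavg K Q g = (\<integral>\<^sup>+\<tau>\<in>{0<..<1}. slice_avg i I Q g (r \<tau>) \<partial>lborel)"
        unfolding K_def by (rule pavg_quantile[OF I Q[unfolded K_def] fm(2)[unfolded K_def] s(3,4) r, symmetric])
      ultimately show ?thesis by (simp add: distrib_right nn_integral_add)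
    qed
    show ?case
    proof (rule that[of q t0 t1 r s0 s1])
      show "slice_quantile i K P q t0 t1" unfolding K_def using t(3-5) q by (rule slice_quantileI[OF I P[unfolded K_def]])
      show "slice_quantile i K Q r s0 s1" unfolding K_def using s(3-5) r by (rule slice_quantileI[OF I Q[unfolded K_def]])
      show "ennreal ((prad K P + prad K Q) ^ card K) * (pavg K P f + pavg K Q g) \<le> (\<integral>\<^sup>+x. h x \<partial>PL K)"
        using 15(3) unfolding av Hint K(2) \<mu>_def \<nu>_def .
      assume "(\<integral>\<^sup>+x. h x \<partial>PL K) = ennreal ((prad K P + prad K Q) ^ card K) * (pavg K P f + pavg K Q g)"
        "(\<integral>\<^sup>+x. h x \<partial>PL K) < top" and f0: "\<And>x. x \<in> P \<Longrightarrow> f x > 0"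
      then show "\<exists>c. \<forall>\<tau>\<in>{0<..<1}. r \<tau> = prad K Q / prad K P * q \<tau> + c"
        unfolding \<mu>_def[symmetric] \<nu>_def[symmetric] Hint K(2) av[symmetric]
        by (intro 15(4) slice_avg_pos[OF I(1) bP fm(1)[unfolded K_def]])
    qed
  qed (rule t(1) t(2) s(1) s(2) pos M N avm Hm[simplified])+
qed

lemma bonnesen_on_finite:
  assumes "finite I"
  shows "bonnesen_on I"
  using assms
proof (induction I rule: finite_induct)
  case empty
  show ?case
    unfolding bonnesen_on_def
  proof (intro allI impI)
    fix P Q :: "('a \<Rightarrow> real) set" and f g h :: "('a \<Rightarrow> real) \<Rightarrow> ennreal"
    assume PQ: "pbody {} P" "pbody {} Q" and fgh: "supadditive_on {} P Q f g h"
    \<comment> \<open>A body in dimension zero is the only point of the product space, and the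
      inequality reduces to \<open>f + g \<le> h\<close> at that point.\<close>
    have 1: "X = {\<lambda>_. undefined}" if "pbody {} X" for X :: "('a \<Rightarrow> real) set"
    proof -
      have "X \<subseteq> space (PL {})" "X \<noteq> {}" using that sets.sets_into_space by (auto simp: pbody_def)
      then show ?thesis by (auto simp: space_PiM)
    qed
    show "ennreal ((prad {} P + prad {} Q) ^ card {}) * (pavg {} P f + pavg {} Q g) \<le> (\<integral>\<^sup>+x. h x \<partial>PL {})"
      using fgh unfolding supadditive_on_def 1[OF PQ(1)] 1[OF PQ(2)]
      by (simp add: pavg_def PiM_empty nn_integral_count_space_finite restrict_def divide_ennreal_def)
  qed
next
  case (insert i I)
  show ?case
    unfolding bonnesen_on_def
  proof (intro allI impI)
    fix P Q f g h
    assume "pbody (insert i I) P" "pbody (insert i I) Q" "supadditive_on (insert i I) P Q f g h"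
    from slice_coupling[OF insert.hyps insert.IH this]
    show "ennreal ((prad (insert i I) P + prad (insert i I) Q) ^ card (insert i I))
        * (pavg (insert i I) P f + pavg (insert i I) Q g) \<le> (\<integral>\<^sup>+x. h x \<partial>PL (insert i I))"
      by blast
  qed
qed

subsection \<open>Orthonormal coordinates\<close>

text \<open>Evaluates \<open>\<integral>\<integral> 1\<^sub>A(y) 1\<^sub>B(x + y)\<close> in both orders: translation-invariant measures are proportional.\<close>
lemma translation_invariant_proportional:
  fixes M :: "'a::euclidean_space measure"
  assumes "sigma_finite_measure M" and sM[measurable_cong]: "sets M = sets borel"
    and inv: "\<And>x. distr M borel ((+) x) = M"
    and [measurable]: "A \<in> sets borel" "B \<in> sets borel"
  shows "emeasure M A * emeasure lborel B = emeasure M B * emeasure lborel A"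
proof -
  interpret M: sigma_finite_measure M by fact
  interpret pair_sigma_finite "lborel :: 'a measure" M ..
  have um: "distr lborel borel uminus = (lborel :: 'a measure)"
    by (subst lborel_affine[of "-1" 0]) (auto simp: density_1 one_ennreal_def[symmetric])
  have "emeasure M A * emeasure lborel B = (\<integral>\<^sup>+y. indicator A y * emeasure lborel B \<partial>M)"
    by (simp add: nn_integral_multc)
  also have "\<dots> = (\<integral>\<^sup>+y. (\<integral>\<^sup>+x. indicator A y * indicator B (x + y) \<partial>lborel) \<partial>M)"
  proof (rule nn_integral_cong)
    fix y
    have "emeasure lborel B = (\<integral>\<^sup>+x. indicator B x \<partial>distr lborel borel ((+) y))"
      by (simp add: lborel_distr_plus)
    also have "\<dots> = (\<integral>\<^sup>+x. indicator B (x + y) \<partial>lborel)"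
      by (subst nn_integral_distr) (simp_all add: add.commute)
    finally show "indicator A y * emeasure lborel B = (\<integral>\<^sup>+x. indicator A y * indicator B (x + y) \<partial>lborel)"
      by (subst nn_integral_cmult) simp_all
  qed
  also have "\<dots> = (\<integral>\<^sup>+x. (\<integral>\<^sup>+y. indicator A y * indicator B (x + y) \<partial>M) \<partial>lborel)"
    by (rule Fubini') measurable
  also have "\<dots> = (\<integral>\<^sup>+x. (\<integral>\<^sup>+y\<in>B. indicator A (y - x) \<partial>M) \<partial>lborel)"
  proof (rule nn_integral_cong)
    fix x
    have "(\<integral>\<^sup>+y\<in>B. indicator A (y - x) \<partial>M) = (\<integral>\<^sup>+y. indicator A (y - x) * indicator B y \<partial>distr M borel ((+) x))"
      by (simp add: inv)
    also have "\<dots> = (\<integral>\<^sup>+y. indicator A y * indicator B (x + y) \<partial>M)"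
      by (subst nn_integral_distr) simp_all
    finally show "(\<integral>\<^sup>+y. indicator A y * indicator B (x + y) \<partial>M) = (\<integral>\<^sup>+y\<in>B. indicator A (y - x) \<partial>M)" ..
  qed
  also have "\<dots> = (\<integral>\<^sup>+y. (\<integral>\<^sup>+x. indicator A (y - x) * indicator B y \<partial>lborel) \<partial>M)"
    by (rule Fubini'[symmetric]) measurable
  also have "\<dots> = (\<integral>\<^sup>+y\<in>B. emeasure lborel A \<partial>M)"
  proof (rule nn_integral_cong)
    fix y
    have "emeasure lborel A = (\<integral>\<^sup>+x. indicator A x \<partial>distr lborel borel ((+) y))"
      by (simp add: lborel_distr_plus)
    also have "\<dots> = (\<integral>\<^sup>+x. indicator A (y + x) \<partial>distr lborel borel uminus)"
      by (subst nn_integral_distr) (simp_all add: um)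
    also have "\<dots> = (\<integral>\<^sup>+x. indicator A (y - x) \<partial>lborel)"
      by (subst nn_integral_distr) simp_all
    finally show "(\<integral>\<^sup>+x. indicator A (y - x) * indicator B y \<partial>lborel) = emeasure lborel A * indicator B y"
      by (subst nn_integral_multc) simp_all
  qed
  also have "\<dots> = emeasure M B * emeasure lborel A"
    by (subst nn_integral_cmult_indicator) (simp_all add: ac_simps)
  finally show ?thesis .
qed

text \<open>A linear bijection pushes Lebesgue measure forward to a translation-invariant measure,
  hence to a multiple of Lebesgue measure. The factor is expressed through the unit ball and its
  preimage in place of a determinant.\<close>

lemma lborel_linear_vimage:
  fixes T :: "'a::euclidean_space \<Rightarrow> 'a"
  assumes T: "linear T" "inj T" and A: "A \<in> sets borel"
  shows "emeasure lborel (T -` A) * emeasure lborel (ball 0 1 :: 'a set)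
      = emeasure lborel (T -` ball 0 1) * emeasure lborel A"
    and "emeasure lborel (T -` ball 0 1) < top" "0 < emeasure lborel (T -` ball 0 1)"
proof -
  obtain S where S: "linear S" "\<And>x. S (T x) = x" "\<And>x. T (S x) = x"
    using linear_injective_isomorphism[OF T] by blast
  have [measurable]: "T \<in> borel_measurable borel"
    using T(1) by (intro borel_measurable_continuous_onI linear_continuous_on) (simp add: linear_conv_bounded_linear)
  have vi: "T -` X = S ` X" for X using S by (auto simp: image_iff) metis
  have bd: "bounded (T -` X)" if "bounded X" for X
    unfolding vi using that S(1) by (rule bounded_linear_image[OF _ linear_conv_bounded_linear[THEN iffD1]])
  show fin: "emeasure lborel (T -` ball 0 1) < top"
    using emeasure_bounded_finite[OF bd[OF bounded_ball]] by simp
  have "open (T -` ball 0 1)"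
    using T(1) by (intro open_vimage open_ball linear_continuous_on) (simp add: linear_conv_bounded_linear)
  moreover have "0 \<in> T -` ball 0 1" using linear_0[OF T(1)] by simp
  ultimately obtain e where e: "e > 0" "ball 0 e \<subseteq> T -` ball 0 1" using open_contains_ball by blast
  have bpos: "0 < emeasure lborel (ball 0 e :: 'a set)" if "e > 0" for e
    using that content_ball_pos[of e "0::'a"] by (auto simp: zero_less_iff_neq_zero measure_def)
  show "0 < emeasure lborel (T -` ball 0 1)"
    using bpos[OF e(1)] emeasure_mono[OF e(2), of lborel] measurable_sets_borel[of T borel "ball 0 1"] by simp
  have em: "emeasure (distr lborel borel T) X = emeasure lborel (T -` X)" if "X \<in> sets borel" for X
    using that by (simp add: emeasure_distr)
  have "emeasure (distr lborel borel T) A * emeasure lborel (ball 0 1 :: 'a set)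
      = emeasure (distr lborel borel T) (ball 0 1) * emeasure lborel A"
  proof (rule translation_invariant_proportional)
    show "sigma_finite_measure (distr lborel borel T)"
    proof
      let ?F = "range (\<lambda>n::nat. ball (0::'a) (real n))"
      have U: "\<Union> ?F = UNIV"
      proof (intro equalityI subsetI UNIV_I)
        fix x :: 'a
        obtain n :: nat where "norm x < real n" using reals_Archimedean2 by blast
        then show "x \<in> \<Union> ?F" by (intro UnionI[of "ball 0 (real n)"]) simp_all
      qed
      have "emeasure (distr lborel borel T) a \<noteq> \<infinity>" if "a \<in> ?F" for a
      proof -
        have "bounded a" "a \<in> sets borel" using that by auto
        then show ?thesis using emeasure_bounded_finite[OF bd] em[of a] by (metis infinity_ennreal_def less_irrefl)
      qed
      moreover have "?F \<subseteq> sets (distr lborel borel T)" by auto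
      ultimately show "\<exists>F. countable F \<and> F \<subseteq> sets (distr lborel borel T) \<and> \<Union> F = space (distr lborel borel T)
          \<and> (\<forall>a\<in>F. emeasure (distr lborel borel T) a \<noteq> \<infinity>)"
        unfolding space_distr space_borel using U by (intro exI[of _ ?F]) blast
    qed
    fix x
    have "distr (distr lborel borel T) borel ((+) x) = distr lborel borel (\<lambda>y. x + T y)"
      by (subst distr_distr) (simp_all add: comp_def)
    also have "(\<lambda>y. x + T y) = (\<lambda>y. T (S x + y))" using S(3) by (simp add: linear_add[OF T(1)])
    also have "distr lborel borel (\<lambda>y. T (S x + y)) = distr (distr lborel borel ((+) (S x))) borel T"
      by (subst distr_distr) (simp_all add: comp_def)
    finally show "distr (distr lborel borel T) borel ((+) x) = distr lborel borel T"
      by (simp add: lborel_distr_plus)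
  qed (use A in simp_all)
  then show "emeasure lborel (T -` A) * emeasure lborel (ball 0 1 :: 'a set)
      = emeasure lborel (T -` ball 0 1) * emeasure lborel A"
    using A by (simp add: em)
qed

text \<open>The unit ball is its own preimage, so the factor in \<open>lborel_linear_vimage\<close>
  is one.\<close>

lemma lborel_orthogonal_transformation:
  fixes T :: "'a::euclidean_space \<Rightarrow> 'a"
  assumes T: "orthogonal_transformation T"
  shows "distr lborel borel T = lborel"
proof (rule measure_eqI)
  have lin: "linear T" "inj T" using T by (auto simp: orthogonal_transformation_linear orthogonal_transformation_inj)
  have m: "T \<in> borel_measurable borel"
    using lin(1) by (intro borel_measurable_continuous_onI linear_continuous_on) (simp add: linear_conv_bounded_linear)
  fix A assume "A \<in> sets (distr lborel borel T)"
  then have A: "A \<in> sets borel" by simp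
  have b: "T -` ball 0 1 = ball 0 1" using T by (auto simp: orthogonal_transformation_norm)
  have "emeasure lborel (ball 0 1 :: 'a set) * emeasure lborel (T -` A) = emeasure lborel (ball 0 1 :: 'a set) * emeasure lborel A"
    using lborel_linear_vimage(1)[OF lin A] unfolding b by (simp add: ac_simps)
  then have "emeasure lborel (T -` A) = emeasure lborel A"
    using lborel_linear_vimage(2,3)[OF lin A] unfolding b by (auto simp: ennreal_mult_cancel_left)
  then show "emeasure (distr lborel borel T) A = emeasure lborel A"
    using A m by (simp add: emeasure_distr)
qed simp

section \<open>Orthonormal systems and their coordinates\<close>

definition orthonormal :: "'a::euclidean_space set \<Rightarrow> bool" where
  "orthonormal E \<longleftrightarrow> pairwise orthogonal E \<and> (\<forall>b\<in>E. norm b = 1)"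

definition emb :: "'a::euclidean_space set \<Rightarrow> ('a \<Rightarrow> real) \<Rightarrow> 'a" where
  "emb E x = (\<Sum>b\<in>E. x b *\<^sub>R b)"

lemma orthonormal_finite: "orthonormal E \<Longrightarrow> finite E"
  by (simp add: orthonormal_def pairwise_orthogonal_imp_finite)

lemma orthonormal_independent: "orthonormal E \<Longrightarrow> independent E"
  unfolding orthonormal_def by (metis norm_zero pairwise_orthogonal_independent zero_neq_one)

lemma orthonormal_subset: "orthonormal E \<Longrightarrow> D \<subseteq> E \<Longrightarrow> orthonormal D"
  unfolding orthonormal_def using pairwise_subset by blast

lemma orthonormal_inner:
  assumes "orthonormal E" "a \<in> E" "b \<in> E"
  shows "a \<bullet> b = (if a = b then 1 else 0)"
  using assms by (auto simp: orthonormal_def pairwise_def orthogonal_def norm_eq_1)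

lemma emb_inner:
  assumes "orthonormal E" "D \<subseteq> E" "b \<in> E"
  shows "emb D x \<bullet> b = (if b \<in> D then x b else 0)"
proof -
  have "finite D" using assms orthonormal_finite finite_subset by blast
  have "emb D x \<bullet> b = (\<Sum>a\<in>D. x a * (a \<bullet> b))" by (simp add: emb_def inner_sum_left)
  also have "\<dots> = (\<Sum>a\<in>D. if a = b then x a else 0)"
    using assms by (intro sum.cong) (auto simp: orthonormal_inner[OF assms(1)] subset_iff)
  finally show ?thesis using \<open>finite D\<close> by simp
qed

lemma emb_measurable [measurable]: "emb E \<in> measurable (PL E) borel"
  unfolding emb_def[abs_def] by measurable

lemma orthonormal_extend:
  fixes S :: "'a::euclidean_space set"
  assumes S: "orthonormal S"
  obtains E where "S \<inter> E = {}" "orthonormal (S \<union> E)" "span (S \<union> E) = UNIV"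
proof -
  obtain U where U: "pairwise orthogonal (S \<union> U)" "span (S \<union> U) = span (S \<union> UNIV)"
    using orthogonal_extension[of S UNIV] S by (auto simp: orthonormal_def)
  let ?n = "\<lambda>x::'a. x /\<^sub>R norm x"
  define F where "F = ?n ` (U - {0} - S)"
  define E where "E = F - S"
  have SE: "S \<union> E = S \<union> F" by (auto simp: E_def)
  have o1: "norm b = 1" if "b \<in> S \<union> F" for b using that S by (auto simp: F_def orthonormal_def) (metis left_inverse norm_eq_zero)
  have nn: "\<exists>x\<in>S \<union> U. x \<noteq> 0 \<and> b = ?n x" if "b \<in> S \<union> F" for b
  proof (cases "b \<in> S")
    case True then show ?thesis using o1[of b] by (intro bexI[of _ b]) auto
  next
    case False then show ?thesis using that by (auto simp: F_def)
  qed
  have "pairwise orthogonal (S \<union> F)"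
    unfolding pairwise_def
  proof (intro ballI impI)
    fix a b assume ab: "a \<in> S \<union> F" "b \<in> S \<union> F" "a \<noteq> b"
    then obtain x y where "x \<in> S \<union> U" "y \<in> S \<union> U" "a = ?n x" "b = ?n y" using nn by meson
    moreover from this have "x \<noteq> y" using ab(3) by auto
    ultimately show "orthogonal a b" using U(1) by (auto simp: pairwise_def orthogonal_def)
  qed
  then have on: "orthonormal (S \<union> E)" using o1 unfolding SE orthonormal_def by blast
  have "x \<in> span (S \<union> F)" if "x \<in> S \<union> U" for x
  proof (cases "x \<in> S \<or> x = 0")
    case True then show ?thesis by (auto intro: span_base span_zero)
  next
    case False
    then have "?n x \<in> span (S \<union> F)" using that by (intro span_base) (auto simp: F_def)
    then have "norm x *\<^sub>R ?n x \<in> span (S \<union> F)" by (rule span_mul)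
    then show ?thesis using False by simp
  qed
  then have "span (S \<union> U) \<subseteq> span (S \<union> F)" by (intro span_minimal) auto
  then have "span (S \<union> E) = UNIV" unfolding SE using U(2) by auto
  with on show thesis by (intro that[of E]) (auto simp: E_def)
qed

lemma card_orthonormal_complement:
  fixes W :: "'a::euclidean_space set"
  assumes E: "orthonormal (E \<union> W)" "span (E \<union> W) = UNIV" "E \<inter> W = {}"
  shows "card E = DIM('a) - card W"
proof -
  have "card (E \<union> W) = DIM('a)"
    using dim_eq_card[of "E \<union> W" UNIV] E(2) orthonormal_independent[OF E(1)] by (simp add: dim_UNIV)
  then show ?thesis using card_Un_disjoint[OF _ _ E(3)] orthonormal_finite[OF E(1)] by simp
qed

text \<open>The linear map \<open>T\<close> that carries the standard basis to \<open>E\<close>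
  along a bijection is orthogonal, so it preserves Lebesgue measure; what remains is the relabelling
  \<open>?r\<close> of product coordinates.\<close>

lemma nn_integral_emb:
  fixes E :: "'a::euclidean_space set"
  assumes E: "orthonormal E" "span E = UNIV" and [measurable]: "f \<in> borel_measurable borel"
  shows "(\<integral>\<^sup>+x. f x \<partial>lborel) = (\<integral>\<^sup>+z. f (emb E z) \<partial>PL E)"
proof -
  interpret product_sigma_finite "\<lambda>_. lborel :: real measure" by (rule product_sigma_finite_lborel)
  have fin: "finite E" using E(1) by (rule orthonormal_finite)
  have "card E = card (Basis :: 'a set)"
    using dim_eq_card[of E UNIV] E orthonormal_independent[OF E(1)] by (simp add: dim_UNIV)
  then obtain \<sigma> where \<sigma>: "bij_betw \<sigma> (Basis :: 'a set) E"
    using finite_same_card_bij[of Basis E] fin by auto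
  define T where "T y = (\<Sum>j\<in>Basis. (y \<bullet> j) *\<^sub>R \<sigma> j)" for y :: 'a
  have linT: "linear T" unfolding T_def
    by (intro linearI) (simp_all add: inner_add_left scaleR_add_left sum.distrib scaleR_sum_right)
  have in\<sigma>: "\<sigma> j \<bullet> \<sigma> k = (if j = k then 1 else 0)" if "j \<in> Basis" "k \<in> Basis" for j k
    using orthonormal_inner[OF E(1)] \<sigma> that by (auto simp: bij_betw_def inj_on_def)
  have inT: "T v \<bullet> T w = v \<bullet> w" for v w
  proof -
    have "T v \<bullet> T w = (\<Sum>j\<in>Basis. \<Sum>k\<in>Basis. (w \<bullet> j) * (v \<bullet> k) * (\<sigma> k \<bullet> \<sigma> j))"
      unfolding T_def inner_sum_left inner_sum_right by (intro sum.cong refl) simp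
    also have "\<dots> = (\<Sum>j\<in>Basis. \<Sum>k\<in>Basis. if j = k then (w \<bullet> j) * (v \<bullet> k) else 0)"
      by (intro sum.cong refl) (simp add: in\<sigma>)
    also have "\<dots> = v \<bullet> w" by (simp add: euclidean_inner[of v w] mult.commute)
    finally show ?thesis .
  qed
  have oT: "orthogonal_transformation T" using linT inT by (simp add: orthogonal_transformation_def)
  have [measurable]: "T \<in> borel_measurable borel"
    using linT by (intro borel_measurable_continuous_onI linear_continuous_on) (simp add: linear_conv_bounded_linear)
  define \<rho> where "\<rho> = inv_into Basis \<sigma>"
  have \<rho>: "\<rho> b \<in> Basis" "\<sigma> (\<rho> b) = b" if "b \<in> E" for b
    using \<sigma> that by (auto simp: \<rho>_def bij_betw_def inv_into_into f_inv_into_f)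
  have \<rho>\<sigma>: "\<rho> (\<sigma> j) = j" if "j \<in> Basis" for j
    using \<sigma> that by (simp add: \<rho>_def bij_betw_def)
  let ?r = "\<lambda>z :: 'a \<Rightarrow> real. \<lambda>b\<in>E. z (\<rho> b)"
  have rm: "?r \<in> measurable (PL Basis) (PL E)" using \<rho>(1) by (intro measurable_restrict) simp
  have R: "distr (PL Basis) (PL E) ?r = PL E"
  proof (rule PiM_eqI[OF fin])
    fix A :: "'a \<Rightarrow> real set" assume A: "\<And>i. i \<in> E \<Longrightarrow> A i \<in> sets lborel"
    have "?r -` Pi\<^sub>E E A \<inter> space (PL Basis) = (\<Pi>\<^sub>E j\<in>Basis. A (\<sigma> j))"
    proof (intro set_eqI iffI)
      fix z assume z: "z \<in> ?r -` Pi\<^sub>E E A \<inter> space (PL Basis)"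
      show "z \<in> (\<Pi>\<^sub>E j\<in>Basis. A (\<sigma> j))"
      proof (rule PiE_I)
        fix j assume j: "j \<in> (Basis :: 'a set)"
        then have "\<sigma> j \<in> E" using \<sigma> by (auto simp: bij_betw_def)
        then have "?r z (\<sigma> j) \<in> A (\<sigma> j)" using z by (auto simp: PiE_iff)
        then show "z j \<in> A (\<sigma> j)" using \<open>\<sigma> j \<in> E\<close> \<rho>\<sigma>[OF j] by simp
      qed (use z in \<open>auto simp: space_PiM PiE_def extensional_def\<close>)
    next
      fix z assume z: "z \<in> (\<Pi>\<^sub>E j\<in>Basis. A (\<sigma> j))"
      have "z (\<rho> b) \<in> A b" if "b \<in> E" for b
        using PiE_mem[OF z \<rho>(1)[OF that]] \<rho>(2)[OF that] by simp
      then show "z \<in> ?r -` Pi\<^sub>E E A \<inter> space (PL Basis)"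
        using z by (auto simp: space_PiM PiE_iff)
    qed
    then have "emeasure (distr (PL Basis) (PL E) ?r) (Pi\<^sub>E E A) = emeasure (PL Basis) (\<Pi>\<^sub>E j\<in>Basis. A (\<sigma> j))"
      using A fin by (subst emeasure_distr[OF rm]) (auto intro!: sets_PiM_I_finite)
    also have "\<dots> = (\<Prod>j\<in>Basis. emeasure lborel (A (\<sigma> j)))"
      using A \<sigma> by (intro emeasure_PiM) (auto simp: bij_betw_def)
    also have "\<dots> = (\<Prod>b\<in>E. emeasure lborel (A b))"
      using \<sigma> by (intro prod.reindex_bij_betw)
    finally show "emeasure (distr (PL Basis) (PL E) ?r) (Pi\<^sub>E E A) = (\<Prod>b\<in>E. emeasure lborel (A b))" .
  qed simp
  have "(\<integral>\<^sup>+x. f x \<partial>lborel) = (\<integral>\<^sup>+x. f x \<partial>distr lborel borel T)"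
    using lborel_orthogonal_transformation[OF oT] by simp
  also have "\<dots> = (\<integral>\<^sup>+x. f (T x) \<partial>lborel)" by (rule nn_integral_distr) measurable
  also have "\<dots> = (\<integral>\<^sup>+z. f (T (\<Sum>b\<in>Basis. z b *\<^sub>R b)) \<partial>PL Basis)"
    by (subst lborel_eq, subst nn_integral_distr) measurable
  also have "\<dots> = (\<integral>\<^sup>+z. f (emb E (?r z)) \<partial>PL Basis)"
  proof -
    have "T (\<Sum>b\<in>Basis. z b *\<^sub>R b) = emb E (?r z)" for z
    proof -
      have "T (\<Sum>b\<in>Basis. z b *\<^sub>R b) = (\<Sum>j\<in>Basis. z j *\<^sub>R \<sigma> j)"
        unfolding T_def by (intro sum.cong refl) (simp add: inner_sum_left inner_Basis if_distrib cong: if_cong)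
      also have "\<dots> = (\<Sum>j\<in>Basis. ?r z (\<sigma> j) *\<^sub>R \<sigma> j)"
        using \<sigma> by (intro sum.cong refl) (auto simp: \<rho>\<sigma> bij_betw_def)
      also have "\<dots> = emb E (?r z)" unfolding emb_def using \<sigma> by (rule sum.reindex_bij_betw)
      finally show ?thesis .
    qed
    then show ?thesis by simp
  qed
  also have "\<dots> = (\<integral>\<^sup>+z. f (emb E z) \<partial>distr (PL Basis) (PL E) ?r)"
    by (rule nn_integral_distr[OF rm, symmetric]) measurable
  finally show ?thesis by (simp add: R)
qed

definition orth_proj :: "'a::euclidean_space set \<Rightarrow> 'a \<Rightarrow> 'a" where
  "orth_proj W x = x - (\<Sum>w\<in>W. (x \<bullet> w) *\<^sub>R w)"

definition unit_cyl :: "'a::euclidean_space set \<Rightarrow> 'a set" where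
  "unit_cyl W = {x. \<forall>w\<in>W. x \<bullet> w \<in> {0..1}}"

text \<open>Integral over the orthogonal complement of an orthonormal set \<open>W\<close>, computed in the ambient
  space by fattening with the unit cube spanned by \<open>W\<close>.\<close>
definition vint :: "'a::euclidean_space set \<Rightarrow> ('a \<Rightarrow> ennreal) \<Rightarrow> ennreal" where
  "vint W f = (\<integral>\<^sup>+x. f (orth_proj W x) * indicator (unit_cyl W) x \<partial>lborel)"

lemma orth_proj_measurable [measurable]: "orth_proj W \<in> borel_measurable borel"
  unfolding orth_proj_def[abs_def] by measurable

lemma unit_cyl_measurable [measurable]: "finite W \<Longrightarrow> unit_cyl W \<in> sets borel"
  unfolding unit_cyl_def by measurable

text \<open>In the coordinates \<open>E \<union> W\<close> the cylinder confines the
  \<open>W\<close> part to a cube of measure one, and the projection forgets that part. Hence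
  \<open>vint W\<close> may be computed in any orthonormal basis \<open>E\<close> of the complement,
  in particular in one that contains a prescribed direction.\<close>

lemma vint_emb:
  fixes E :: "'a::euclidean_space set"
  assumes E: "orthonormal (E \<union> W)" "span (E \<union> W) = UNIV" "E \<inter> W = {}" and f[measurable]: "f \<in> borel_measurable borel"
  shows "vint W f = (\<integral>\<^sup>+z. f (emb E z) \<partial>PL E)"
proof -
  interpret product_sigma_finite "\<lambda>_. lborel :: real measure" by (rule product_sigma_finite_lborel)
  have fin: "finite E" "finite W" using orthonormal_finite[OF E(1)] by auto
  have [measurable]: "unit_cyl W \<in> sets borel" using fin(2) by (rule unit_cyl_measurable)
  have pr: "orth_proj W (emb (E \<union> W) z) = emb E z" for z
  proof -
    have "(\<Sum>w\<in>W. (emb (E \<union> W) z \<bullet> w) *\<^sub>R w) = emb W z"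
      unfolding emb_def[of W] by (intro sum.cong refl) (simp add: emb_inner[OF E(1)])
    moreover have "emb (E \<union> W) z = emb E z + emb W z"
      unfolding emb_def using fin E(3) by (rule sum.union_disjoint)
    ultimately show ?thesis by (simp add: orth_proj_def)
  qed
  have cy: "emb (E \<union> W) z \<in> unit_cyl W \<longleftrightarrow> (\<forall>w\<in>W. z w \<in> {0..1})" for z
    by (simp add: unit_cyl_def emb_inner[OF E(1)])
  let ?C = "\<Pi>\<^sub>E w\<in>W. {0..1::real}"
  have "vint W f = (\<integral>\<^sup>+z. f (emb E z) * indicator (unit_cyl W) (emb (E \<union> W) z) \<partial>PL (E \<union> W))"
    unfolding vint_def by (subst nn_integral_emb[OF E(1,2)]) (simp_all add: pr)
  also have "\<dots> = (\<integral>\<^sup>+x. (\<integral>\<^sup>+y. f (emb E (merge E W (x, y))) * indicator (unit_cyl W) (emb (E \<union> W) (merge E W (x, y))) \<partial>PL W) \<partial>PL E)"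
  proof (rule product_nn_integral_fold[OF E(3) fin])
    have "(\<lambda>z. f (orth_proj W (emb (E \<union> W) z)) * indicator (unit_cyl W) (emb (E \<union> W) z)) \<in> borel_measurable (PL (E \<union> W))"
      by measurable
    then show "(\<lambda>z. f (emb E z) * indicator (unit_cyl W) (emb (E \<union> W) z)) \<in> borel_measurable (PL (E \<union> W))"
      by (simp add: pr)
  qed
  also have "\<dots> = (\<integral>\<^sup>+x. (\<integral>\<^sup>+y. f (emb E x) * indicator ?C y \<partial>PL W) \<partial>PL E)"
  proof (intro nn_integral_cong)
    fix x y assume xy: "x \<in> space (PL E)" "y \<in> space (PL W)"
    have "emb E (merge E W (x, y)) = emb E x"
      unfolding emb_def by (intro sum.cong refl) (simp add: merge_def)
    moreover have "emb (E \<union> W) (merge E W (x, y)) \<in> unit_cyl W \<longleftrightarrow> y \<in> ?C"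
      unfolding cy using xy(2) E(3) by (auto simp: space_PiM PiE_iff merge_def)
    ultimately show "f (emb E (merge E W (x, y))) * indicator (unit_cyl W) (emb (E \<union> W) (merge E W (x, y)))
        = f (emb E x) * indicator ?C y" by (simp add: indicator_def)
  qed
  also have "\<dots> = (\<integral>\<^sup>+x. f (emb E x) * emeasure (PL W) ?C \<partial>PL E)"
    using fin by (intro nn_integral_cong) (simp add: nn_integral_cmult sets_PiM_I_finite)
  also have "emeasure (PL W) ?C = 1" using fin by (simp add: emeasure_PiM)
  finally show ?thesis by simp
qed

subsection \<open>Equality forces homothety\<close>

definition vvol :: "'a::euclidean_space set \<Rightarrow> 'a set \<Rightarrow> ennreal" where
  "vvol W X = vint W (indicator X)"

text \<open>Normalised so that its power to the dimension of the complement is the volume. In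
  dimension zero the exponent \<open>1 / 0\<close> is \<open>0\<close>, and the value is
  \<open>1\<close> for positive finite volume.\<close>

definition vrad :: "'a::euclidean_space set \<Rightarrow> 'a set \<Rightarrow> real" where
  "vrad W X = enn2real (vvol W X) powr (1 / real (DIM('a) - card W))"

definition vavg :: "'a::euclidean_space set \<Rightarrow> 'a set \<Rightarrow> ('a \<Rightarrow> ennreal) \<Rightarrow> ennreal" where
  "vavg W X f = vint W (\<lambda>x. f x * indicator X x) / vvol W X"

definition vbody :: "'a::euclidean_space set \<Rightarrow> 'a set \<Rightarrow> bool" where
  "vbody W X \<longleftrightarrow> X \<in> sets borel \<and> convex X \<and> bounded X \<and> (\<forall>x\<in>X. \<forall>w\<in>W. x \<bullet> w = 0) \<and> vvol W X > 0"

text \<open>Integrating over the fattened set in the ambient space produces a single vector that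
  depends on no basis and no direction.\<close>

definition vcentroid :: "'a::euclidean_space set \<Rightarrow> 'a set \<Rightarrow> 'a" where
  "vcentroid W X = (1 / enn2real (vvol W X)) *\<^sub>R
     (\<integral>x. indicator (unit_cyl W \<inter> orth_proj W -` X) x *\<^sub>R orth_proj W x \<partial>lborel)"

section \<open>Volume and centroid in an orthogonal complement\<close>

lemma orth_proj_inner:
  assumes "orthonormal W" "w \<in> W"
  shows "orth_proj W x \<bullet> w = 0"
proof -
  have fin: "finite W" using assms orthonormal_finite by blast
  have "(\<Sum>a\<in>W. (x \<bullet> a) *\<^sub>R a) \<bullet> w = (\<Sum>a\<in>W. if a = w then x \<bullet> a else 0)"
    unfolding inner_sum_left using assms by (intro sum.cong) (auto simp: orthonormal_inner[OF assms(1)])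
  then show ?thesis using fin assms(2) by (simp add: orth_proj_def inner_diff_left)
qed

lemma orth_proj_inner_eq:
  assumes "\<And>w. w \<in> W \<Longrightarrow> e \<bullet> w = 0"
  shows "orth_proj W x \<bullet> e = x \<bullet> e"
proof -
  have "w \<bullet> e = 0" if "w \<in> W" for w using assms[OF that] by (simp add: inner_commute)
  then show ?thesis by (simp add: orth_proj_def inner_diff_left inner_sum_left)
qed

lemma norm_le_cyl:
  assumes "orthonormal W" "x \<in> unit_cyl W"
  shows "norm x \<le> norm (orth_proj W x) + card W"
proof -
  have "norm (\<Sum>w\<in>W. (x \<bullet> w) *\<^sub>R w) \<le> (\<Sum>w\<in>W. 1)"
    using assms by (intro sum_norm_le) (auto simp: unit_cyl_def orthonormal_def)
  moreover have "x = orth_proj W x + (\<Sum>w\<in>W. (x \<bullet> w) *\<^sub>R w)" by (simp add: orth_proj_def)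
  ultimately show ?thesis using norm_triangle_ineq[of "orth_proj W x" "\<Sum>w\<in>W. (x \<bullet> w) *\<^sub>R w"] by simp
qed

lemma vvol_eq:
  assumes "orthonormal W" "X \<in> sets borel"
  shows "vvol W X = emeasure lborel (unit_cyl W \<inter> orth_proj W -` X)"
    and "unit_cyl W \<inter> orth_proj W -` X \<in> sets borel"
proof -
  show m: "unit_cyl W \<inter> orth_proj W -` X \<in> sets borel"
    using unit_cyl_measurable[OF orthonormal_finite[OF assms(1)]] measurable_sets_borel[OF orth_proj_measurable assms(2)]
    by (rule sets.Int)
  have "vvol W X = (\<integral>\<^sup>+x. indicator (unit_cyl W \<inter> orth_proj W -` X) x \<partial>lborel)"
    unfolding vvol_def vint_def by (intro nn_integral_cong) (auto simp: indicator_def)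
  then show "vvol W X = emeasure lborel (unit_cyl W \<inter> orth_proj W -` X)" using m by simp
qed

lemma vvol_finite:
  assumes W: "orthonormal W" and "bounded X" "X \<in> sets borel"
  shows "vvol W X < top"
proof -
  obtain R where R: "\<And>x. x \<in> X \<Longrightarrow> norm x \<le> R" using assms(2) bounded_iff by blast
  have "bounded (unit_cyl W \<inter> orth_proj W -` X)"
    unfolding bounded_iff using norm_le_cyl[OF W] R by (intro exI[of _ "R + card W"]) (smt (verit) IntE vimageE)
  then show ?thesis using emeasure_bounded_finite vvol_eq[OF W assms(3)] by simp
qed

text \<open>\<open>vint\<close> takes values in \<open>ennreal\<close>, so the first moment in
  direction \<open>e\<close> is shifted by \<open>R\<close>, which makes
  \<open>x \<bullet> e + R\<close> nonnegative on \<open>X\<close>.\<close>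

lemma vcentroid_inner:
  assumes W: "orthonormal W" and X: "vbody W X" and R: "X \<subseteq> cball 0 R" and e: "norm e \<le> 1"
  shows "vint W (\<lambda>x. ennreal (x \<bullet> e + R) * indicator X x) = vvol W X * ennreal (vcentroid W X \<bullet> e + R)"
    and "vcentroid W X \<bullet> e + R \<ge> 0"
proof -
  have Xb: "X \<in> sets borel" "bounded X" "vvol W X > 0" using X by (auto simp: vbody_def)
  define C where "C = unit_cyl W \<inter> orth_proj W -` X"
  have C[measurable]: "C \<in> sets borel" and vC: "vvol W X = emeasure lborel C"
    unfolding C_def using vvol_eq[OF W Xb(1)] by auto
  have finC: "emeasure lborel C < top" using vvol_finite[OF W Xb(2,1)] vC by simp
  define m where "m = enn2real (vvol W X)"
  have m: "vvol W X = ennreal m" "m > 0" "measure lborel C = m"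
    using vvol_finite[OF W Xb(2,1)] Xb(3) by (auto simp: m_def enn2real_positive_iff less_top vC measure_def)
  define p where "p x = indicat_real C x *\<^sub>R orth_proj W x" for x
  have pR: "norm (orth_proj W x) \<le> R" if "x \<in> C" for x using that R by (auto simp: C_def)
  have ip: "integrable lborel p"
    unfolding p_def[abs_def] using finC pR
    by (intro integrableI_bounded_set_indicator[where B=R]) auto
  have iC: "integrable lborel (indicat_real C)" using finC by (simp add: integrable_indicator_iff)
  have cen: "vcentroid W X = (1 / m) *\<^sub>R integral\<^sup>L lborel p"
    by (simp add: vcentroid_def m_def p_def[abs_def] C_def)
  have nn: "p x \<bullet> e + R * indicator C x \<ge> 0" for x
  proof (cases "x \<in> C")
    case True
    have "\<bar>orth_proj W x \<bullet> e\<bar> \<le> norm (orth_proj W x) * norm e" by (rule Cauchy_Schwarz_ineq2)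
    also have "\<dots> \<le> R * 1" using pR[OF True] e order_trans[OF norm_ge_zero pR[OF True]] by (intro mult_mono) simp_all
    finally show ?thesis using True by (simp add: p_def abs_le_iff)
  qed (simp add: p_def)
  have int: "integrable lborel (\<lambda>x. p x \<bullet> e + R * indicator C x)"
    using ip iC by (intro Bochner_Integration.integrable_add integrable_inner_left integrable_mult_right) auto
  have val: "(\<integral>x. p x \<bullet> e + R * indicator C x \<partial>lborel) = m * (vcentroid W X \<bullet> e + R)"
  proof -
    have "(\<integral>x. p x \<bullet> e + R * indicator C x \<partial>lborel) = integral\<^sup>L lborel p \<bullet> e + R * m"
      using ip iC m(3) by (subst Bochner_Integration.integral_add) auto
    then show ?thesis using m(2) by (simp add: cen algebra_simps)
  qed
  have "0 \<le> m * (vcentroid W X \<bullet> e + R)" unfolding val[symmetric] using nn by (intro integral_nonneg_AE) simp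
  then show "vcentroid W X \<bullet> e + R \<ge> 0" using m(2) by (simp add: zero_le_mult_iff)
  have "vint W (\<lambda>x. ennreal (x \<bullet> e + R) * indicator X x) = (\<integral>\<^sup>+x. ennreal (p x \<bullet> e + R * indicator C x) \<partial>lborel)"
    unfolding vint_def by (intro nn_integral_cong) (auto simp: p_def C_def indicator_def)
  also have "\<dots> = ennreal (m * (vcentroid W X \<bullet> e + R))"
    unfolding val[symmetric] using int nn by (intro nn_integral_eq_integral) auto
  also have "\<dots> = vvol W X * ennreal (vcentroid W X \<bullet> e + R)"
    unfolding m(1) using m(2) by (simp add: ennreal_mult')
  finally show "vint W (\<lambda>x. ennreal (x \<bullet> e + R) * indicator X x) = vvol W X * ennreal (vcentroid W X \<bullet> e + R)" .
qed

lemma emb_expand: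
  assumes E: "orthonormal (E \<union> W)" "span (E \<union> W) = UNIV" and x: "\<And>w. w \<in> W \<Longrightarrow> x \<bullet> w = 0"
  shows "emb E (\<lambda>b\<in>E. x \<bullet> b) = x"
proof -
  let ?d = "x - emb E (\<lambda>b\<in>E. x \<bullet> b)"
  have "orthogonal ?d b" if "b \<in> E \<union> W" for b
    using emb_inner[OF E(1) _ that, of E] that x by (auto simp: orthogonal_def inner_diff_left)
  then have "orthogonal ?d ?d" using orthogonal_to_span[of ?d "E \<union> W"] E(2) by (metis UNIV_I orthogonal_commute)
  then show ?thesis by (simp add: orthogonal_self)
qed

text \<open>A consequence of \<open>vint_emb\<close>: the dictionary between the notions on the
  complement of \<open>W\<close> and those on \<open>PL E\<close>, valid for every orthonormal
  completion \<open>E\<close>.\<close>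

lemma pbody_coordinates:
  assumes E: "orthonormal (E \<union> W)" "span (E \<union> W) = UNIV" "E \<inter> W = {}" and X: "vbody W X"
  defines "XE \<equiv> emb E -` X \<inter> space (PL E)"
  shows "pbody E XE" "emeasure (PL E) XE = vvol W X" "prad E XE = vrad W X"
    "f \<in> borel_measurable borel \<Longrightarrow> (\<integral>\<^sup>+z\<in>XE. f (emb E z) \<partial>PL E) = vint W (\<lambda>x. f x * indicator X x)"
    "f \<in> borel_measurable borel \<Longrightarrow> pavg E XE (\<lambda>z. f (emb E z)) = vavg W X f"
proof -
  have Xb: "X \<in> sets borel" "convex X" "bounded X" "vvol W X > 0" using X by (auto simp: vbody_def)
  have fin: "finite E" "finite W" using orthonormal_finite[OF E(1)] by auto
  have XE: "XE \<in> sets (PL E)" unfolding XE_def using Xb(1) by (rule measurable_sets[OF emb_measurable])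
  show i: "(\<integral>\<^sup>+z\<in>XE. f (emb E z) \<partial>PL E) = vint W (\<lambda>x. f x * indicator X x)"
    if [measurable]: "f \<in> borel_measurable borel" for f
  proof -
    have "(\<lambda>x. f x * indicator X x) \<in> borel_measurable borel" using Xb(1) by measurable
    from vint_emb[OF E this] have "vint W (\<lambda>x. f x * indicator X x) = (\<integral>\<^sup>+z. f (emb E z) * indicator X (emb E z) \<partial>PL E)" .
    also have "\<dots> = (\<integral>\<^sup>+z\<in>XE. f (emb E z) \<partial>PL E)"
      by (intro nn_integral_cong) (simp add: XE_def indicator_def)
    finally show ?thesis ..
  qed
  show v: "emeasure (PL E) XE = vvol W X" using i[of "\<lambda>_. 1"] XE by (simp add: vvol_def)
  show "pavg E XE (\<lambda>z. f (emb E z)) = vavg W X f" if "f \<in> borel_measurable borel"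
    unfolding pavg_def vavg_def v i[OF that] ..
  show "prad E XE = vrad W X" by (simp add: prad_def vrad_def measure_def v card_orthonormal_complement[OF E])
  have oE: "orthonormal E" using orthonormal_subset[OF E(1)] by blast
  show "pbody E XE"
    unfolding pbody_def
  proof (intro conjI XE)
    show "emeasure (PL E) XE > 0" using Xb(4) v by simp
    show "pconvex E XE"
      unfolding pconvex_def
    proof (intro ballI)
      fix x y and l :: real assume xy: "x \<in> XE" "y \<in> XE" "l \<in> {0<..<1}"
      have "emb E (\<lambda>i\<in>E. (1 - l) * x i + l * y i) = (1 - l) *\<^sub>R emb E x + l *\<^sub>R emb E y"
        by (simp add: emb_def scaleR_sum_right sum.distrib[symmetric] algebra_simps)
      also have "\<dots> \<in> X" using convexD_alt[OF Xb(2), of "emb E x" "emb E y" l] xy by (simp add: XE_def)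
      finally show "(\<lambda>i\<in>E. (1 - l) * x i + l * y i) \<in> XE" by (simp add: XE_def space_PiM)
    qed
    obtain R where R: "\<And>x. x \<in> X \<Longrightarrow> norm x \<le> R" using Xb(3) bounded_iff by blast
    have "\<bar>z b\<bar> \<le> R" if "z \<in> XE" "b \<in> E" for z b
    proof -
      have "\<bar>emb E z \<bullet> b\<bar> \<le> norm (emb E z) * norm b" by (rule Cauchy_Schwarz_ineq2)
      then show ?thesis using emb_inner[OF oE subset_refl that(2)] that oE R[of "emb E z"]
        by (simp add: XE_def orthonormal_def)
    qed
    then show "\<exists>C. \<forall>x\<in>XE. \<forall>i\<in>E. \<bar>x i\<bar> \<le> C" by blast
  qed
qed

text \<open>A basis of the complement that contains \<open>e\<close> makes \<open>e\<close> the
  slicing coordinate, and the heights are coupled by \<open>r = c * q + k\<close>. The mean of a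
  quantile map is the \<open>e\<close>-coordinate of the centroid, so first moments give
  \<open>k = v \<bullet> e\<close> with one vector \<open>v\<close> for all directions. The tops of
  the two height ranges then correspond under the affine map; \<open>\<eta>\<close> is there because
  the suprema need not be attained.\<close>

lemma support_relation:
  fixes W :: "'a::euclidean_space set"
  assumes W: "orthonormal W" and e: "norm e = 1" "\<And>w. w \<in> W \<Longrightarrow> e \<bullet> w = 0"
    and P: "vbody W P" and Q: "vbody W Q"
    and [measurable]: "f \<in> borel_measurable borel" "g \<in> borel_measurable borel" "h \<in> borel_measurable borel"
    and fgh: "\<And>x y. x \<in> P \<Longrightarrow> y \<in> Q \<Longrightarrow> f x + g y \<le> h (x + y)" and f0: "\<And>x. x \<in> P \<Longrightarrow> f x > 0"
    and eq: "vint W h = ennreal ((vrad W P + vrad W Q) ^ (DIM('a) - card W)) * (vavg W P f + vavg W Q g)"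
    and fin: "vint W h < top"
  defines "c \<equiv> vrad W Q / vrad W P" and "v \<equiv> vcentroid W Q - (vrad W Q / vrad W P) *\<^sub>R vcentroid W P"
  shows "\<And>y \<eta>. y \<in> Q \<Longrightarrow> \<eta> > 0 \<Longrightarrow> \<exists>x\<in>P. y \<bullet> e \<le> (c *\<^sub>R x + v) \<bullet> e + \<eta>"
    and "\<And>x \<eta>. x \<in> P \<Longrightarrow> \<eta> > 0 \<Longrightarrow> \<exists>y\<in>Q. (c *\<^sub>R x + v) \<bullet> e \<le> y \<bullet> e + \<eta>"
proof -
  let ?I = "{0<..<1::real}"
  have eW: "e \<notin> W" using e by (auto simp: norm_eq_1)
  have "orthonormal (insert e W)"
    using W e unfolding orthonormal_def pairwise_insert by (auto simp: orthogonal_def inner_commute)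
  from orthonormal_extend[OF this] obtain D where D: "insert e W \<inter> D = {}"
    "orthonormal (insert e W \<union> D)" "span (insert e W \<union> D) = UNIV" by blast
  define E where "E = insert e D"
  have EW: "orthonormal (E \<union> W)" "span (E \<union> W) = UNIV" "E \<inter> W = {}"
    using D eW by (auto simp: E_def Un_ac)
  have oE: "orthonormal E" using orthonormal_subset[OF EW(1)] by blast
  have Dfin: "finite D" "e \<notin> D" using orthonormal_finite[OF oE] D(1) by (auto simp: E_def)
  define PE QE where "PE = emb E -` P \<inter> space (PL E)" and "QE = emb E -` Q \<inter> space (PL E)"
  note cP = pbody_coordinates[OF EW P, folded PE_def] and cQ = pbody_coordinates[OF EW Q, folded QE_def]
  have pQ: "pbody (insert e D) QE" and pP: "pbody (insert e D) PE" using cP(1) cQ(1) by (simp_all add: E_def)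
  have addE: "emb E (\<lambda>i\<in>E. x i + y i) = emb E x + emb E y" for x y
    by (simp add: emb_def sum.distrib[symmetric] scaleR_add_left)
  have sup: "supadditive_on (insert e D) PE QE (\<lambda>z. f (emb E z)) (\<lambda>z. g (emb E z)) (\<lambda>z. h (emb E z))"
    unfolding supadditive_on_def E_def[symmetric] addE using fgh by (auto simp: PE_def QE_def)
  have hE: "(\<integral>\<^sup>+z. h (emb E z) \<partial>PL E) = vint W h" using vint_emb[OF EW] by simp
  have cardE: "card E = DIM('a) - card W" by (rule card_orthonormal_complement[OF EW])
  obtain t0 t1 s0 s1 and q r :: "real \<Rightarrow> real" where
    sq: "slice_quantile e E PE q t0 t1" and sr: "slice_quantile e E QE r s0 s1"
    and aff: "\<exists>k. \<forall>\<tau>\<in>?I. r \<tau> = c * q \<tau> + k"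
  proof (-, rule slice_coupling[OF Dfin bonnesen_on_finite[OF Dfin(1)] pP pQ sup], goal_cases)
    case (1 t0 t1 s0 s1 q r)
    note G = 1(2-)[folded E_def]
    have "\<exists>k. \<forall>\<tau>\<in>?I. r \<tau> = prad E QE / prad E PE * q \<tau> + k"
    proof (rule G(4))
      show "(\<integral>\<^sup>+z. h (emb E z) \<partial>PL E) = ennreal ((prad E PE + prad E QE) ^ card E)
          * (pavg E PE (\<lambda>z. f (emb E z)) + pavg E QE (\<lambda>z. g (emb E z)))"
        unfolding hE eq cardE using cP(3,5) cQ(3,5) by simp
      show "(\<integral>\<^sup>+z. h (emb E z) \<partial>PL E) < top" unfolding hE by (rule fin)
      show "f (emb E x) > 0" if "x \<in> PE" for x using that f0 by (simp add: PE_def)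
    qed
    then have "\<exists>k. \<forall>\<tau>\<in>?I. r \<tau> = c * q \<tau> + k" unfolding c_def cP(3) cQ(3) .
    with G(1,2) show ?case by (rule 1(1))
  qed
  have qr: "q \<in> borel_measurable borel" "r \<in> borel_measurable borel"
      "q ` ?I = {t0<..<t1}" "r ` ?I = {s0<..<s1}"
    and Pt: "\<And>p. p \<in> PE \<Longrightarrow> p e \<in> {t0..t1}" and Qs: "\<And>p. p \<in> QE \<Longrightarrow> p e \<in> {s0..s1}"
    and tP: "\<And>t. t \<in> {t0<..<t1} \<Longrightarrow> \<exists>p\<in>PE. p e = t" and sQ: "\<And>s. s \<in> {s0<..<s1} \<Longrightarrow> \<exists>p\<in>QE. p e = s"
    using sq sr unfolding slice_quantile_def quantile_map_def by blast+
  from aff obtain k where k: "\<And>\<tau>. \<tau> \<in> ?I \<Longrightarrow> r \<tau> = c * q \<tau> + k" by blast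
  have c: "c > 0"
    using prad_power(1)[OF orthonormal_finite[OF oE] cP(1)] prad_power(1)[OF orthonormal_finite[OF oE] cQ(1)]
    by (simp add: c_def cP(3) cQ(3))
  have eE: "e \<in> E" by (simp add: E_def)
  have emb_e: "emb E z \<bullet> e = z e" for z using emb_inner[OF oE subset_refl eE, of z] eE by simp
  have lift: "\<exists>z\<in>emb E -` X \<inter> space (PL E). z e = x \<bullet> e" if "vbody W X" "x \<in> X" for X x
  proof (intro bexI[of _ "\<lambda>b\<in>E. x \<bullet> b"])
    have "emb E (\<lambda>b\<in>E. x \<bullet> b) = x" using that by (intro emb_expand[OF EW(1,2)]) (auto simp: vbody_def)
    then show "(\<lambda>b\<in>E. x \<bullet> b) \<in> emb E -` X \<inter> space (PL E)" using that by (simp add: space_PiM)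
  qed (use eE in simp)
  have qI: "q \<tau> \<in> {t0<..<t1}" and rI: "r \<tau> \<in> {s0<..<s1}" if "\<tau> \<in> ?I" for \<tau> using qr(3,4) that by blast+
  obtain R0 where R0: "P \<subseteq> cball 0 R0" "Q \<subseteq> cball 0 R0"
  proof -
    have "bounded (P \<union> Q)" using P Q by (auto simp: vbody_def)
    then obtain R where R: "\<forall>x\<in>P \<union> Q. norm x \<le> R" unfolding bounded_iff ..
    show thesis by (rule that[of R]) (use R in auto)
  qed
  have kv: "k = v \<bullet> e"
  proof -
    \<comment> \<open>\<open>R2\<close> is so large that \<open>Q\<close> lies in its ball and
      \<open>k + R2 - c * R0\<close> is nonnegative; then
      \<open>r + R2 = c * (q + R0) + (k + R2 - c * R0)\<close> is an identity between nonnegative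
      terms and can be integrated in \<open>ennreal\<close>.\<close>
    define R2 where "R2 = max R0 (c * R0 - k)"
    have R2: "Q \<subseteq> cball 0 R2" "k + R2 - c * R0 \<ge> 0" using R0 by (auto simp: R2_def)
    \<comment> \<open>Centroid and quantile map both compute the shifted first moment of
      \<open>X\<close> in direction \<open>e\<close>; the positive finite volume is
      cancelled.\<close>
    have mom: "(\<integral>\<^sup>+\<tau>\<in>?I. ennreal (s \<tau> + R) \<partial>lborel) = ennreal (vcentroid W X \<bullet> e + R)"
      if X: "vbody W X" "X \<subseteq> cball 0 R"
        and si: "slice_quantile e E (emb E -` X \<inter> space (PL E)) s a b" for X R s a b
    proof -
      have "vvol W X * ennreal (vcentroid W X \<bullet> e + R) = vint W (\<lambda>x. ennreal (x \<bullet> e + R) * indicator X x)"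
        using vcentroid_inner(1)[OF W X] e(1) by simp
      also have "\<dots> = (\<integral>\<^sup>+z. ennreal (z e + R) * indicator (emb E -` X \<inter> space (PL E)) z \<partial>PL E)"
        by (subst pbody_coordinates(4)[OF EW X(1), symmetric]) (simp_all add: emb_e)
      also have "\<dots> = vvol W X * (\<integral>\<^sup>+\<tau>\<in>?I. ennreal (s \<tau> + R) \<partial>lborel)"
      proof -
        have "\<forall>k\<in>borel_measurable borel. (\<integral>\<^sup>+z\<in>emb E -` X \<inter> space (PL E). k (z e) \<partial>PL E)
            = vvol W X * (\<integral>\<^sup>+\<tau>\<in>?I. k (s \<tau>) \<partial>lborel)"
          using si pbody_coordinates(2)[OF EW X(1)] by (simp add: slice_quantile_def quantile_map_def)
        from bspec[OF this, of "\<lambda>t. ennreal (t + R)"] show ?thesis by simp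
      qed
      finally show ?thesis
        using X(1) vvol_finite[OF W, of X] by (auto simp: vbody_def ennreal_mult_cancel_left)
    qed
    have mP: "(\<integral>\<^sup>+\<tau>\<in>?I. ennreal (q \<tau> + R0) \<partial>lborel) = ennreal (vcentroid W P \<bullet> e + R0)"
      by (rule mom[OF P R0(1) sq[unfolded PE_def]])
    have mQ: "(\<integral>\<^sup>+\<tau>\<in>?I. ennreal (r \<tau> + R2) \<partial>lborel) = ennreal (vcentroid W Q \<bullet> e + R2)"
      by (rule mom[OF Q R2(1) sr[unfolded QE_def]])
    have qR: "q \<tau> + R0 \<ge> 0" if \<tau>: "\<tau> \<in> ?I" for \<tau>
    proof -
      obtain z where "z \<in> PE" "z e = q \<tau>" using tP[OF qI[OF \<tau>]] by blast
      then have "emb E z \<in> P" "emb E z \<bullet> e = q \<tau>" using emb_e by (auto simp: PE_def)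
      moreover have "\<bar>emb E z \<bullet> e\<bar> \<le> norm (emb E z) * norm e" by (rule Cauchy_Schwarz_ineq2)
      ultimately show ?thesis using R0(1) e(1) by (auto simp: subset_iff abs_le_iff)
    qed
    note [measurable] = qr(1,2)
    have "(\<integral>\<^sup>+\<tau>\<in>?I. ennreal (r \<tau> + R2) \<partial>lborel)
        = (\<integral>\<^sup>+\<tau>. ennreal c * (ennreal (q \<tau> + R0) * indicator ?I \<tau>) + ennreal (k + R2 - c * R0) * indicator ?I \<tau> \<partial>lborel)"
    proof (rule nn_integral_cong)
      fix \<tau> :: real
      show "ennreal (r \<tau> + R2) * indicator ?I \<tau>
          = ennreal c * (ennreal (q \<tau> + R0) * indicator ?I \<tau>) + ennreal (k + R2 - c * R0) * indicator ?I \<tau>"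
      proof (cases "\<tau> \<in> ?I")
        case True
        have "ennreal c * ennreal (q \<tau> + R0) + ennreal (k + R2 - c * R0) = ennreal (c * (q \<tau> + R0) + (k + R2 - c * R0))"
          using c qR[OF True] R2(2) by (simp add: ennreal_mult' ennreal_plus)
        also have "c * (q \<tau> + R0) + (k + R2 - c * R0) = r \<tau> + R2" using k[OF True] by (simp add: algebra_simps)
        finally show ?thesis using True by simp
      qed simp
    qed
    also have "\<dots> = ennreal c * ennreal (vcentroid W P \<bullet> e + R0) + ennreal (k + R2 - c * R0)"
      by (subst nn_integral_add) (simp_all add: nn_integral_cmult mP)
    also have "\<dots> = ennreal (c * (vcentroid W P \<bullet> e + R0) + (k + R2 - c * R0))"
      using c vcentroid_inner(2)[OF W P R0(1), of e] R2(2) e(1) by (simp add: ennreal_mult' ennreal_plus)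
    finally have "ennreal (vcentroid W Q \<bullet> e + R2) = ennreal (c * (vcentroid W P \<bullet> e + R0) + (k + R2 - c * R0))"
      using mQ by simp
    moreover have "vcentroid W Q \<bullet> e + R2 \<ge> 0" using vcentroid_inner(2)[OF W Q R2(1), of e] e(1) by simp
    moreover have "c * (vcentroid W P \<bullet> e + R0) + (k + R2 - c * R0) \<ge> 0"
      using c vcentroid_inner(2)[OF W P R0(1), of e] R2(2) e(1) by simp
    ultimately have "vcentroid W Q \<bullet> e + R2 = c * (vcentroid W P \<bullet> e + R0) + (k + R2 - c * R0)" by simp
    then show ?thesis by (simp add: v_def c_def[symmetric] inner_diff_left algebra_simps)
  qed
  have ve: "(c *\<^sub>R x + v) \<bullet> e = c * (x \<bullet> e) + k" for x by (simp add: kv inner_add_left)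
  show "\<exists>x\<in>P. y \<bullet> e \<le> (c *\<^sub>R x + v) \<bullet> e + \<eta>" if y: "y \<in> Q" and \<eta>: "\<eta> > 0" for y \<eta>
  proof -
    obtain z where "z \<in> QE" "z e = y \<bullet> e" using lift[OF Q y] by (auto simp: QE_def)
    then have "y \<bullet> e \<le> s1" "s0 \<le> s1" using Qs by force+
    have "s0 < s1" using qr(4) by (metis greaterThanLessThan_empty_iff image_is_empty not_le zero_less_one)
    \<comment> \<open>Any height within \<open>\<eta>\<close> of the top \<open>s1\<close> will do:
      a point of \<open>P\<close> at the coupled height reaches, after the affine map, almost as far
      as \<open>y\<close>.\<close>
    then obtain s where s: "s \<in> {s0<..<s1}" "s1 - \<eta> < s"
      using dense[of "max s0 (s1 - \<eta>)" s1] \<eta> by auto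
    then obtain \<tau> where \<tau>: "\<tau> \<in> ?I" "s = r \<tau>" using qr(4) by (metis imageE)
    obtain p where p: "p \<in> PE" "p e = q \<tau>" using tP[OF qI[OF \<tau>(1)]] by blast
    have "emb E p \<in> P" using p(1) by (simp add: PE_def)
    moreover have "y \<bullet> e \<le> (c *\<^sub>R emb E p + v) \<bullet> e + \<eta>"
      unfolding ve emb_e p(2) using k[OF \<tau>(1)] s(2) \<tau>(2) \<open>y \<bullet> e \<le> s1\<close> by simp
    ultimately show ?thesis by blast
  qed
  show "\<exists>y\<in>Q. (c *\<^sub>R x + v) \<bullet> e \<le> y \<bullet> e + \<eta>" if x: "x \<in> P" and \<eta>: "\<eta> > 0" for x \<eta>
  proof -
    obtain z where "z \<in> PE" "z e = x \<bullet> e" using lift[OF P x] by (auto simp: PE_def)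
    then have xt: "x \<bullet> e \<le> t1" using Pt by force
    have "t0 < t1" using qr(3) by (metis greaterThanLessThan_empty_iff image_is_empty not_le zero_less_one)
    \<comment> \<open>Heights in \<open>P\<close> get multiplied by \<open>c\<close>, so the margin
      below the top is \<open>\<eta> / c\<close>.\<close>
    then obtain t where t: "t \<in> {t0<..<t1}" "t1 - \<eta> / c < t"
      using dense[of "max t0 (t1 - \<eta> / c)" t1] \<eta> c by auto
    then obtain \<tau> where \<tau>: "\<tau> \<in> ?I" "t = q \<tau>" using qr(3) by (metis imageE)
    obtain p where p: "p \<in> QE" "p e = r \<tau>" using sQ[OF rI[OF \<tau>(1)]] by blast
    have "emb E p \<in> Q" using p(1) by (simp add: QE_def)
    moreover have "c * (x \<bullet> e) \<le> c * (t + \<eta> / c)" using xt t(2) c by (intro mult_left_mono) auto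
    then have "(c *\<^sub>R x + v) \<bullet> e \<le> emb E p \<bullet> e + \<eta>"
      unfolding ve emb_e p(2) using k[OF \<tau>(1)] \<tau>(2) c by (simp add: algebra_simps)
    ultimately show ?thesis by blast
  qed
qed

text \<open>Separation of a point from a closed convex set, with directions confined to the
  complement of \<open>W\<close>: on vectors orthogonal to \<open>W\<close> a functional
  \<open>a\<close> agrees with its projection \<open>d\<close>, so \<open>d\<close> separates as
  well.\<close>

lemma subset_if_support_le:
  fixes X Y :: "'a::euclidean_space set"
  assumes W: "orthonormal W" and X: "closed X" "convex X" "X \<noteq> {}" "\<And>x w. x \<in> X \<Longrightarrow> w \<in> W \<Longrightarrow> x \<bullet> w = 0"
    and Y: "\<And>x w. x \<in> Y \<Longrightarrow> w \<in> W \<Longrightarrow> x \<bullet> w = 0"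
    and sup: "\<And>e y \<eta>. norm e = 1 \<Longrightarrow> (\<And>w. w \<in> W \<Longrightarrow> e \<bullet> w = 0) \<Longrightarrow> y \<in> Y \<Longrightarrow> \<eta> > 0 \<Longrightarrow> \<exists>x\<in>X. y \<bullet> e \<le> x \<bullet> e + \<eta>"
  shows "Y \<subseteq> X"
proof (rule subsetI, rule ccontr)
  fix y assume y: "y \<in> Y" "y \<notin> X"
  obtain a b where ab: "a \<bullet> y < b" "\<And>x. x \<in> X \<Longrightarrow> b < a \<bullet> x"
    using separating_hyperplane_closed_point[OF X(2,1) y(2)] by blast
  define d where "d = orth_proj W a"
  have dW: "d \<bullet> w = 0" if "w \<in> W" for w unfolding d_def by (rule orth_proj_inner[OF W that])
  have dX: "a \<bullet> x = d \<bullet> x" if "x \<in> X \<union> Y" for x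
    unfolding d_def using X(4) Y that by (intro orth_proj_inner_eq[symmetric]) blast
  obtain x0 where x0: "x0 \<in> X" using X(3) by blast
  have "d \<noteq> 0" using ab(1) ab(2)[OF x0] dX[of y] dX[of x0] y(1) x0 by auto
  \<comment> \<open>The separation puts \<open>y\<close> below \<open>X\<close> along
    \<open>a\<close>. The opposite direction turns this into a support inequality, and the slack
    \<open>(b - a \<bullet> y) / norm d\<close> is small enough to be contradictory.\<close>
  define e where "e = - (d /\<^sub>R norm d)"
  have "norm e = 1" "\<And>w. w \<in> W \<Longrightarrow> e \<bullet> w = 0" using \<open>d \<noteq> 0\<close> dW by (auto simp: e_def)
  moreover have "(b - a \<bullet> y) / norm d > 0" using ab(1) \<open>d \<noteq> 0\<close> by simp
  ultimately obtain x where x: "x \<in> X" "y \<bullet> e \<le> x \<bullet> e + (b - a \<bullet> y) / norm d" using sup y(1) by blast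
  then have "norm d * (y \<bullet> e) \<le> norm d * (x \<bullet> e + (b - a \<bullet> y) / norm d)" by (intro mult_left_mono) auto
  moreover have "norm d * (z \<bullet> e) = - (d \<bullet> z)" for z using \<open>d \<noteq> 0\<close> by (simp add: e_def inner_commute)
  ultimately have "- (d \<bullet> y) \<le> - (d \<bullet> x) + (b - a \<bullet> y)" using \<open>d \<noteq> 0\<close> by (simp add: distrib_left)
  then show False using ab(2)[OF x(1)] dX[of x] dX[of y] x(1) y(1) by simp
qed

text \<open>The two support relations give the two inclusions, since \<open>c\<close> and
  \<open>v\<close> are the same in all directions. Support functions determine a convex set only up
  to closure, hence the closures in the conclusion.\<close>

theorem vint_equality_homothetic:
  fixes W :: "'a::euclidean_space set"
  assumes W: "orthonormal W" and P: "vbody W P" and Q: "vbody W Q"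
    and fgh: "f \<in> borel_measurable borel" "g \<in> borel_measurable borel" "h \<in> borel_measurable borel"
      "\<And>x y. x \<in> P \<Longrightarrow> y \<in> Q \<Longrightarrow> f x + g y \<le> h (x + y)" "\<And>x. x \<in> P \<Longrightarrow> f x > 0"
      "vint W h = ennreal ((vrad W P + vrad W Q) ^ (DIM('a) - card W)) * (vavg W P f + vavg W Q g)"
      "vint W h < top"
  obtains v where "closure Q = (\<lambda>x. (vrad W Q / vrad W P) *\<^sub>R x + v) ` closure P"
proof -
  define c where "c = vrad W Q / vrad W P"
  define v where "v = vcentroid W Q - c *\<^sub>R vcentroid W P"
  have rel1: "\<exists>x\<in>P. y \<bullet> e \<le> (c *\<^sub>R x + v) \<bullet> e + \<eta>"
    if "norm e = 1" "\<And>w. w \<in> W \<Longrightarrow> e \<bullet> w = 0" "y \<in> Q" "\<eta> > 0" for e y and \<eta> :: real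
    unfolding v_def c_def by (rule support_relation(1)[OF W that(1) _ P Q fgh(1-3) _ _ fgh(6,7)]) (use that fgh(4,5) in auto)
  have rel2: "\<exists>y\<in>Q. (c *\<^sub>R x + v) \<bullet> e \<le> y \<bullet> e + \<eta>"
    if "norm e = 1" "\<And>w. w \<in> W \<Longrightarrow> e \<bullet> w = 0" "x \<in> P" "\<eta> > 0" for e x and \<eta> :: real
    unfolding v_def c_def by (rule support_relation(2)[OF W that(1) _ P Q fgh(1-3) _ _ fgh(6,7)]) (use that fgh(4,5) in auto)
  have PQ: "convex P" "convex Q" "bounded P" "bounded Q" "P \<noteq> {}" "Q \<noteq> {}"
    "\<And>x w. x \<in> P \<Longrightarrow> w \<in> W \<Longrightarrow> x \<bullet> w = 0" "\<And>x w. x \<in> Q \<Longrightarrow> w \<in> W \<Longrightarrow> x \<bullet> w = 0"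
    using P Q by (auto simp: vbody_def vvol_def vint_def)
  have clV: "x \<bullet> w = 0" if "x \<in> closure S" "w \<in> W" "\<And>x. x \<in> S \<Longrightarrow> x \<bullet> w = 0" for S x w
  proof -
    have "closure S \<subseteq> {x. x \<bullet> w = 0}"
    proof (rule closure_minimal)
      show "closed {x. x \<bullet> w = 0}" using closed_hyperplane[of w 0] by (simp add: inner_commute)
    qed (use that(3) in auto)
    then show ?thesis using that(1) by auto
  qed
  have ab: "c > 0" "\<And>w. w \<in> W \<Longrightarrow> v \<bullet> w = 0"
  proof -
    have vr: "vrad W X > 0" if "vbody W X" for X
      using that vvol_finite[OF W, of X] by (auto simp: vbody_def vrad_def enn2real_eq_0_iff)
    show "c > 0" using vr[OF P] vr[OF Q] by (simp add: c_def)
    \<comment> \<open>A non-integrable function has integral zero by convention, so the centroid is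
      orthogonal to \<open>W\<close> in both cases.\<close>
    have vc: "vcentroid W X \<bullet> w = 0" if "w \<in> W" for X w
    proof (cases "integrable lborel (\<lambda>x. indicat_real (unit_cyl W \<inter> orth_proj W -` X) x *\<^sub>R orth_proj W x)")
      case True
      then have "(\<integral>x. indicat_real (unit_cyl W \<inter> orth_proj W -` X) x *\<^sub>R orth_proj W x \<partial>lborel) \<bullet> w
          = (\<integral>x. (indicat_real (unit_cyl W \<inter> orth_proj W -` X) x *\<^sub>R orth_proj W x) \<bullet> w \<partial>lborel)"
        by (intro integral_inner_left[symmetric]) simp
      then show ?thesis by (simp add: vcentroid_def orth_proj_inner[OF W that])
    qed (simp add: vcentroid_def not_integrable_integral_eq)
    show "v \<bullet> w = 0" if "w \<in> W" for w using vc[OF that] by (simp add: v_def inner_diff_left)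
  qed
  define S where "S = (\<lambda>x. c *\<^sub>R x + v) ` closure P"
  have S: "compact S" "convex S"
  proof -
    show "compact S" unfolding S_def
      using PQ(3) by (intro compact_continuous_image continuous_intros) (simp add: compact_closure)
    show "convex S" unfolding S_def
      using convex_translation[of "(\<lambda>x. c *\<^sub>R x) ` closure P" v] convex_scaling[of "closure P" c] PQ(1)
      by (simp add: image_image add.commute convex_closure)
  qed
  have SV: "x \<bullet> w = 0" if "x \<in> S" "w \<in> W" for x w
    using that clV[OF _ that(2), of _ P] PQ(7) ab(2) by (auto simp: S_def inner_add_left)
  have 1: "Q \<subseteq> S"
  proof (rule subset_if_support_le[OF W compact_imp_closed[OF S(1)] S(2) _ SV PQ(8)])
    show "S \<noteq> {}" using PQ(5) by (simp add: S_def)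
    fix e y and \<eta> :: real assume e: "norm e = 1" "\<And>w. w \<in> W \<Longrightarrow> e \<bullet> w = 0" and y: "y \<in> Q" "\<eta> > 0"
    obtain x where x: "x \<in> P" "y \<bullet> e \<le> (c *\<^sub>R x + v) \<bullet> e + \<eta>" using rel1[of e y \<eta>] e y by blast
    then show "\<exists>x\<in>S. y \<bullet> e \<le> x \<bullet> e + \<eta>"
      using closure_subset[of P] by (intro bexI[of _ "c *\<^sub>R x + v"]) (auto simp: S_def)
  qed
  have 2: "(\<lambda>x. c *\<^sub>R x + v) ` P \<subseteq> closure Q"
  proof (rule subset_if_support_le[OF W closed_closure convex_closure[OF PQ(2)]])
    show "closure Q \<noteq> {}" using PQ(6) by simp
    show "x \<bullet> w = 0" if "x \<in> closure Q" "w \<in> W" for x w using clV[OF that] PQ(8) that(2) by blast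
    show "x \<bullet> w = 0" if "x \<in> (\<lambda>x. c *\<^sub>R x + v) ` P" "w \<in> W" for x w
      using that PQ(7) ab(2) by (auto simp: inner_add_left)
    fix e y and \<eta> :: real assume e: "norm e = 1" "\<And>w. w \<in> W \<Longrightarrow> e \<bullet> w = 0"
      and y: "y \<in> (\<lambda>x. c *\<^sub>R x + v) ` P" "\<eta> > 0"
    then obtain x where "x \<in> P" "y = c *\<^sub>R x + v" by blast
    then show "\<exists>x\<in>closure Q. y \<bullet> e \<le> x \<bullet> e + \<eta>"
      using rel2[of e x \<eta>] e y(2) closure_subset[of Q] by blast
  qed
  have "S \<subseteq> closure ((\<lambda>x. c *\<^sub>R x + v) ` P)"
    unfolding S_def by (rule continuous_image_closure_subset[of UNIV]) (simp_all add: continuous_on_add continuous_on_scaleR)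
  also have "\<dots> \<subseteq> closure Q" using 2 closure_mono[OF 2] by simp
  finally have "S \<subseteq> closure Q" .
  moreover have "closure Q \<subseteq> S" using 1 compact_imp_closed[OF S(1)] by (rule closure_minimal)
  ultimately show thesis using that[of v] by (auto simp: S_def c_def)
qed

subsection \<open>Fibres and shadows\<close>

lemma emeasure_eq_measure_lebesgue:
  assumes "X \<in> sets borel" "bounded X"
  shows "emeasure lborel X = ennreal (measure lebesgue X)"
  using assms emeasure_bounded_finite[OF assms(2)]
  by (simp add: measure_completion emeasure_eq_ennreal_measure less_top)

lemma vint_cong:
  assumes "orthonormal W" "\<And>x. (\<And>w. w \<in> W \<Longrightarrow> x \<bullet> w = 0) \<Longrightarrow> f x = g x"
  shows "vint W f = vint W g"
  unfolding vint_def using assms orth_proj_inner[OF assms(1)] by (intro nn_integral_cong) simp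

lemma orthonormal_singleton: "norm w = 1 \<Longrightarrow> orthonormal {w}"
  by (simp add: orthonormal_def)

lemma linear_orth_proj: "linear (orth_proj W)"
  by (intro linearI)
    (simp_all add: orth_proj_def inner_add_left scaleR_add_left sum.distrib scaleR_sum_right algebra_simps)

lemma vvol_pos_power:
  fixes W :: "'a::euclidean_space set"
  assumes W: "orthonormal W" and X: "vbody W X"
  shows "vrad W X > 0" "vvol W X = ennreal (vrad W X ^ (DIM('a) - card W))"
proof -
  obtain E where E: "W \<inter> E = {}" "orthonormal (W \<union> E)" "span (W \<union> E) = UNIV"
    using orthonormal_extend[OF W] by blast
  then have E': "orthonormal (E \<union> W)" "span (E \<union> W) = UNIV" "E \<inter> W = {}" by (auto simp: Un_commute)
  have fin: "finite E" "finite W" using orthonormal_finite[OF E'(1)] by auto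
  have c: "card E = DIM('a) - card W" by (rule card_orthonormal_complement[OF E'])
  note p = pbody_coordinates[OF E' X]
  show "vrad W X > 0" "vvol W X = ennreal (vrad W X ^ (DIM('a) - card W))"
    using prad_power[OF fin(1) p(1)] unfolding p(2) p(3) c by simp_all
qed

lemma vvol_affine:
  fixes W :: "'a::euclidean_space set"
  assumes W: "orthonormal W" and X: "X \<in> sets borel" and c: "c > 0" and v: "\<And>w. w \<in> W \<Longrightarrow> v \<bullet> w = 0"
  shows "vvol W ((\<lambda>x. c *\<^sub>R x + v) ` X) = ennreal (c ^ (DIM('a) - card W)) * vvol W X"
proof -
  obtain E where E: "W \<inter> E = {}" "orthonormal (W \<union> E)" "span (W \<union> E) = UNIV"
    using orthonormal_extend[OF W] by blast
  then have E': "orthonormal (E \<union> W)" "span (E \<union> W) = UNIV" "E \<inter> W = {}" by (auto simp: Un_commute)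
  have fin: "finite E" "finite W" using orthonormal_finite[OF E'(1)] by auto
  have card: "card E = DIM('a) - card W" by (rule card_orthonormal_complement[OF E'])
  let ?Y = "(\<lambda>x. c *\<^sub>R x + v) ` X"
  have Yvim: "?Y = (\<lambda>y. (1 / c) *\<^sub>R (y - v)) -` X"
  proof (intro set_eqI iffI)
    fix y assume "y \<in> (\<lambda>y. (1 / c) *\<^sub>R (y - v)) -` X"
    then show "y \<in> ?Y" using c by (intro image_eqI[of _ _ "(1 / c) *\<^sub>R (y - v)"]) auto
  qed (use c in auto)
  have Y[measurable]: "?Y \<in> sets borel"
    unfolding Yvim by (rule measurable_sets_borel[OF _ X]) measurable
  have eY: "c *\<^sub>R x + v \<in> ?Y \<longleftrightarrow> x \<in> X" for x using c by (auto simp: Yvim)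
  have "vvol W ?Y = (\<integral>\<^sup>+z. indicator ?Y (emb E z) \<partial>PL E)"
    unfolding vvol_def by (rule vint_emb[OF E']) measurable
  also have "\<dots> = ennreal (c ^ card E) * (\<integral>\<^sup>+z. indicator ?Y (emb E (\<lambda>i\<in>E. (v \<bullet> i) + c * z i)) \<partial>PL E)"
    by (rule nn_integral_PL_affine[OF fin(1) c]) measurable
  also have "(\<integral>\<^sup>+z. indicator ?Y (emb E (\<lambda>i\<in>E. (v \<bullet> i) + c * z i)) \<partial>PL E) = (\<integral>\<^sup>+z. indicator X (emb E z) \<partial>PL E)"
  proof (rule nn_integral_cong)
    fix z
    have "emb E (\<lambda>i\<in>E. (v \<bullet> i) + c * z i) = c *\<^sub>R emb E z + emb E (\<lambda>i\<in>E. v \<bullet> i)"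
      by (simp add: emb_def scaleR_add_left sum.distrib scaleR_sum_right add.commute)
    also have "emb E (\<lambda>i\<in>E. v \<bullet> i) = v" by (rule emb_expand[OF E'(1,2) v])
    finally have "emb E (\<lambda>i\<in>E. (v \<bullet> i) + c * z i) = c *\<^sub>R emb E z + v" .
    then show "indicator ?Y (emb E (\<lambda>i\<in>E. (v \<bullet> i) + c * z i)) = (indicator X (emb E z) :: ennreal)"
      by (simp only: indicator_def eY)
  qed
  also have "\<dots> = vvol W X"
    unfolding vvol_def by (rule vint_emb[OF E' borel_measurable_indicator[OF X], symmetric])
  finally show ?thesis by (simp add: card)
qed

lemma orthonormal_empty: "orthonormal {}"
  by (simp add: orthonormal_def pairwise_empty)

lemma vint_empty: "vint {} f = (\<integral>\<^sup>+x. f x \<partial>lborel)"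
  by (simp add: vint_def orth_proj_def unit_cyl_def)

lemma vvol_empty: "X \<in> sets borel \<Longrightarrow> vvol {} X = emeasure lborel X"
  by (simp add: vvol_def vint_empty)

section \<open>Convex bodies and equality in Brunn-Minkowski\<close>

lemma convex_body_simps:
  assumes "convex_body A"
  shows "compact A" "convex A" "bounded A" "A \<in> sets borel" "A \<noteq> {}" "interior A \<noteq> {}"
    "closure (interior A) = A" "measure lebesgue (interior A) = measure lebesgue A" "measure lebesgue A > 0"
proof -
  show A: "compact A" "convex A" and i: "interior A \<noteq> {}" using assms by (auto simp: convex_body_def)
  show b: "bounded A" "A \<in> sets borel" "A \<noteq> {}"
    using A i interior_subset by (auto simp: compact_imp_bounded compact_imp_closed)
  show "closure (interior A) = A"
    using convex_closure_interior[OF A(2) i] A(1) by (simp add: compact_imp_closed closure_closed)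
  show m: "measure lebesgue (interior A) = measure lebesgue A"
    using measure_interior[OF b(1) negligible_convex_frontier[OF A(2)]] .
  have "\<not> negligible (interior A)" using i open_not_negligible by blast
  then have "measure lebesgue (interior A) \<noteq> 0"
    using negligible_iff_measure[of "interior A"] lmeasurable_interior[OF b(1)] by blast
  then show "measure lebesgue A > 0" using m by (simp add: zero_less_measure_iff)
qed

lemma compact_set_plus:
  fixes X Y :: "'a::real_normed_vector set"
  assumes "compact X" "compact Y"
  shows "compact (X + Y)"
proof -
  have "X + Y = {x + y | x y. x \<in> X \<and> y \<in> Y}" by (auto simp: set_plus_def)
  then show ?thesis using compact_sums[OF assms] by simp
qed

text \<open>Here \<open>W = {}\<close> and \<open>h\<close> is the indicator of
  \<open>X + Y\<close>: the constants \<open>1/2\<close> are positive, as the equality theorem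
  demands, and add up to the value of \<open>h\<close> on the sum. The factor \<open>s\<close> is a
  common normalisation of the volumes; the actual radii are \<open>\<mu>\<close> and
  \<open>\<nu>\<close> times the same root of \<open>s\<close>, so it drops out of their
  ratio.\<close>

lemma brunn_minkowski_equality_homothetic:
  fixes X Y :: "'a::euclidean_space set"
  assumes X: "convex_body X" and Y: "convex_body Y" and s: "s > 0" "\<mu> > 0" "\<nu> > 0"
    and vX: "measure lebesgue X = s * \<mu> ^ DIM('a)" and vY: "measure lebesgue Y = s * \<nu> ^ DIM('a)"
    and vXY: "measure lebesgue (X + Y) = s * (\<mu> + \<nu>) ^ DIM('a)"
  obtains v where "Y = (\<lambda>x. (\<nu> / \<mu>) *\<^sub>R x + v) ` X"
proof -
  note bX = convex_body_simps[OF X] and bY = convex_body_simps[OF Y]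
  let ?n = "DIM('a)"
  have XY: "compact (X + Y)" using bX(1) bY(1) by (rule compact_set_plus)
  have XYb[measurable]: "X + Y \<in> sets borel" using XY by (simp add: compact_imp_closed)
  note [measurable] = bX(4) bY(4)
  have vv: "vvol {} Z = ennreal (measure lebesgue Z)" if "compact Z" for Z :: "'a set"
    using that by (simp add: vvol_empty compact_imp_closed emeasure_eq_measure_lebesgue compact_imp_bounded)
  have vr: "vrad {} Z = s powr (1 / ?n) * t" if "compact Z" "measure lebesgue Z = s * t ^ ?n" "t > 0" for Z :: "'a set" and t
  proof -
    have "(t ^ ?n) powr (1 / ?n) = t" using that(3) by (simp add: powr_realpow[symmetric] powr_powr)
    then show ?thesis using that(3) s(1) by (simp add: vrad_def vv[OF that(1)] that(2) powr_mult)
  qed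
  have vb: "vbody {} X" "vbody {} Y" using bX bY by (simp_all add: vbody_def vv)
  have vl: "vint {} (indicator (X + Y)) = ennreal (measure lebesgue (X + Y))"
    using vv[OF XY] by (simp add: vvol_def)
  have va: "vavg {} Z (\<lambda>_. ennreal (1/2)) = ennreal (1/2)" if "compact Z" "measure lebesgue Z > 0" for Z :: "'a set"
  proof -
    have m: "Z \<in> sets borel" using that by (simp add: compact_imp_closed)
    have "vint {} (\<lambda>x. ennreal (1/2) * indicator Z x) = ennreal (1/2) * vvol {} Z"
      unfolding vint_empty vvol_empty[OF m] using m by (intro nn_integral_cmult_indicator) simp
    then have "vavg {} Z (\<lambda>_. ennreal (1/2)) = ennreal (1/2) * vvol {} Z / vvol {} Z"
      by (simp only: vavg_def)
    also have "\<dots> = ennreal (1/2)" using that by (intro mult_divide_eq_ennreal) (simp_all add: vv)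
    finally show ?thesis .
  qed
  have half: "ennreal (1/2) + ennreal (1/2) = 1" by (subst ennreal_plus[symmetric]) simp_all
  obtain v where "closure Y = (\<lambda>x. (vrad {} Y / vrad {} X) *\<^sub>R x + v) ` closure X"
  proof (rule vint_equality_homothetic[OF orthonormal_empty vb, of "\<lambda>_. ennreal (1/2)" "\<lambda>_. ennreal (1/2)" "indicator (X + Y)"])
    show "ennreal (1/2) + ennreal (1/2) \<le> indicator (X + Y) (x + y)" if "x \<in> X" "y \<in> Y" for x y
      unfolding half using that by (simp add: set_plus_intro)
    have "(vrad {} X + vrad {} Y) ^ ?n = (s powr (1 / ?n)) ^ ?n * (\<mu> + \<nu>) ^ ?n"
      using vr[OF bX(1) vX s(2)] vr[OF bY(1) vY s(3)] by (simp add: distrib_left[symmetric] power_mult_distrib)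
    also have "(s powr (1 / ?n)) ^ ?n = s" using s(1) by (simp add: powr_realpow[symmetric] powr_powr)
    finally show "vint {} (indicator (X + Y)) = ennreal ((vrad {} X + vrad {} Y) ^ (?n - card {}))
        * (vavg {} X (\<lambda>_. ennreal (1/2)) + vavg {} Y (\<lambda>_. ennreal (1/2)))"
      unfolding va[OF bX(1,9)] va[OF bY(1,9)] half by (simp add: vl vXY)
    show "vint {} (indicator (X + Y)) < top" by (simp add: vl)
    show "ennreal (1/2) > 0" by (subst ennreal_less_zero_iff) simp
  qed auto
  moreover have "vrad {} Y / vrad {} X = \<nu> / \<mu>"
    using vr[OF bX(1) vX s(2)] vr[OF bY(1) vY s(3)] s(1) by simp
  ultimately show thesis
    using that bX(1) bY(1) by (simp add: compact_imp_closed closure_closed)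
qed

section \<open>Fibres in one direction\<close>

definition fibre :: "'a::euclidean_space \<Rightarrow> 'a set \<Rightarrow> 'a \<Rightarrow> real set" where
  "fibre w A x = {y. x + y *\<^sub>R w \<in> A}"

definition fibre_len :: "'a::euclidean_space \<Rightarrow> 'a set \<Rightarrow> 'a \<Rightarrow> ennreal" where
  "fibre_len w A x = emeasure lborel (fibre w A x)"

abbreviation shadow :: "'a::euclidean_space \<Rightarrow> 'a set \<Rightarrow> 'a set" where
  "shadow w A \<equiv> orth_proj {w} ` A"

lemma fibre_measurable:
  assumes "A \<in> sets borel"
  shows "fibre w A x \<in> sets borel"
proof -
  have "fibre w A x = (\<lambda>y. x + y *\<^sub>R w) -` A" by (auto simp: fibre_def)
  then show ?thesis using assms by (simp add: measurable_sets_borel[of _ borel])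
qed

lemma fibre_len_nn: "A \<in> sets borel \<Longrightarrow> fibre_len w A x = (\<integral>\<^sup>+y. indicator A (x + y *\<^sub>R w) \<partial>lborel)"
proof -
  assume A: "A \<in> sets borel"
  have "(\<integral>\<^sup>+y. indicator A (x + y *\<^sub>R w) \<partial>lborel) = (\<integral>\<^sup>+y. indicator (fibre w A x) y \<partial>lborel)"
    by (intro nn_integral_cong) (simp add: fibre_def indicator_def)
  then show ?thesis using fibre_measurable[OF A, of w x] by (simp add: fibre_len_def)
qed

lemma fibre_len_measurable:
  assumes [measurable]: "A \<in> sets borel"
  shows "fibre_len w A \<in> borel_measurable borel"
proof -
  have "(\<lambda>x. \<integral>\<^sup>+y. indicator A (x + y *\<^sub>R w) \<partial>lborel) \<in> borel_measurable borel" by measurable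
  then show ?thesis unfolding fibre_len_nn[OF assms, abs_def] .
qed

text \<open>Fubini in an orthonormal basis containing \<open>w\<close>: the inner integral over that
  coordinate is the fibre length.\<close>

lemma vint_fibre_len:
  assumes w: "norm w = 1" and A: "A \<in> sets borel"
  shows "vint {w} (fibre_len w A) = emeasure lborel A"
proof -
  interpret product_sigma_finite "\<lambda>_. lborel :: real measure" by (rule product_sigma_finite_lborel)
  obtain D where D: "{w} \<inter> D = {}" "orthonormal ({w} \<union> D)" "span ({w} \<union> D) = UNIV"
    using orthonormal_extend[OF orthonormal_singleton[OF w]] by blast
  have E: "orthonormal (D \<union> {w})" "span (D \<union> {w}) = UNIV" "D \<inter> {w} = {}" using D by (auto simp: Un_commute)
  have fin: "finite D" "w \<notin> D" using orthonormal_finite[OF E(1)] E(3) by auto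
  note [measurable] = A
  have em: "emb (insert w D) (x(w := y)) = emb D x + y *\<^sub>R w" for x y
    using fin unfolding emb_def by (subst sum.insert) (auto intro!: sum.cong simp: add.commute)
  have "emeasure lborel A = (\<integral>\<^sup>+x. indicator A x \<partial>lborel)" by simp
  also have "\<dots> = (\<integral>\<^sup>+z. indicator A (emb (insert w D) z) \<partial>PL (insert w D))"
    using nn_integral_emb[of "insert w D" "indicator A"] D by simp
  also have "\<dots> = (\<integral>\<^sup>+x. (\<integral>\<^sup>+y. indicator A (emb (insert w D) (x(w := y))) \<partial>lborel) \<partial>PL D)"
    by (rule product_nn_integral_insert[OF fin]) measurable
  also have "\<dots> = (\<integral>\<^sup>+x. fibre_len w A (emb D x) \<partial>PL D)"
    unfolding em fibre_len_nn[OF A] ..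
  also have "\<dots> = vint {w} (fibre_len w A)"
    by (rule vint_emb[OF E fibre_len_measurable[OF A], symmetric])
  finally show ?thesis ..
qed

lemma convex_fibre: "convex A \<Longrightarrow> convex (fibre w A x)"
proof (rule convexI)
  fix y z s t :: real assume A: "convex A" and *: "y \<in> fibre w A x" "z \<in> fibre w A x" "0 \<le> s" "0 \<le> t" "s + t = 1"
  then have "s *\<^sub>R (x + y *\<^sub>R w) + t *\<^sub>R (x + z *\<^sub>R w) \<in> A"
    by (intro convexD[OF A]) (auto simp: fibre_def)
  also have "s *\<^sub>R (x + y *\<^sub>R w) + t *\<^sub>R (x + z *\<^sub>R w) = (s + t) *\<^sub>R x + (s * y + t * z) *\<^sub>R w"
    by (simp add: algebra_simps)
  finally show "s *\<^sub>R y + t *\<^sub>R z \<in> fibre w A x" using *(5) by (simp add: fibre_def)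
qed

lemma bounded_fibre:
  assumes "norm w = 1" "bounded A"
  shows "bounded (fibre w A x)"
proof -
  obtain R where R: "\<forall>a\<in>A. norm a \<le> R" using assms(2) unfolding bounded_iff ..
  have "norm y \<le> R + norm x" if "y \<in> fibre w A x" for y
  proof -
    have "norm (y *\<^sub>R w) \<le> norm (x + y *\<^sub>R w) + norm x" by (metis add_diff_cancel_left' norm_triangle_ineq4)
    moreover have "norm (x + y *\<^sub>R w) \<le> R" using R that by (simp add: fibre_def)
    ultimately show ?thesis using assms(1) by simp
  qed
  then show ?thesis unfolding bounded_iff by blast
qed

text \<open>A point strictly between \<open>Inf F + Inf G\<close> and \<open>Sup F + Sup G\<close>
  is trapped between two sums of points of \<open>F\<close> and \<open>G\<close>, and
  \<open>H\<close> is an interval, so \<open>H\<close> contains it. The superset \<open>H\<close>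
  stands for the fibre of \<open>A + B\<close> over \<open>x + y\<close>, which may be larger than
  the sum of the fibres over \<open>x\<close> and \<open>y\<close>.\<close>

lemma emeasure_sum_le_real:
  fixes F G H :: "real set"
  assumes F: "bounded F" "F \<noteq> {}" "F \<in> sets borel" and G: "bounded G" "G \<noteq> {}" "G \<in> sets borel"
    and H: "convex H" "H \<in> sets borel" and FGH: "\<And>f g. f \<in> F \<Longrightarrow> g \<in> G \<Longrightarrow> f + g \<in> H"
  shows "emeasure lborel F + emeasure lborel G \<le> emeasure lborel H"
proof -
  have bd: "bdd_below F" "bdd_above F" "bdd_below G" "bdd_above G"
    using F(1) G(1) by (auto simp: bounded_imp_bdd_below bounded_imp_bdd_above)
  have le: "Inf X \<le> Sup X" "emeasure lborel X \<le> ennreal (Sup X - Inf X)"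
    if "X \<noteq> {}" "bdd_below X" "bdd_above X" for X :: "real set"
  proof -
    show le: "Inf X \<le> Sup X" using that by (intro cInf_le_cSup)
    have "X \<subseteq> {Inf X..Sup X}" using that by (auto intro: cInf_lower cSup_upper)
    then have "emeasure lborel X \<le> emeasure lborel {Inf X..Sup X}" by (intro emeasure_mono) auto
    then show "emeasure lborel X \<le> ennreal (Sup X - Inf X)" using le by simp
  qed
  have sub: "{Inf F + Inf G<..<Sup F + Sup G} \<subseteq> H"
  proof
    fix z assume z: "z \<in> {Inf F + Inf G<..<Sup F + Sup G}"
    have "Inf F < Inf F + (z - Inf F - Inf G) / 2" "Inf G < Inf G + (z - Inf F - Inf G) / 2" using z by auto
    then obtain f g where fg: "f \<in> F" "f < Inf F + (z - Inf F - Inf G) / 2" "g \<in> G" "g < Inf G + (z - Inf F - Inf G) / 2"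
      using cInf_less_iff[OF F(2) bd(1)] cInf_less_iff[OF G(2) bd(3)] by blast
    have "Sup F - (Sup F + Sup G - z) / 2 < Sup F" "Sup G - (Sup F + Sup G - z) / 2 < Sup G" using z by auto
    then obtain f' g' where fg': "f' \<in> F" "Sup F - (Sup F + Sup G - z) / 2 < f'" "g' \<in> G" "Sup G - (Sup F + Sup G - z) / 2 < g'"
      using less_cSup_iff[OF F(2) bd(2)] less_cSup_iff[OF G(2) bd(4)] by blast
    have "f + g \<le> z" "z \<le> f' + g'" using fg fg' by (auto simp: field_simps)
    moreover have "is_interval H" using H(1) by (simp add: is_interval_convex_1)
    ultimately show "z \<in> H" using FGH[OF fg(1,3)] FGH[OF fg'(1,3)] mem_is_interval_1_I by blast
  qed
  have "emeasure lborel F + emeasure lborel G \<le> ennreal (Sup F - Inf F) + ennreal (Sup G - Inf G)"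
    using le(2)[OF F(2) bd(1,2)] le(2)[OF G(2) bd(3,4)] by (rule add_mono)
  also have "\<dots> = ennreal (Sup F + Sup G - (Inf F + Inf G))"
    using le(1)[OF F(2) bd(1,2)] le(1)[OF G(2) bd(3,4)] by (simp add: ennreal_plus[symmetric] algebra_simps del: ennreal_plus)
  also have "\<dots> = emeasure lborel {Inf F + Inf G<..<Sup F + Sup G}"
    using le(1)[OF F(2) bd(1,2)] le(1)[OF G(2) bd(3,4)] by simp
  also have "\<dots> \<le> emeasure lborel H" using sub H(2) by (intro emeasure_mono) auto
  finally show ?thesis .
qed

text \<open>A fibre of \<open>A\<close> over the boundary of the shadow can be a point, whereas
  every nonempty fibre of the interior is open and so has positive length. The interior is dense in
  \<open>A\<close>, which recovers the whole shadow by closure, and the shadow volume is unchanged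
  because the frontier of a convex set is negligible.\<close>

lemma open_shadow:
  fixes w :: "'a::euclidean_space"
  assumes w: "norm w = 1" and A: "convex_body A"
  defines "P \<equiv> shadow w (interior A)"
  shows "vbody {w} P" "closure P = shadow w A" "vvol {w} P = vvol {w} (shadow w A)"
    "\<And>x. x \<in> P \<Longrightarrow> fibre w (interior A) x \<noteq> {}"
    "\<And>x. x \<in> P \<Longrightarrow> fibre_len w (interior A) x > 0"
    "vint {w} (\<lambda>x. fibre_len w (interior A) x * indicator P x) = ennreal (measure lebesgue A)"
proof -
  note bA = convex_body_simps[OF A]
  have W: "orthonormal {w}" using w by (rule orthonormal_singleton)
  have ww: "w \<bullet> w = 1" using w by (simp add: norm_eq_1)
  let ?f = "fibre_len w (interior A)"
  have PV: "x \<bullet> w = 0" if "x \<in> P" for x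
    using that orth_proj_inner[OF W, of w] by (auto simp: P_def)
  have Pmem: "x \<in> P \<longleftrightarrow> x \<bullet> w = 0 \<and> (\<exists>y. x + y *\<^sub>R w \<in> interior A)" for x
  proof
    assume "x \<in> P"
    then obtain a where "a \<in> interior A" "x = orth_proj {w} a" by (auto simp: P_def)
    then show "x \<bullet> w = 0 \<and> (\<exists>y. x + y *\<^sub>R w \<in> interior A)"
      using PV[OF \<open>x \<in> P\<close>] by (auto intro!: exI[of _ "a \<bullet> w"] simp: orth_proj_def)
  next
    assume "x \<bullet> w = 0 \<and> (\<exists>y. x + y *\<^sub>R w \<in> interior A)"
    then obtain y where "x \<bullet> w = 0" "x + y *\<^sub>R w \<in> interior A" by blast
    moreover from this have "orth_proj {w} (x + y *\<^sub>R w) = x" by (simp add: orth_proj_def inner_add_left ww)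
    ultimately show "x \<in> P" unfolding P_def by (metis imageI)
  qed
  have "open (\<Union>y. (\<lambda>x. x + y *\<^sub>R w) -` interior A)"
    by (intro open_UN ballI open_vimage open_interior continuous_intros)
  moreover have "P = {x. x \<bullet> w = 0} \<inter> (\<Union>y. (\<lambda>x. x + y *\<^sub>R w) -` interior A)" using Pmem by auto
  moreover have "closed {x. x \<bullet> w = 0}" using closed_hyperplane[of w 0] by (simp add: inner_commute)
  ultimately have Pb: "P \<in> sets borel" by (metis borel_closed borel_open sets.Int)
  have Pc: "convex P" unfolding P_def
    using linear_orth_proj convex_interior[OF bA(2)] by (rule convex_linear_image)
  have ShA: "compact (shadow w A)"
    using bA(1) linear_orth_proj by (intro compact_continuous_image linear_continuous_on) (simp_all add: linear_conv_bounded_linear)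
  have PSh: "P \<subseteq> shadow w A" unfolding P_def using interior_subset by blast
  have Pbd: "bounded P" using compact_imp_bounded[OF ShA] PSh by (rule bounded_subset)
  show clP: "closure P = shadow w A"
  proof
    show "closure P \<subseteq> shadow w A" using PSh compact_imp_closed[OF ShA] by (rule closure_minimal)
    have "shadow w (closure (interior A)) \<subseteq> closure P" unfolding P_def
      using linear_orth_proj by (intro continuous_image_closure_subset[of UNIV] linear_continuous_on) (simp_all add: linear_conv_bounded_linear)
    then show "shadow w A \<subseteq> closure P" by (simp add: bA(7))
  qed
  show ne: "fibre w (interior A) x \<noteq> {}" if "x \<in> P" for x
    using that unfolding Pmem fibre_def by blast
  show f0: "?f x > 0" if "x \<in> P" for x
  proof -
    have "fibre w (interior A) x = (\<lambda>y. x + y *\<^sub>R w) -` interior A" by (auto simp: fibre_def)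
    then have o: "open (fibre w (interior A) x)"
      by (simp add: open_vimage continuous_intros)
    then have "\<not> negligible (fibre w (interior A) x)" using open_not_negligible ne[OF that] by blast
    then show ?thesis using o
      by (simp add: fibre_len_def negligible_iff_null_sets null_sets_def emeasure_completion borel_open zero_less_iff_neq_zero)
  qed
  have z: "?f x * indicator P x = ?f x" if "x \<bullet> w = 0" for x
  proof (cases "x \<in> P")
    case False
    then have "fibre w (interior A) x = {}" using that unfolding Pmem fibre_def by blast
    then show ?thesis using False by (simp add: fibre_len_def)
  qed simp
  have "vint {w} (\<lambda>x. ?f x * indicator P x) = vint {w} ?f"
    by (rule vint_cong[OF W]) (simp add: z)
  also have "\<dots> = ennreal (measure lebesgue A)"
    using vint_fibre_len[OF w, of "interior A"] emeasure_eq_measure_lebesgue[of "interior A"] bA(8) bounded_subset[OF bA(3) interior_subset]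
    by simp
  finally show vf: "vint {w} (\<lambda>x. ?f x * indicator P x) = ennreal (measure lebesgue A)" .
  define C where "C = unit_cyl {w} \<inter> orth_proj {w} -` P"
  define C' where "C' = unit_cyl {w} \<inter> orth_proj {w} -` shadow w A"
  have Cb: "C \<in> sets borel" "vvol {w} P = emeasure lborel C" unfolding C_def using vvol_eq[OF W Pb] by auto
  have C'b: "C' \<in> sets borel" "vvol {w} (shadow w A) = emeasure lborel C'"
    unfolding C'_def using vvol_eq[OF W, of "shadow w A"] ShA by (auto simp: compact_imp_closed)
  \<comment> \<open>If the shadow were null, integrating fibre lengths over it would give
    \<open>A\<close> volume zero.\<close>
  have "vvol {w} P \<noteq> 0"
  proof
    assume "vvol {w} P = 0"
    then have "C \<in> null_sets lborel" using Cb by (simp add: null_sets_def)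
    then have "(\<integral>\<^sup>+x\<in>C. ?f (orth_proj {w} x) \<partial>lborel) = 0" by (rule nn_integral_null_set)
    also have "(\<integral>\<^sup>+x\<in>C. ?f (orth_proj {w} x) \<partial>lborel) = vint {w} (\<lambda>x. ?f x * indicator P x)"
      unfolding vint_def by (intro nn_integral_cong) (auto simp: C_def indicator_def)
    finally show False using vf bA(9) by simp
  qed
  then show "vbody {w} P" using Pb Pc Pbd PV by (simp add: vbody_def zero_less_iff_neq_zero)
  have Cc: "convex C"
  proof -
    have "convex (unit_cyl {w})"
      unfolding unit_cyl_def convex_def by (auto simp: inner_add_left convex_bound_le)
    moreover have "convex (orth_proj {w} -` P)" using linear_orth_proj Pc by (rule convex_linear_vimage)
    ultimately show ?thesis unfolding C_def by (rule convex_Int)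
  qed
  have "bounded C'"
  proof -
    obtain R where R: "\<forall>x\<in>shadow w A. norm x \<le> R" using compact_imp_bounded[OF ShA] unfolding bounded_iff ..
    have "norm x \<le> R + 1" if "x \<in> C'" for x using norm_le_cyl[OF W, of x] R that by (force simp: C'_def)
    then show ?thesis unfolding bounded_iff by blast
  qed
  moreover have CC': "C \<subseteq> C'" using PSh by (auto simp: C_def C'_def)
  ultimately have Cbd: "bounded C" "bounded C'" using bounded_subset by blast+
  \<comment> \<open>The copy of \<open>P\<close> shifted to the height \<open>x \<bullet> w\<close>
    along \<open>w\<close> lies in \<open>C\<close>, and its closure contains
    \<open>x\<close>.\<close>
  have "C' \<subseteq> closure C"
  proof
    fix x assume x: "x \<in> C'"
    have "(\<lambda>p. p + (x \<bullet> w) *\<^sub>R w) ` closure P \<subseteq> closure ((\<lambda>p. p + (x \<bullet> w) *\<^sub>R w) ` P)"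
      by (rule continuous_image_closure_subset[of UNIV]) (simp_all add: continuous_on_add)
    moreover have "(\<lambda>p. p + (x \<bullet> w) *\<^sub>R w) ` P \<subseteq> C"
      using x PV by (auto simp: C_def C'_def unit_cyl_def orth_proj_def inner_add_left ww)
    ultimately have "(\<lambda>p. p + (x \<bullet> w) *\<^sub>R w) ` closure P \<subseteq> closure C" using closure_mono by blast
    moreover have "orth_proj {w} x \<in> closure P" using x clP by (simp add: C'_def)
    ultimately have "orth_proj {w} x + (x \<bullet> w) *\<^sub>R w \<in> closure C" by blast
    then show "x \<in> closure C" by (simp add: orth_proj_def)
  qed
  then have "measure lebesgue C' \<le> measure lebesgue (closure C)"
    using C'b(1) Cbd by (intro measure_mono_fmeasurable) (auto intro!: lmeasurable_compact simp: compact_closure)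
  also have "\<dots> = measure lebesgue C" by (rule measure_closure[OF Cbd(1) negligible_convex_frontier[OF Cc]])
  finally have "emeasure lborel C' \<le> emeasure lborel C"
    using emeasure_eq_measure_lebesgue[OF Cb(1) Cbd(1)] emeasure_eq_measure_lebesgue[OF C'b(1) Cbd(2)] by (simp add: ennreal_leI)
  then show "vvol {w} P = vvol {w} (shadow w A)"
    unfolding Cb(2) C'b(2) using emeasure_mono[OF CC', of lborel] C'b(1) by (intro antisym) auto
qed

subsection \<open>Stretching\<close>

abbreviation segment :: "'a::real_vector \<Rightarrow> real \<Rightarrow> 'a set" where
  "segment w h \<equiv> (\<lambda>t. t *\<^sub>R w) ` {0..h}"

lemma segment_props:
  fixes w :: "'a::real_normed_vector"
  assumes "h \<ge> 0"
  shows "compact (segment w h)" "convex (segment w h)" "segment w h \<noteq> {}"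
proof -
  show "compact (segment w h)" by (intro compact_continuous_image continuous_intros) simp
  show "convex (segment w h)" by (intro convex_linear_image) (auto intro!: linearI simp: scaleR_add_left)
  show "segment w h \<noteq> {}" using assms by auto
qed

lemma segment_plus:
  assumes "h \<ge> 0" "k \<ge> 0"
  shows "segment w h + segment w k = segment w (h + k)"
proof (intro equalityI subsetI)
  fix x assume "x \<in> segment w h + segment w k"
  then show "x \<in> segment w (h + k)"
    by (auto simp: set_plus_def scaleR_add_left[symmetric] intro!: imageI)
next
  fix x assume "x \<in> segment w (h + k)"
  then obtain t where t: "0 \<le> t" "t \<le> h + k" "x = t *\<^sub>R w" by auto
  have "x = min t h *\<^sub>R w + (t - min t h) *\<^sub>R w" using t by (simp add: scaleR_add_left[symmetric])
  moreover have "min t h *\<^sub>R w \<in> segment w h" "(t - min t h) *\<^sub>R w \<in> segment w k"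
    using t assms by (intro imageI; simp add: min_def)+
  ultimately show "x \<in> segment w h + segment w k" by (metis set_plus_intro)
qed

lemma convex_body_plus:
  fixes A B :: "'a::euclidean_space set"
  assumes A: "convex_body A" and B: "compact B" "convex B" "B \<noteq> {}"
  shows "convex_body (A + B)"
proof -
  obtain b where b: "b \<in> B" using B(3) by blast
  have "(+) b ` interior A \<subseteq> A + B"
    using b interior_subset[of A] by (auto simp: set_plus_def add.commute)
  then have "(+) b ` interior A \<subseteq> interior (A + B)" by (intro interior_maximal open_translation open_interior)
  then show ?thesis
    using A B by (auto simp: convex_body_def compact_set_plus convex_set_plus)
qed

lemma convex_body_affine:
  fixes A :: "'a::euclidean_space set"
  assumes A: "convex_body A" and c: "c > 0"
  shows "convex_body ((\<lambda>x. c *\<^sub>R x + v) ` A)"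
    and "measure lebesgue ((\<lambda>x. c *\<^sub>R x + v) ` A) = c ^ DIM('a) * measure lebesgue A"
proof -
  let ?f = "\<lambda>x. c *\<^sub>R x + v"
  note bA = convex_body_simps[OF A]
  have im: "?f ` A = (+) v ` (\<lambda>x. c *\<^sub>R x) ` A" by (auto simp: image_image add.commute)
  have co: "compact (?f ` A)" using bA(1) by (intro compact_continuous_image continuous_intros)
  have "convex (?f ` A)" unfolding im using bA(2) by (intro convex_translation convex_scaling)
  moreover have "interior (?f ` A) = (+) v ` (\<lambda>x. c *\<^sub>R x) ` interior A"
    unfolding im interior_translation using c by (subst interior_injective_linear_image) (auto intro: injI)
  ultimately show "convex_body (?f ` A)" using co bA(6) by (simp add: convex_body_def)
  have e: "emeasure lborel Z = ennreal (measure lebesgue Z)" "Z \<in> sets borel" if "compact Z" for Z :: "'a set"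
    using emeasure_eq_measure_lebesgue[OF _ compact_imp_bounded[OF that]] compact_imp_closed[OF that] by auto
  have "vvol {} (?f ` A) = ennreal (c ^ (DIM('a) - card ({} :: 'a set))) * vvol {} A"
    using bA(4) c by (intro vvol_affine orthonormal_empty) auto
  then have "ennreal (measure lebesgue (?f ` A)) = ennreal (c ^ DIM('a) * measure lebesgue A)"
    using e[OF co] e[OF bA(1)] c by (simp add: vvol_empty ennreal_mult')
  then show "measure lebesgue (?f ` A) = c ^ DIM('a) * measure lebesgue A" using c by simp
qed

text \<open>Convexity enters in the first inclusion: \<open>x + c *\<^sub>R y\<close> is
  \<open>1 + c\<close> times the convex combination of \<open>x\<close> and \<open>y\<close> with
  weights \<open>1 / (1 + c)\<close> and \<open>c / (1 + c)\<close>.\<close>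

lemma convex_plus_homothet:
  fixes S :: "'a::real_vector set"
  assumes S: "convex S" and c: "c > 0"
  shows "S + (\<lambda>x. c *\<^sub>R x + v) ` S = (\<lambda>x. (1 + c) *\<^sub>R x + v) ` S"
proof (intro equalityI subsetI)
  fix z assume "z \<in> S + (\<lambda>x. c *\<^sub>R x + v) ` S"
  then obtain x y where xy: "x \<in> S" "y \<in> S" "z = x + (c *\<^sub>R y + v)" by (auto simp: set_plus_def)
  define l where "l = c / (1 + c)"
  have l: "0 \<le> l" "l \<le> 1" "(1 + c) * l = c" using c by (simp_all add: l_def)
  then have l4: "(1 + c) * (1 - l) = 1" by (simp add: right_diff_distrib)
  have "(1 - l) *\<^sub>R x + l *\<^sub>R y \<in> S" using convexD_alt[OF S xy(1,2) l(1,2)] .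
  moreover have "z = (1 + c) *\<^sub>R ((1 - l) *\<^sub>R x + l *\<^sub>R y) + v"
    using l(3) l4 xy(3) by (simp only: scaleR_add_right scaleR_scaleR) simp
  ultimately show "z \<in> (\<lambda>x. (1 + c) *\<^sub>R x + v) ` S" by blast
next
  fix z assume "z \<in> (\<lambda>x. (1 + c) *\<^sub>R x + v) ` S"
  then obtain x where "x \<in> S" "z = x + (c *\<^sub>R x + v)" by (auto simp: algebra_simps)
  then show "z \<in> S + (\<lambda>x. c *\<^sub>R x + v) ` S" by (auto intro!: set_plus_intro)
qed

lemma shadow_plus: "shadow w (A + B) = shadow w A + shadow w B"
proof (intro equalityI subsetI)
  fix z assume "z \<in> shadow w (A + B)"
  then obtain a b where "a \<in> A" "b \<in> B" "z = orth_proj {w} (a + b)" by (auto simp: set_plus_def)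
  then show "z \<in> shadow w A + shadow w B" unfolding linear_add[OF linear_orth_proj] by (simp add: set_plus_intro)
next
  fix z assume "z \<in> shadow w A + shadow w B"
  then obtain a b where "a \<in> A" "b \<in> B" "z = orth_proj {w} a + orth_proj {w} b" by (auto simp: set_plus_def)
  then show "z \<in> shadow w (A + B)"
    unfolding linear_add[OF linear_orth_proj, symmetric] by (simp add: set_plus_intro)
qed

lemma orth_proj_scaleR_self: "norm w = 1 \<Longrightarrow> orth_proj {w} (t *\<^sub>R w) = 0"
  by (simp add: orth_proj_def norm_eq_1)

lemma shadow_segment: "norm w = 1 \<Longrightarrow> h \<ge> 0 \<Longrightarrow> shadow w (A + segment w h) = shadow w A"
proof -
  assume *: "norm w = 1" "h \<ge> 0"
  have "shadow w (segment w h) = (\<lambda>_. 0) ` {0..h}"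
    unfolding image_image using orth_proj_scaleR_self[OF *(1)] by (intro image_cong) auto
  also have "\<dots> = {0}" using *(2) by (simp add: image_constant_conv)
  finally show ?thesis unfolding shadow_plus by (auto simp: set_plus_def)
qed

lemma shadow_affine: "shadow w ((\<lambda>x. c *\<^sub>R x + v) ` A) = (\<lambda>x. c *\<^sub>R x + orth_proj {w} v) ` shadow w A"
  using linear_orth_proj[of "{w}"] by (simp add: image_image linear_add linear_scale)

lemma shadow_orth: "norm w = 1 \<Longrightarrow> x \<in> shadow w A \<Longrightarrow> x \<bullet> w = 0"
  using orth_proj_inner[OF orthonormal_singleton, of w w] by auto

lemma shadow_compact_convex:
  assumes "convex_body A"
  shows "compact (shadow w A)" "convex (shadow w A)"
proof -
  note bA = convex_body_simps[OF assms]
  show "compact (shadow w A)"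
    using bA(1) linear_orth_proj by (intro compact_continuous_image linear_continuous_on) (simp_all add: linear_conv_bounded_linear)
  show "convex (shadow w A)" using linear_orth_proj bA(2) by (rule convex_linear_image)
qed

text \<open>For a convex body in dimension one the shadow is a point and \<open>shrad\<close> is
  \<open>1\<close>, so the formulas with exponent \<open>DIM('a) - 1\<close> turn into the plain sum
  of the two volumes.\<close>

abbreviation shrad :: "'a::euclidean_space \<Rightarrow> 'a set \<Rightarrow> real" where
  "shrad w A \<equiv> vrad {w} (shadow w A)"

lemma shadow_volume:
  fixes w :: "'a::euclidean_space"
  assumes w: "norm w = 1" and A: "convex_body A"
  shows "shrad w A > 0" "vvol {w} (shadow w A) = ennreal (shrad w A ^ (DIM('a) - 1))"
proof -
  have "vbody {w} (shadow w A)"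
    using open_shadow(1,3)[OF w A] shadow_compact_convex[OF A, of w] shadow_orth[OF w, of _ A]
    by (simp add: vbody_def compact_imp_closed compact_imp_bounded)
  from vvol_pos_power[OF orthonormal_singleton[OF w] this]
  show "shrad w A > 0" "vvol {w} (shadow w A) = ennreal (shrad w A ^ (DIM('a) - 1))" by simp_all
qed

text \<open>A fibre over the shadow is a compact interval \<open>{p..q}\<close> and becomes
  \<open>{p..q + h}\<close>, while fibres off the shadow stay empty. Integrating the lengths adds
  \<open>h\<close> times the volume of the shadow.\<close>

lemma measure_plus_segment:
  fixes w :: "'a::euclidean_space"
  assumes w: "norm w = 1" and A: "convex_body A" and h: "h \<ge> 0"
  shows "measure lebesgue (A + segment w h) = measure lebesgue A + h * shrad w A ^ (DIM('a) - 1)"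
proof -
  have W: "orthonormal {w}" using w by (rule orthonormal_singleton)
  have ww: "w \<bullet> w = 1" using w by (simp add: norm_eq_1)
  note bA = convex_body_simps[OF A]
  let ?S = "A + segment w h"
  have S: "convex_body ?S" using A segment_props[OF h] by (rule convex_body_plus)
  note bS = convex_body_simps[OF S]
  have Sh: "shadow w A \<in> sets borel" using shadow_compact_convex(1)[OF A] by (simp add: compact_imp_closed)
  have fl: "fibre_len w ?S x = fibre_len w A x + ennreal h * indicator (shadow w A) x" if x: "x \<bullet> w = 0" for x
  proof -
    have fS: "y \<in> fibre w ?S x \<longleftrightarrow> (\<exists>t\<in>{0..h}. y - t \<in> fibre w A x)" for y
    proof
      assume "y \<in> fibre w ?S x"
      then obtain a t where "a \<in> A" "t \<in> {0..h}" "x + y *\<^sub>R w = a + t *\<^sub>R w"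
        by (auto simp: fibre_def set_plus_def)
      moreover from this(3) have "x + (y - t) *\<^sub>R w = a" by (simp add: algebra_simps)
      ultimately show "\<exists>t\<in>{0..h}. y - t \<in> fibre w A x" by (auto simp: fibre_def)
    next
      assume "\<exists>t\<in>{0..h}. y - t \<in> fibre w A x"
      then obtain t where t: "t \<in> {0..h}" "x + (y - t) *\<^sub>R w \<in> A" by (auto simp: fibre_def)
      have "(x + (y - t) *\<^sub>R w) + t *\<^sub>R w \<in> ?S" using t by (intro set_plus_intro imageI)
      then show "y \<in> fibre w ?S x" by (simp add: fibre_def algebra_simps)
    qed
    have sh: "x \<in> shadow w A \<longleftrightarrow> fibre w A x \<noteq> {}"
    proof
      assume "x \<in> shadow w A"
      then obtain a where a: "a \<in> A" "x = orth_proj {w} a" by blast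
      then have "a \<bullet> w \<in> fibre w A x" by (simp add: fibre_def orth_proj_def)
      then show "fibre w A x \<noteq> {}" by blast
    next
      assume "fibre w A x \<noteq> {}"
      then obtain y where "x + y *\<^sub>R w \<in> A" by (auto simp: fibre_def)
      moreover have "orth_proj {w} (x + y *\<^sub>R w) = x" using x by (simp add: orth_proj_def inner_add_left ww)
      ultimately show "x \<in> shadow w A" by (metis imageI)
    qed
    have "fibre w A x = (\<lambda>y. x + y *\<^sub>R w) -` A" by (auto simp: fibre_def)
    then have "closed (fibre w A x)"
      using compact_imp_closed[OF bA(1)] by (simp add: continuous_closed_vimage continuous_intros)
    then have "compact (fibre w A x)" using bounded_fibre[OF w bA(3)] by (simp add: compact_eq_bounded_closed)
    moreover have "connected (fibre w A x)" using convex_fibre[OF bA(2)] by (rule convex_connected)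
    ultimately obtain p q where pq: "fibre w A x = {p..q}" using connected_compact_interval_1 by blast
    show ?thesis
    proof (cases "p \<le> q")
      case True
      have "fibre w ?S x = {p..q + h}"
      proof (intro equalityI subsetI)
        fix y assume "y \<in> {p..q + h}"
        \<comment> \<open>The witness is the shift \<open>0\<close> as long as
          \<open>y \<le> q\<close>, and the excess \<open>y - q\<close> afterwards.\<close>
        then show "y \<in> fibre w ?S x" unfolding fS pq using h True
          by (intro bexI[of _ "max 0 (y - q)"]) (auto simp: max_def)
      qed (auto simp: fS pq)
      then show ?thesis using True h sh pq by (simp add: fibre_len_def ennreal_plus[symmetric] del: ennreal_plus)
    next
      case False
      then have "fibre w A x = {}" "fibre w ?S x = {}" using pq fS by auto
      then show ?thesis using sh by (simp add: fibre_len_def)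
    qed
  qed
  have "ennreal (measure lebesgue ?S) = vint {w} (fibre_len w ?S)"
    using vint_fibre_len[OF w bS(4)] emeasure_eq_measure_lebesgue[OF bS(4,3)] by simp
  also have "\<dots> = vint {w} (\<lambda>x. fibre_len w A x + ennreal h * indicator (shadow w A) x)"
    by (rule vint_cong[OF W]) (simp add: fl)
  also have "\<dots> = vint {w} (fibre_len w A) + ennreal h * vvol {w} (shadow w A)"
  proof -
    note [measurable] = fibre_len_measurable[OF bA(4)] Sh unit_cyl_measurable[of "{w}", simplified]
    have "vint {w} (\<lambda>x. fibre_len w A x + ennreal h * indicator (shadow w A) x)
      = (\<integral>\<^sup>+x. fibre_len w A (orth_proj {w} x) * indicator (unit_cyl {w}) x
          + ennreal h * (indicator (shadow w A) (orth_proj {w} x) * indicator (unit_cyl {w}) x) \<partial>lborel)"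
      unfolding vint_def by (simp add: distrib_right mult.assoc)
    also have "\<dots> = (\<integral>\<^sup>+x. fibre_len w A (orth_proj {w} x) * indicator (unit_cyl {w}) x \<partial>lborel)
          + (\<integral>\<^sup>+x. ennreal h * (indicator (shadow w A) (orth_proj {w} x) * indicator (unit_cyl {w}) x) \<partial>lborel)"
      by (rule nn_integral_add) measurable
    also have "(\<integral>\<^sup>+x. ennreal h * (indicator (shadow w A) (orth_proj {w} x) * indicator (unit_cyl {w}) x) \<partial>lborel)
        = ennreal h * vvol {w} (shadow w A)"
      unfolding vvol_def vint_def by (rule nn_integral_cmult) measurable
    finally show ?thesis by (simp add: vint_def)
  qed
  also have "\<dots> = ennreal (measure lebesgue A + h * shrad w A ^ (DIM('a) - 1))"
    using vint_fibre_len[OF w bA(4)] emeasure_eq_measure_lebesgue[OF bA(4,3)] shadow_volume[OF w A] h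
    by (simp add: ennreal_plus[symmetric] ennreal_mult'[symmetric] del: ennreal_plus)
  finally show ?thesis using h shadow_volume(1)[OF w A] by (subst (asm) ennreal_inj) simp_all
qed

text \<open>Only powers of the radii are compared: in dimension one \<open>shrad\<close> is
  \<open>1\<close> for every body, so the radii themselves do not scale by \<open>c\<close>.\<close>

lemma shadow_homothetic_volume:
  fixes w :: "'a::euclidean_space"
  assumes w: "norm w = 1" and A: "convex_body A" and C: "convex_body C"
    and c: "c > 0" and sh: "shadow w C = (\<lambda>x. c *\<^sub>R x + v) ` shadow w A"
  shows "shrad w C ^ (DIM('a) - 1) = c ^ (DIM('a) - 1) * shrad w A ^ (DIM('a) - 1)"
proof -
  have W: "orthonormal {w}" using w by (rule orthonormal_singleton)
  obtain x where x: "x \<in> shadow w A" using convex_body_simps(5)[OF A] by blast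
  then have "c *\<^sub>R x + v \<in> shadow w C" unfolding sh by (rule imageI)
  from shadow_orth[OF w this] have v: "v \<bullet> w = 0" using shadow_orth[OF w x] by (simp add: inner_add_left)
  have "vvol {w} (shadow w C) = ennreal (c ^ (DIM('a) - card {w})) * vvol {w} (shadow w A)"
    unfolding sh using shadow_compact_convex(1)[OF A] c v by (intro vvol_affine[OF W]) (auto simp: compact_imp_closed)
  then show ?thesis
    using shadow_volume[OF w A] shadow_volume[OF w C] c by (simp add: ennreal_mult'[symmetric])
qed

text \<open>The equality theorem for \<open>W = {w}\<close>, applied to fibre lengths over open
  shadows: the average fibre length of a body is its volume divided by the volume of its shadow, so
  the assumed identity is exactly the functional equality. For the sum the full body
  \<open>A + B\<close> supplies \<open>h\<close>, whose integral is its volume.\<close>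

lemma bonnesen_equality_shadow:
  fixes w :: "'a::euclidean_space"
  assumes w: "norm w = 1" and A: "convex_body A" and B: "convex_body B"
    and eq: "measure lebesgue (A + B) = (shrad w A + shrad w B) ^ (DIM('a) - 1)
      * (measure lebesgue A / shrad w A ^ (DIM('a) - 1) + measure lebesgue B / shrad w B ^ (DIM('a) - 1))"
  obtains v where "shadow w B = (\<lambda>x. (shrad w B / shrad w A) *\<^sub>R x + v) ` shadow w A"
proof -
  have W: "orthonormal {w}" using w by (rule orthonormal_singleton)
  let ?m = "DIM('a) - 1"
  note bA = convex_body_simps[OF A] and bB = convex_body_simps[OF B]
  have AB: "convex_body (A + B)" using A bB(1,2,5) by (rule convex_body_plus)
  note bAB = convex_body_simps[OF AB]
  note oA = open_shadow[OF w A] and oB = open_shadow[OF w B]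
  let ?P = "shadow w (interior A)" and ?Q = "shadow w (interior B)"
  have rad: "vrad {w} ?P = shrad w A" "vrad {w} ?Q = shrad w B" using oA(3) oB(3) by (simp_all add: vrad_def)
  have avg: "vavg {w} (shadow w (interior X)) (fibre_len w (interior X)) = ennreal (measure lebesgue X / shrad w X ^ ?m)"
    if X: "convex_body X" for X
    unfolding vavg_def open_shadow(6)[OF w X] open_shadow(3)[OF w X] shadow_volume(2)[OF w X]
    using shadow_volume(1)[OF w X] by (simp add: divide_ennreal)
  have vl: "vint {w} (fibre_len w (A + B)) = ennreal (measure lebesgue (A + B))"
    using vint_fibre_len[OF w bAB(4)] emeasure_eq_measure_lebesgue[OF bAB(4,3)] by simp
  obtain v where "closure ?Q = (\<lambda>x. (vrad {w} ?Q / vrad {w} ?P) *\<^sub>R x + v) ` closure ?P"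
  proof (rule vint_equality_homothetic[OF W oA(1) oB(1), of "fibre_len w (interior A)" "fibre_len w (interior B)" "fibre_len w (A + B)"])
    show "fibre_len w (interior A) \<in> borel_measurable borel" "fibre_len w (interior B) \<in> borel_measurable borel"
      by (intro fibre_len_measurable borel_open open_interior)+
    show "fibre_len w (A + B) \<in> borel_measurable borel" by (rule fibre_len_measurable[OF bAB(4)])
    show "fibre_len w (interior A) x + fibre_len w (interior B) y \<le> fibre_len w (A + B) (x + y)"
      if "x \<in> ?P" "y \<in> ?Q" for x y
      unfolding fibre_len_def
    proof (rule emeasure_sum_le_real)
      show "bounded (fibre w (interior A) x)" "bounded (fibre w (interior B) y)"
        by (simp_all add: bounded_fibre[OF w] bounded_interior bA(3) bB(3))
      show "fibre w (interior A) x \<noteq> {}" "fibre w (interior B) y \<noteq> {}" using oA(4) oB(4) that by blast+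
      show "fibre w (interior A) x \<in> sets borel" "fibre w (interior B) y \<in> sets borel"
        by (intro fibre_measurable borel_open open_interior)+
      show "convex (fibre w (A + B) (x + y))" by (rule convex_fibre[OF bAB(2)])
      show "fibre w (A + B) (x + y) \<in> sets borel" by (rule fibre_measurable[OF bAB(4)])
      fix s t assume "s \<in> fibre w (interior A) x" "t \<in> fibre w (interior B) y"
      then have "(x + s *\<^sub>R w) + (y + t *\<^sub>R w) \<in> A + B"
        using interior_subset by (intro set_plus_intro) (auto simp: fibre_def)
      then show "s + t \<in> fibre w (A + B) (x + y)" by (simp add: fibre_def algebra_simps)
    qed
    show "fibre_len w (interior A) x > 0" if "x \<in> ?P" for x using oA(5)[OF that] .
    show "vint {w} (fibre_len w (A + B)) = ennreal ((vrad {w} ?P + vrad {w} ?Q) ^ (DIM('a) - card {w}))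
        * (vavg {w} ?P (fibre_len w (interior A)) + vavg {w} ?Q (fibre_len w (interior B)))"
      unfolding rad avg[OF A] avg[OF B] vl eq using shadow_volume(1)[OF w A] shadow_volume(1)[OF w B]
      by (simp add: ennreal_mult' ennreal_plus[symmetric] del: ennreal_plus)
    show "vint {w} (fibre_len w (A + B)) < top" by (simp add: vl)
  qed
  then show thesis using that unfolding rad oA(2) oB(2) by blast
qed

text \<open>If \<open>k = 0\<close>, then \<open>B\<close> is the homothetic image of
  \<open>A + segment w h\<close>. A homothety of ratio \<open>c\<close> carries the segment to
  \<open>segment w (c * h)\<close>, so \<open>B\<close> is a stretching of the image of
  \<open>A\<close>, and \<open>A\<close> is a stretching of itself by zero. The case
  \<open>h = 0\<close> is handled with the inverse homothety.\<close>

lemma bonnesen_equality_imp_stretchings: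
  fixes w :: "'a::euclidean_space"
  assumes w: "norm w = 1" and A: "convex_body A" and B: "convex_body B"
    and eq: "measure lebesgue (A + B) = (shrad w A + shrad w B) ^ (DIM('a) - 1)
      * (measure lebesgue A / shrad w A ^ (DIM('a) - 1) + measure lebesgue B / shrad w B ^ (DIM('a) - 1))"
  shows "\<exists>A' B' h k. convex_body A' \<and> convex_body B' \<and> homothetic_bodies A' B' \<and> h \<ge> 0 \<and> k \<ge> 0
      \<and> A = A' + segment w h \<and> B = B' + segment w k"
proof -
  define m where "m = DIM('a) - 1"
  have n: "DIM('a) = Suc m" by (simp add: m_def)
  define \<mu> \<nu> where "\<mu> = shrad w A" and "\<nu> = shrad w B"
  have pos: "\<mu> > 0" "\<nu> > 0" using shadow_volume(1)[OF w A] shadow_volume(1)[OF w B] by (simp_all add: \<mu>_def \<nu>_def)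
  note bA = convex_body_simps[OF A] and bB = convex_body_simps[OF B]
  have AB: "convex_body (A + B)" using A bB(1,2,5) by (rule convex_body_plus)
  obtain v where v: "shadow w B = (\<lambda>x. (\<nu> / \<mu>) *\<^sub>R x + v) ` shadow w A"
    using bonnesen_equality_shadow[OF w A B eq] by (auto simp: \<mu>_def \<nu>_def)
  \<comment> \<open>Homothety of the shadows determines the shadow volume of \<open>A + B\<close>,
    which is the factor of \<open>h + k\<close> when the sum is stretched.\<close>
  have "shadow w (A + B) = (\<lambda>x. (1 + \<nu> / \<mu>) *\<^sub>R x + v) ` shadow w A"
    unfolding shadow_plus v using shadow_compact_convex(2)[OF A] pos by (intro convex_plus_homothet) simp_all
  then have "shrad w (A + B) ^ m = (1 + \<nu> / \<mu>) ^ m * \<mu> ^ m"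
    using shadow_homothetic_volume[OF w A AB, of "1 + \<nu> / \<mu>" v] pos by (simp add: m_def \<mu>_def add_pos_pos)
  also have "\<dots> = (\<mu> + \<nu>) ^ m" using pos by (simp add: power_mult_distrib[symmetric] distrib_right)
  finally have shAB: "shrad w (A + B) ^ m = (\<mu> + \<nu>) ^ m" .
  define \<alpha> \<beta> where "\<alpha> = measure lebesgue A / \<mu> ^ m" and "\<beta> = measure lebesgue B / \<nu> ^ m"
  have ab: "\<alpha> > 0" "measure lebesgue A = \<alpha> * \<mu> ^ m" "measure lebesgue B = \<beta> * \<nu> ^ m"
    using pos bA(9) by (simp_all add: \<alpha>_def \<beta>_def)
  \<comment> \<open>\<open>s\<close> is the least factor for which nonnegative stretchings raise
    \<open>\<alpha>\<close> to \<open>s * \<mu>\<close> and \<open>\<beta>\<close> to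
    \<open>s * \<nu>\<close>. The term attaining the maximum needs no stretching, so at least one of
    \<open>h\<close> and \<open>k\<close> is zero.\<close>
  define s where "s = max (\<alpha> / \<mu>) (\<beta> / \<nu>)"
  define h k where "h = s * \<mu> - \<alpha>" and "k = s * \<nu> - \<beta>"
  have "\<alpha> / \<mu> \<le> s" "\<beta> / \<nu> \<le> s" by (simp_all add: s_def)
  then have hk: "h \<ge> 0" "k \<ge> 0" using pos by (simp_all add: h_def k_def pos_divide_le_eq)
  have hk0: "h = 0 \<or> k = 0" using pos by (auto simp: h_def k_def s_def max_def)
  have s: "s > 0" using ab(1) pos by (simp add: s_def less_max_iff_disj)
  define X Y where "X = A + segment w h" and "Y = B + segment w k"
  have X: "convex_body X" and Y: "convex_body Y"
    unfolding X_def Y_def using A B segment_props[OF hk(1)] segment_props[OF hk(2)] by (blast intro: convex_body_plus)+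
  have vX: "measure lebesgue X = s * \<mu> ^ DIM('a)"
    using measure_plus_segment[OF w A hk(1)] by (simp add: X_def n ab(2) \<mu>_def[symmetric] h_def algebra_simps)
  have vY: "measure lebesgue Y = s * \<nu> ^ DIM('a)"
    using measure_plus_segment[OF w B hk(2)] by (simp add: Y_def n ab(3) \<nu>_def[symmetric] k_def algebra_simps)
  have XY: "X + Y = (A + B) + segment w (h + k)"
    unfolding X_def Y_def segment_plus[OF hk, symmetric] by (simp add: add_ac)
  have "measure lebesgue (X + Y) = measure lebesgue (A + B) + (h + k) * (\<mu> + \<nu>) ^ m"
    unfolding XY using measure_plus_segment[OF w AB, of "h + k"] hk shAB by (simp add: m_def)
  also have "measure lebesgue (A + B) = (\<mu> + \<nu>) ^ m * (\<alpha> + \<beta>)"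
    using eq by (simp add: \<alpha>_def \<beta>_def \<mu>_def \<nu>_def m_def)
  \<comment> \<open>The volume is \<open>(\<mu> + \<nu>) ^ m * (\<alpha> + \<beta> + h + k)\<close>,
    where \<open>\<alpha> + h = s * \<mu>\<close> and
    \<open>\<beta> + k = s * \<nu>\<close>.\<close>
  finally have vXY: "measure lebesgue (X + Y) = s * (\<mu> + \<nu>) ^ DIM('a)"
    by (simp add: n h_def k_def algebra_simps)
  obtain z where z: "Y = (\<lambda>x. (\<nu> / \<mu>) *\<^sub>R x + z) ` X"
    using brunn_minkowski_equality_homothetic[OF X Y s pos vX vY vXY] by blast
  define c where "c = \<nu> / \<mu>"
  have c: "c > 0" using pos by (simp add: c_def)
  have seg0: "S + segment w 0 = S" for S :: "'a set" by (auto simp: set_plus_def)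
  have homo: "homothetic_bodies S ((\<lambda>x. c *\<^sub>R x + z) ` S)" for S
    unfolding homothetic_bodies_def
  proof (intro exI conjI)
    show "1 / c > 0" using c by simp
    show "S = (\<lambda>y. (1 / c) *\<^sub>R y + (- ((1 / c) *\<^sub>R z))) ` (\<lambda>x. c *\<^sub>R x + z) ` S"
      using c by (simp add: image_image scaleR_add_right)
  qed
  have aff: "(\<lambda>x. t *\<^sub>R x + r) ` (S + segment w l) = (\<lambda>x. t *\<^sub>R x + r) ` S + segment w (t * l)"
    if t: "t > 0" "l \<ge> 0" for t r l and S :: "'a set"
  proof (intro equalityI subsetI)
    fix x assume "x \<in> (\<lambda>x. t *\<^sub>R x + r) ` (S + segment w l)"
    then obtain a j where "a \<in> S" "j \<in> {0..l}" "x = t *\<^sub>R (a + j *\<^sub>R w) + r" by (auto simp: set_plus_def)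
    then have "x = (t *\<^sub>R a + r) + (t * j) *\<^sub>R w" "t * j \<in> {0..t * l}" using t by (auto simp: algebra_simps)
    then show "x \<in> (\<lambda>x. t *\<^sub>R x + r) ` S + segment w (t * l)" using \<open>a \<in> S\<close> by (auto intro!: set_plus_intro)
  next
    fix x assume "x \<in> (\<lambda>x. t *\<^sub>R x + r) ` S + segment w (t * l)"
    then obtain a j where aj: "a \<in> S" "j \<in> {0..t * l}" "x = (t *\<^sub>R a + r) + j *\<^sub>R w" by (auto simp: set_plus_def)
    then have "x = t *\<^sub>R (a + (j / t) *\<^sub>R w) + r" "j / t \<in> {0..l}" using t by (auto simp: algebra_simps field_simps)
    then show "x \<in> (\<lambda>x. t *\<^sub>R x + r) ` (S + segment w l)" using aj(1) by (intro image_eqI) (auto intro!: set_plus_intro)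
  qed
  from hk0 show ?thesis
  proof
    assume "k = 0"
    then have "B = (\<lambda>x. c *\<^sub>R x + z) ` A + segment w (c * h)"
      using z aff[OF c hk(1), of z A] seg0 by (simp add: X_def Y_def c_def)
    moreover have "c * h \<ge> 0" using c hk by simp
    ultimately show ?thesis
      using A convex_body_affine(1)[OF A c] homo[of A] seg0[of A]
      by (intro exI[of _ A] exI[of _ "(\<lambda>x. c *\<^sub>R x + z) ` A"] exI[of _ 0] exI[of _ "c * h"]) auto
  next
    assume "h = 0"
    then have e: "(\<lambda>x. c *\<^sub>R x + z) ` A = B + segment w k" using z seg0 by (simp add: X_def Y_def c_def)
    let ?g = "\<lambda>x. (1 / c) *\<^sub>R x + (- ((1 / c) *\<^sub>R z))"
    have "A = ?g ` (B + segment w k)"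
      unfolding e[symmetric] using c by (simp add: image_image scaleR_add_right)
    then have Ak: "A = ?g ` B + segment w (1 / c * k)" using aff[of "1 / c" k "- ((1 / c) *\<^sub>R z)" B] c hk by simp
    show ?thesis
    proof (rule exI[of _ "?g ` B"], rule exI[of _ B], rule exI[of _ "1 / c * k"], rule exI[of _ 0], intro conjI)
      show "homothetic_bodies (?g ` B) B"
        unfolding homothetic_bodies_def using c by (intro exI[of _ "1 / c"] exI[of _ "- ((1 / c) *\<^sub>R z)"]) simp
      show "convex_body (?g ` B)" using B c by (intro convex_body_affine(1)) simp_all
      show "1 / c * k \<ge> 0" using c hk by simp
      show "A = ?g ` B + segment w (1 / c * k)" by (fact Ak)
      show "B = B + segment w 0" by (rule seg0[symmetric])
    qed (use B in simp_all)
  qed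
qed

text \<open>The sum of the stretched bodies is the homothetic copy of \<open>B\<close> with ratio
  \<open>1 + c\<close>, stretched by \<open>h + k\<close>. Every volume is therefore a polynomial in
  \<open>c\<close>, \<open>h\<close>, \<open>k\<close> and data of \<open>B\<close>; with
  \<open>d\<close> the volume of \<open>B\<close> per unit of shadow, both sides equal
  \<open>(1 + c) ^ m * \<nu> ^ m * ((c * d + h) + (d + k))\<close>.\<close>

lemma stretchings_imp_bonnesen_equality:
  fixes w :: "'a::euclidean_space"
  assumes w: "norm w = 1" and A: "convex_body A" and B: "convex_body B"
    and hom: "homothetic_bodies A B" and hk: "h \<ge> 0" "k \<ge> 0"
  shows "measure lebesgue ((A + segment w h) + (B + segment w k))
    = (shrad w (A + segment w h) + shrad w (B + segment w k)) ^ (DIM('a) - 1)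
      * (measure lebesgue (A + segment w h) / shrad w (A + segment w h) ^ (DIM('a) - 1)
        + measure lebesgue (B + segment w k) / shrad w (B + segment w k) ^ (DIM('a) - 1))"
proof -
  define m where "m = DIM('a) - 1"
  have n: "DIM('a) = Suc m" by (simp add: m_def)
  obtain c v where c: "c > 0" and Aeq: "A = (\<lambda>y. c *\<^sub>R y + v) ` B" using hom by (auto simp: homothetic_bodies_def)
  have shA: "shadow w A = (\<lambda>x. c *\<^sub>R x + orth_proj {w} v) ` shadow w B" unfolding Aeq by (rule shadow_affine)
  define \<nu> where "\<nu> = shrad w B"
  have \<nu>: "\<nu> > 0" using shadow_volume(1)[OF w B] by (simp add: \<nu>_def)
  have \<mu>: "shrad w A ^ m = c ^ m * \<nu> ^ m"
    using shadow_homothetic_volume[OF w B A c shA] by (simp add: m_def \<nu>_def)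
  have \<mu>p: "shrad w A > 0" using shadow_volume(1)[OF w A] .
  \<comment> \<open>For \<open>m = 0\<close> both sides are \<open>1\<close>; for positive
    \<open>m\<close> the radius \<open>c * \<nu>\<close> can be recovered from its power.\<close>
  have sum: "(shrad w A + \<nu>) ^ m = (1 + c) ^ m * \<nu> ^ m"
  proof (cases "m = 0")
    case False
    have "shrad w A ^ m = (c * \<nu>) ^ m" using \<mu> by (simp add: power_mult_distrib)
    then have "shrad w A = c * \<nu>" using False c \<nu> \<mu>p power_eq_imp_eq_base[of "shrad w A" m "c * \<nu>"] by simp
    then show ?thesis by (simp add: power_mult_distrib[symmetric] algebra_simps)
  qed simp
  have bB: "compact B" "convex B" "B \<noteq> {}" using convex_body_simps[OF B] by simp_all
  have AB: "convex_body (A + B)" using A bB by (rule convex_body_plus)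
  have ABeq: "A + B = (\<lambda>y. (1 + c) *\<^sub>R y + v) ` B"
    using convex_plus_homothet[OF bB(2) c, of v] by (simp add: Aeq add.commute)
  have c1: "1 + c > 0" using c by simp
  have shAB: "shrad w (A + B) ^ m = (1 + c) ^ m * \<nu> ^ m"
    using shadow_homothetic_volume[OF w B AB c1, of "orth_proj {w} v"] shadow_affine[of w "1 + c" v B]
    by (simp add: ABeq[symmetric] m_def \<nu>_def)
  define b where "b = measure lebesgue B"
  have vA: "measure lebesgue A = c ^ Suc m * b" and vAB: "measure lebesgue (A + B) = (1 + c) ^ Suc m * b"
    using convex_body_affine(2)[OF B c, of v] convex_body_affine(2)[OF B c1, of v]
    by (simp_all add: Aeq[symmetric] ABeq[symmetric] n b_def)
  have "(A + segment w h) + (B + segment w k) = (A + B) + segment w (h + k)"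
    unfolding segment_plus[OF hk, symmetric] by (simp add: add_ac)
  then have L: "measure lebesgue ((A + segment w h) + (B + segment w k))
      = (1 + c) ^ Suc m * b + (h + k) * ((1 + c) ^ m * \<nu> ^ m)"
    using measure_plus_segment[OF w AB, of "h + k"] hk shAB vAB by (simp add: m_def)
  have r: "shrad w (A + segment w h) = shrad w A" "shrad w (B + segment w k) = \<nu>"
    by (simp_all add: shadow_segment[OF w] hk \<nu>_def)
  have a: "measure lebesgue (A + segment w h) = c ^ Suc m * b + h * (c ^ m * \<nu> ^ m)"
    using measure_plus_segment[OF w A hk(1)] vA \<mu> by (simp add: m_def)
  have b: "measure lebesgue (B + segment w k) = b + k * \<nu> ^ m"
    using measure_plus_segment[OF w B hk(2)] by (simp add: m_def b_def \<nu>_def)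
  define d where "d = b / \<nu> ^ m"
  have bd: "b = d * \<nu> ^ m" using \<nu> by (simp add: d_def)
  have "(c ^ Suc m * b + h * (c ^ m * \<nu> ^ m)) / (c ^ m * \<nu> ^ m) = c * d + h"
    "(b + k * \<nu> ^ m) / \<nu> ^ m = d + k"
    using c \<nu> by (simp_all add: bd add_divide_distrib)
  moreover have "(1 + c) ^ Suc m * b + (h + k) * ((1 + c) ^ m * \<nu> ^ m)
      = (1 + c) ^ m * \<nu> ^ m * ((c * d + h) + (d + k))"
  proof -
    have "(1 + c) * X * (d * Y) + (h + k) * (X * Y) = X * Y * ((c * d + h) + (d + k))" for X Y :: real
      by (simp add: algebra_simps)
    then show ?thesis unfolding bd power_Suc .
  qed
  ultimately show ?thesis
    unfolding L m_def[symmetric] r a b sum \<mu> by (simp only:)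
qed

section \<open>From orthogonal shadows to images under a general linear map\<close>

text \<open>The map \<open>L\<close> agrees with \<open>\<pi>\<close> on the hyperplane orthogonal
  to \<open>w\<close> and sends \<open>w\<close> to a unit normal \<open>w'\<close> of the range. It
  is invertible and pulls the unit cylinder over the image of \<open>A\<close> back to the unit
  cylinder over the shadow of \<open>A\<close>, so the two measures differ by the absolute
  determinant of \<open>L\<close>, the same for all bodies.\<close>

lemma subspace_lebesgue_proportional:
  fixes \<pi> :: "'a::euclidean_space \<Rightarrow> 'a"
  assumes \<pi>: "linear \<pi>" and ker: "dim {x. \<pi> x = 0} = 1" and w: "norm w = 1" "\<pi> w = 0"
  obtains \<kappa> where "\<kappa> > 0"
    "\<And>A. convex_body A \<Longrightarrow> measure (subspace_lebesgue (range \<pi>)) (\<pi> ` A) = \<kappa> * shrad w A ^ (DIM('a) - 1)"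
proof -
  have W: "orthonormal {w}" using w(1) by (rule orthonormal_singleton)
  have ww: "w \<bullet> w = 1" using w(1) by (simp add: norm_eq_1)
  let ?R = "range \<pi>"
  have R: "subspace ?R" using \<pi> linear_subspace_image subspace_UNIV by blast
  define B where "B = (SOME B. orthonormal_basis ?R B)"
  have "\<exists>B. orthonormal_basis ?R B"
    using orthonormal_basis_subspace[OF R] unfolding orthonormal_basis_def by metis
  then have B: "orthonormal_basis ?R B" unfolding B_def by (rule someI_ex)
  have oB: "orthonormal B" and sB: "span B = ?R" using B by (auto simp: orthonormal_basis_def orthonormal_def)
  obtain W' where W': "B \<inter> W' = {}" "orthonormal (B \<union> W')" "span (B \<union> W') = UNIV"
    using orthonormal_extend[OF oB] by blast
  have oW': "orthonormal W'" using orthonormal_subset[OF W'(2)] by blast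
  have fin: "finite B" "finite W'" using orthonormal_finite oB oW' by blast+
  have "span {w} = span {x. \<pi> x = 0}" using w ker by (intro dim_eq_span) auto
  then have kerw: "\<exists>c. x = c *\<^sub>R w" if "\<pi> x = 0" for x
    using that span_base[of x "{x. \<pi> x = 0}"] by (auto simp: span_singleton)
  have \<pi>pr: "\<pi> (orth_proj {w} x) = \<pi> x" for x
    using w(2) \<pi> by (simp add: orth_proj_def linear_diff linear_scale)
  have \<pi>eq: "\<pi> x = \<pi> y \<longleftrightarrow> orth_proj {w} x = orth_proj {w} y" for x y
  proof
    assume "\<pi> x = \<pi> y"
    then obtain c where "x - y = c *\<^sub>R w" using kerw[of "x - y"] \<pi> by (auto simp: linear_diff)
    then have "orth_proj {w} (x - y) = 0" using orth_proj_scaleR_self[OF w(1)] by simp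
    then show "orth_proj {w} x = orth_proj {w} y" using linear_diff[OF linear_orth_proj, of "{w}" x y] by simp
  qed (metis \<pi>pr)
  \<comment> \<open>\<open>\<pi>\<close> maps the hyperplane orthogonal to \<open>w\<close>
    bijectively onto the range, so the range has codimension one and a single unit normal completes
    its basis.\<close>
  have "card W' = 1"
  proof -
    let ?V = "{x. w \<bullet> x = 0}"
    have V: "subspace ?V" by (rule subspace_hyperplane)
    have prV: "orth_proj {w} x \<in> ?V" for x using orth_proj_inner[OF W, of w x] by (simp add: inner_commute)
    have "\<pi> ` ?V = ?R" using prV \<pi>pr by (metis (no_types, lifting) UNIV_I image_iff image_subset_iff subsetI subset_antisym)
    moreover have "inj_on \<pi> ?V"
    proof (rule inj_onI)
      fix x y assume "x \<in> ?V" "y \<in> ?V" "\<pi> x = \<pi> y"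
      moreover from this have "orth_proj {w} x = x" "orth_proj {w} y = y" by (auto simp: orth_proj_def inner_commute)
      ultimately show "x = y" using \<pi>eq by metis
    qed
    moreover have "dim ?V = DIM('a) - 1" using w(1) by (intro dim_hyperplane) auto
    ultimately have "dim ?R = DIM('a) - 1"
      using dim_image_eq[OF \<pi>, of ?V] V by (simp add: span_eq_iff[THEN iffD2])
    moreover have "dim ?R = card B" using dim_eq_card[of B ?R] sB R orthonormal_independent[OF oB] by (metis span_eq_iff)
    moreover have "card (B \<union> W') = DIM('a)"
      using dim_eq_card[of "B \<union> W'" UNIV] W'(3) orthonormal_independent[OF W'(2)] by (simp add: dim_UNIV)
    ultimately show ?thesis using card_Un_disjoint[OF fin W'(1)] DIM_positive[where 'a='a] by linarith
  qed
  then obtain w' where w': "W' = {w'}" using card_1_singletonE by blast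
  have nw': "norm w' = 1" "w' \<bullet> w' = 1" using oW' by (simp_all add: w' orthonormal_def norm_eq_1)
  have Rw': "\<pi> x \<bullet> w' = 0" for x
  proof -
    have "orthogonal w' b" if "b \<in> B" for b
    proof -
      have "w' \<noteq> b" using that W'(1) by (auto simp: w')
      then show ?thesis using W'(2) that by (auto simp: w' orthonormal_def pairwise_def)
    qed
    then have "orthogonal w' (\<pi> x)" using orthogonal_to_span[of "\<pi> x" B w'] sB by blast
    then show ?thesis by (simp add: orthogonal_def inner_commute)
  qed
  define L where "L x = \<pi> x + (x \<bullet> w) *\<^sub>R w'" for x
  have linL: "linear L"
    using \<pi> by (intro linearI) (simp_all add: L_def linear_add linear_scale inner_add_left algebra_simps)
  have Lw': "L x \<bullet> w' = x \<bullet> w" for x by (simp add: L_def inner_add_left Rw' nw')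
  have prL: "orth_proj {w'} (L x) = \<pi> x" for x by (simp add: orth_proj_def Lw') (simp add: L_def)
  have injL: "inj L"
  proof (rule linear_injective_0[OF linL, THEN iffD2], intro allI impI)
    fix x assume "L x = 0"
    then have "\<pi> x = 0" "x \<bullet> w = 0" using prL[of x] Lw'[of x] by (auto simp: orth_proj_def)
    then show "x = 0" using kerw[of x] ww by auto
  qed
  \<comment> \<open>The volume of the unit ball divided by that of its preimage is the factor by
    which \<open>L\<close> scales volumes; \<open>\<beta> / \<gamma>\<close> will be
    \<open>\<kappa>\<close>.\<close>
  define \<beta> \<gamma> where "\<beta> = enn2real (emeasure lborel (ball 0 1 :: 'a set))" and "\<gamma> = enn2real (emeasure lborel (L -` ball 0 1))"
  have idball: "emeasure lborel (ball 0 1 :: 'a set) < top" "0 < emeasure lborel (ball 0 1 :: 'a set)"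
    using lborel_linear_vimage(2,3)[OF linear_id, of "{}"] by simp_all
  have \<beta>: "\<beta> > 0" "emeasure lborel (ball 0 1 :: 'a set) = ennreal \<beta>"
    using idball by (simp_all add: \<beta>_def enn2real_positive_iff)
  have \<gamma>: "\<gamma> > 0" "emeasure lborel (L -` ball 0 1) = ennreal \<gamma>"
    using lborel_linear_vimage(2,3)[OF linL injL, of "{}"] by (simp_all add: \<gamma>_def enn2real_positive_iff)
  show thesis
  proof (rule that[of "\<beta> / \<gamma>"])
    show "\<beta> / \<gamma> > 0" using \<beta> \<gamma> by simp
    fix A :: "'a set" assume A: "convex_body A"
    let ?\<rho> = "shrad w A ^ (DIM('a) - 1)"
    have "compact (\<pi> ` A)"
      using convex_body_simps(1)[OF A] \<pi> by (intro compact_continuous_image linear_continuous_on) (simp_all add: linear_conv_bounded_linear)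
    then have m: "\<pi> ` A \<in> sets borel" by (simp add: compact_imp_closed)
    have mS: "shadow w A \<in> sets borel" using shadow_compact_convex(1)[OF A] by (simp add: compact_imp_closed)
    define C where "C = unit_cyl {w'} \<inter> orth_proj {w'} -` (\<pi> ` A)"
    have C: "C \<in> sets borel" "vvol {w'} (\<pi> ` A) = emeasure lborel C"
      unfolding C_def using vvol_eq[OF orthonormal_singleton[OF nw'(1)] m] by auto
    have "L -` C = unit_cyl {w} \<inter> orth_proj {w} -` shadow w A"
      unfolding C_def by (auto simp: unit_cyl_def Lw' prL \<pi>eq)
    then have "emeasure lborel (L -` C) = ennreal ?\<rho>"
      using vvol_eq[OF W mS] shadow_volume(2)[OF w(1) A] by simp
    then have "ennreal \<gamma> * emeasure lborel C = ennreal (?\<rho> * \<beta>)"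
      using lborel_linear_vimage(1)[OF linL injL C(1)] \<beta> \<gamma> shadow_volume(1)[OF w(1) A] by (simp add: ennreal_mult')
    also have "\<dots> = ennreal \<gamma> * ennreal (\<beta> / \<gamma> * ?\<rho>)"
      using \<beta> \<gamma> by (simp add: ennreal_mult'[symmetric] mult.commute)
    finally have eC: "emeasure lborel C = ennreal (\<beta> / \<gamma> * ?\<rho>)" using \<gamma>(1) by (auto simp: ennreal_mult_cancel_left)
    have "measure (subspace_lebesgue ?R) (\<pi> ` A) = measure (distr (PL B) borel (emb B)) (\<pi> ` A)"
      unfolding subspace_lebesgue_def B_def[symmetric] Let_def emb_def[abs_def] using m by simp
    also have "\<dots> = measure (PL B) (emb B -` (\<pi> ` A) \<inter> space (PL B))"
      using m by (intro measure_distr) simp_all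
    also have "\<dots> = enn2real (\<integral>\<^sup>+z. indicator (emb B -` (\<pi> ` A) \<inter> space (PL B)) z \<partial>PL B)"
      using measurable_sets[OF emb_measurable m, of B] by (simp add: measure_def)
    also have "(\<integral>\<^sup>+z. indicator (emb B -` (\<pi> ` A) \<inter> space (PL B)) z \<partial>PL B) = (\<integral>\<^sup>+z. indicator (\<pi> ` A) (emb B z) \<partial>PL B)"
      by (intro nn_integral_cong) (simp add: indicator_def)
    also have "\<dots> = vvol W' (\<pi> ` A)"
      unfolding vvol_def by (rule vint_emb[OF W'(2,3,1) borel_measurable_indicator[OF m], symmetric])
    also have "\<dots> = ennreal (\<beta> / \<gamma> * ?\<rho>)" using C(2) eC by (simp add: w')
    finally show "measure (subspace_lebesgue ?R) (\<pi> ` A) = \<beta> / \<gamma> * ?\<rho>"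
      using \<beta> \<gamma> shadow_volume(1)[OF w(1) A] by simp
  qed
qed

text \<open>Roots turn \<open>\<kappa>\<close> into a common factor
  \<open>\<kappa> powr (1 / (d - 1))\<close> of both radii; the power of their sum contributes
  \<open>\<kappa>\<close> again, which cancels the \<open>\<kappa>\<close> in the denominators. So
  the bound is insensitive to the scale of the measure on the range.\<close>

lemma bonnesen_bound_homogeneous:
  fixes \<kappa> \<mu> \<nu> :: real
  assumes "\<kappa> > 0" "\<mu> > 0" "\<nu> > 0" "d > 0"
  shows "bonnesen_bound d (\<kappa> * \<mu> ^ (d - 1)) (\<kappa> * \<nu> ^ (d - 1)) a b
    = (\<mu> + \<nu>) ^ (d - 1) * (a / \<mu> ^ (d - 1) + b / \<nu> ^ (d - 1))"
proof (cases "d = 1")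
  case False
  define m where "m = d - 1"
  have m: "m > 0" "real d - 1 = real m" using False assms(4) by (simp_all add: m_def of_nat_diff)
  have p: "(\<kappa> * t ^ m) powr (1 / real m) = \<kappa> powr (1 / real m) * t" if "t > 0" for t
    using that assms(1) m(1) by (simp add: powr_mult powr_realpow[symmetric] powr_powr)
  have k: "(\<kappa> powr (1 / real m)) ^ m = \<kappa>"
    using assms(1) m(1) by (simp add: powr_realpow[symmetric] powr_powr)
  have "((\<kappa> * \<mu> ^ m) powr (1 / real m) + (\<kappa> * \<nu> ^ m) powr (1 / real m)) ^ m = \<kappa> * (\<mu> + \<nu>) ^ m"
    using p[OF assms(2)] p[OF assms(3)] k by (simp add: distrib_left[symmetric] power_mult_distrib)
  then show ?thesis
    using False assms unfolding bonnesen_bound_def m(2) m_def[symmetric] by (simp add: field_simps)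
qed (simp add: bonnesen_bound_def)

text \<open>\<open>stretch_eq\<close> eliminates \<open>K\<close>, and an amount \<open>h\<close>
  counted in multiples of \<open>u\<close> becomes \<open>h * norm u\<close> in multiples of the
  normalised vector.\<close>

lemma is_stretching_iff:
  assumes u: "u \<noteq> 0" and A': "convex_body A'" and K: "line_complement u K"
  shows "is_stretching u K A A' \<longleftrightarrow> (\<exists>h\<ge>0. A = A' + segment (u /\<^sub>R norm u) h)"
proof -
  have st: "stretch u K h A' = A' + segment (u /\<^sub>R norm u) (h * norm u)" if "h \<ge> 0" for h
    unfolding stretch_eq[OF A' K that]
  proof (intro equalityI subsetI)
    fix z assume "z \<in> {a + t *\<^sub>R u |a t. a \<in> A' \<and> 0 \<le> t \<and> t \<le> h}"
    then obtain a t where at: "z = a + t *\<^sub>R u" "a \<in> A'" "0 \<le> t" "t \<le> h" by blast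
    then have "z = a + (t * norm u) *\<^sub>R (u /\<^sub>R norm u)" "t * norm u \<in> {0..h * norm u}"
      using u by (simp_all add: mult_right_mono)
    then show "z \<in> A' + segment (u /\<^sub>R norm u) (h * norm u)" using at(2) by (auto intro!: set_plus_intro)
  next
    fix z assume "z \<in> A' + segment (u /\<^sub>R norm u) (h * norm u)"
    then obtain a t where at: "z = a + t *\<^sub>R (u /\<^sub>R norm u)" "a \<in> A'" "0 \<le> t" "t \<le> h * norm u"
      by (auto simp: set_plus_def)
    then have "z = a + (t / norm u) *\<^sub>R u" "0 \<le> t / norm u" "t / norm u \<le> h"
      using u by (simp_all add: divide_inverse pos_divide_le_eq[unfolded divide_inverse])
    then show "z \<in> {a + t *\<^sub>R u |a t. a \<in> A' \<and> 0 \<le> t \<and> t \<le> h}" using at(2) by blast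
  qed
  show ?thesis
  proof
    assume "is_stretching u K A A'"
    then obtain h where "h \<ge> 0" "A = stretch u K h A'" by (auto simp: is_stretching_def)
    then show "\<exists>h\<ge>0. A = A' + segment (u /\<^sub>R norm u) h" using st by (intro exI[of _ "h * norm u"]) simp
  next
    assume "\<exists>h\<ge>0. A = A' + segment (u /\<^sub>R norm u) h"
    then obtain h where "h \<ge> 0" "A = A' + segment (u /\<^sub>R norm u) h" by blast
    then show "is_stretching u K A A'"
      unfolding is_stretching_def using st[of "h / norm u"] u by (intro exI[of _ "h / norm u"]) simp
  qed
qed

theorem theorem1p1:
  fixes A B K :: "(real ^ 'n) set"
    and \<pi> :: "real ^ 'n \<Rightarrow> real ^ 'n"
    and u :: "real ^ 'n"
    and M N :: real
  assumes "convex_body A" and "convex_body B"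
    and "linear \<pi>" and "dim {x. \<pi> x = 0} = 1"
    and "M = measure (subspace_lebesgue (range \<pi>)) (\<pi> ` A)"
    and "N = measure (subspace_lebesgue (range \<pi>)) (\<pi> ` B)"
    and "\<pi> u = 0" and "u \<noteq> 0" and "line_complement u K"
  shows "measure lebesgue (A + B)
           = bonnesen_bound CARD('n) M N (measure lebesgue A) (measure lebesgue B)
     \<longleftrightarrow> (\<exists>A' B'. convex_body A' \<and> convex_body B' \<and> homothetic_bodies A' B' \<and>
            is_stretching u K A A' \<and> is_stretching u K B B')"
proof -
  define w where "w = u /\<^sub>R norm u"
  have w: "norm w = 1" "\<pi> w = 0" using assms(3,7,8) by (simp_all add: w_def linear_scale)
  obtain \<kappa> where \<kappa>: "\<kappa> > 0" "\<And>A. convex_body A \<Longrightarrow>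
      measure (subspace_lebesgue (range \<pi>)) (\<pi> ` A) = \<kappa> * shrad w A ^ (CARD('n) - 1)"
    using subspace_lebesgue_proportional[OF assms(3,4) w] by auto
  \<comment> \<open>The images of \<open>A\<close> and \<open>B\<close> carry the same factor
    \<open>\<kappa>\<close>, so the bound may be expressed through the orthogonal shadows along
    \<open>w\<close>.\<close>
  have bound: "bonnesen_bound CARD('n) M N (measure lebesgue A) (measure lebesgue B)
      = (shrad w A + shrad w B) ^ (DIM(real ^ 'n) - 1)
        * (measure lebesgue A / shrad w A ^ (DIM(real ^ 'n) - 1) + measure lebesgue B / shrad w B ^ (DIM(real ^ 'n) - 1))"
    unfolding assms(5,6) \<kappa>(2)[OF assms(1)] \<kappa>(2)[OF assms(2)]
    using bonnesen_bound_homogeneous[OF \<kappa>(1) shadow_volume(1)[OF w(1) assms(1)] shadow_volume(1)[OF w(1) assms(2)], of "CARD('n)"]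
    by simp
  have st: "is_stretching u K S S' \<longleftrightarrow> (\<exists>h\<ge>0. S = S' + segment w h)" if "convex_body S'" for S S'
    unfolding w_def by (rule is_stretching_iff[OF assms(8) that assms(9)])
  show ?thesis
    unfolding bound
  proof
    assume eq: "measure lebesgue (A + B) = (shrad w A + shrad w B) ^ (DIM(real ^ 'n) - 1)
        * (measure lebesgue A / shrad w A ^ (DIM(real ^ 'n) - 1) + measure lebesgue B / shrad w B ^ (DIM(real ^ 'n) - 1))"
    show "\<exists>A' B'. convex_body A' \<and> convex_body B' \<and> homothetic_bodies A' B' \<and>
            is_stretching u K A A' \<and> is_stretching u K B B'"
    proof -
      obtain A' B' h k where AB': "convex_body A'" "convex_body B'" "homothetic_bodies A' B'"
        and hk: "h \<ge> 0" "k \<ge> 0" "A = A' + segment w h" "B = B' + segment w k"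
        using bonnesen_equality_imp_stretchings[OF w(1) assms(1,2) eq] by (elim exE conjE)
      have "is_stretching u K A A'" unfolding st[OF AB'(1)] using hk(1,3) by (intro exI conjI)
      moreover have "is_stretching u K B B'" unfolding st[OF AB'(2)] using hk(2,4) by (intro exI conjI)
      ultimately show ?thesis using AB' by (intro exI conjI)
    qed
  next
    assume "\<exists>A' B'. convex_body A' \<and> convex_body B' \<and> homothetic_bodies A' B' \<and>
            is_stretching u K A A' \<and> is_stretching u K B B'"
    then obtain A' B' where AB': "convex_body A'" "convex_body B'" "homothetic_bodies A' B'"
      "is_stretching u K A A'" "is_stretching u K B B'" by (elim exE conjE)
    obtain h k where *: "h \<ge> 0" "A = A' + segment w h" "k \<ge> 0" "B = B' + segment w k"
      using AB'(4,5) unfolding st[OF AB'(1)] st[OF AB'(2)] by (elim exE conjE)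
    show "measure lebesgue (A + B) = (shrad w A + shrad w B) ^ (DIM(real ^ 'n) - 1)
        * (measure lebesgue A / shrad w A ^ (DIM(real ^ 'n) - 1) + measure lebesgue B / shrad w B ^ (DIM(real ^ 'n) - 1))"
      unfolding *(2,4) by (rule stretchings_imp_bonnesen_equality[OF w(1) AB'(1-3) *(1,3)])
  qed
qed

end
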